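(* Let $\mathcal{A}$ be the commutative subalgebra of $\mathcal{H}(G,I)$ generated by the elements $\Theta_{1,0}$, $\Theta_{-1,0}$, $\Theta_{0,1}$ and $\Theta_{0,-1}$. Then $\mathcal{A}$ is isomorphic, as a $\mathbb{C}$-algebra, to the quotient of the algebra $\mathbb{C}[X,X^{-1},Y,Z]$ by the relation $YZ=0$.
   Context: $F$ is a two-dimensional local field with last residue field $F_0=\mathbb{F}_q$, and $v:F^\times\to\mathbb{Z}^2$ is a fixed discrete valuation of rank two, where $\mathbb{Z}^2$ carries the lexicographic order from the right: $(i,j)<(k,l)$ iff $j<l$, or $j=l$ and $i<k$. $t_1,t_2$ are local parameters, with $v(t_1)=(1,0)$, $v(t_2)=(0,1)$. $O=\{x\in F: x=0 \text{ or } v(x)\ge(0,0)\}$, with $O/t_1O=\mathbb{F}_q$. $G=SL_2(F)$, and $I=\left\{\begin{pmatrix} a&b\\c&d\end{pmatrix}\in SL_2(O): c\in t_1O\right\}$. For $(i,j)\in\mathbb{Z}^2$ set $\eta^{(1)}_{i,j}=\begin{pmatrix} t_1^i t_2^j & 0\\ 0 & t_1^{-i}t_2^{-j}\end{pmatrix}$, $\eta^{(2)}_{i,j}=\begin{pmatrix} 0 & t_1^i t_2^j\\ -t_1^{-i}t_2^{-j} & 0\end{pmatrix}$, and $C^{(a)}_{i,j}=I\eta^{(a)}_{i,j}I$. By the (known) Bruhat decomposition, $G$ is the disjoint union of all the $C^{(a)}_{i,j}$, $a\in\{1,2\}$, $(i,j)\in\mathbb{Z}^2$. Let $\eta$ be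 the map on $G$ with $\eta(x)=\eta^{(a)}_{i,j}$ for $x\in C^{(a)}_{i,j}$. Let $\chi^{(a)}_{i,j}$ be the characteristic function of $C^{(a)}_{i,j}$, and $C_j=\bigcup_{m\in\mathbb{Z}}(C^{(1)}_{m,j}\cup C^{(2)}_{m,j})$. The convolution product is defined by $$(\chi^{(a)}_{i,j}*\chi^{(b)}_{k,l})(x)=\begin{cases} q^{-1}\sum_z \chi^{(a)}_{i,j}(\eta(x)z^{-1}) & \text{if } x\in C_{j+l}\text{ and } jl\ge0,\\ 0 & \text{otherwise,}\end{cases}$$ where $z$ runs over a set of representatives of the decomposition $C^{(b)}_{k,l}=\coprod_z Iz$ into right cosets of $I$; the sum has only finitely many nonzero terms for each $x$. $\mathcal{H}(G,I)$ is the $\mathbb{C}$-vector space generated by the functions $\sum_{r\le i}c_r\chi^{(a)}_{r,j}$ ($j>0$), $\sum_{r\ge i}c_r\chi^{(a)}_{r,j}$ ($j<0$), and $\sum_{i\le r\le i'}c_r\chi^{(a)}_{r,0}$, with $i,i',j\in\mathbb{Z}$, $a\in\{1,2\}$, $c_r\in\mathbb{C}$. The product $*$ is extended (infinite-)linearly to $\mathcal{H}(G,I)$, i.e. $(\sum_\alpha c_\alpha\alpha)*(\sum_\beta d_\beta\beta)=\sum_{\alpha,\beta}c_\alpha d_\beta\,\alpha*\beta$ for $\alpha,\beta$ running over the functions $\chi^{(a)}_{i,j}$, which is well-defined since only finitely many terms contribute to each coefficient. The element $\iota=q\chi^{(1)}_{0,0}$ is the identity. Define $\Theta_{1,0}=\chi^{(1)}_{1,0}$,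 $\Theta_{-1,0}=\chi^{(1)}_{-1,0}-(q-1)\chi^{(2)}_{-1,0}-(q-1)\chi^{(2)}_{0,0}+q(q+q^{-1}-2)\chi^{(1)}_{0,0}$, $\Theta_{0,1}=\chi^{(1)}_{0,1}$, $\Theta_{0,-1}=\chi^{(1)}_{0,-1}-(q-1)\sum_{i\ge0}q^i\chi^{(2)}_{i,-1}$. These four elements commute with each other and $\Theta_{1,0}^{-1}=\Theta_{-1,0}$. *)

theory Defs
  imports
    "HOL-Analysis.Analysis"
    "HOL-Algebra.QuotRing"
    "HOL-Algebra.Module"
    "HOL-Library.Poly_Mapping"
begin

section \<open>Two-dimensional local fields\<close>

text \<open>Valuations are total functions; their value at zero is irrelevant and is never used.\<close>

definition discrete_valuation :: "'a ring \<Rightarrow> ('a \<Rightarrow> int) \<Rightarrow> bool" where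
  "discrete_valuation K w \<longleftrightarrow>
     field K \<and>
     w ` (carrier K - {\<zero>\<^bsub>K\<^esub>}) = UNIV \<and>
     (\<forall>x \<in> carrier K - {\<zero>\<^bsub>K\<^esub>}. \<forall>y \<in> carrier K - {\<zero>\<^bsub>K\<^esub>}.
        w (x \<otimes>\<^bsub>K\<^esub> y) = w x + w y \<and>
        (x \<oplus>\<^bsub>K\<^esub> y \<noteq> \<zero>\<^bsub>K\<^esub> \<longrightarrow> min (w x) (w y) \<le> w (x \<oplus>\<^bsub>K\<^esub> y)))"

definition valuation_ge :: "'a ring \<Rightarrow> ('a \<Rightarrow> int) \<Rightarrow> int \<Rightarrow> 'a set" where
  "valuation_ge K w n = {x \<in> carrier K. x = \<zero>\<^bsub>K\<^esub> \<or> n \<le> w x}"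

definition residue_field :: "'a ring \<Rightarrow> ('a \<Rightarrow> int) \<Rightarrow> 'a set ring" where
  "residue_field K w = (K\<lparr>carrier := valuation_ge K w 0\<rparr>) Quot (valuation_ge K w 1)"

definition valuation_complete :: "'a ring \<Rightarrow> ('a \<Rightarrow> int) \<Rightarrow> bool" where
  "valuation_complete K w \<longleftrightarrow>
     (\<forall>s :: nat \<Rightarrow> 'a.
        range s \<subseteq> carrier K \<and>
        (\<forall>N. \<exists>n0. \<forall>m\<ge>n0. \<forall>n\<ge>n0. s m \<ominus>\<^bsub>K\<^esub> s n \<in> valuation_ge K w N) \<longrightarrow>
        (\<exists>l \<in> carrier K. \<forall>N. \<exists>n0. \<forall>n\<ge>n0. s n \<ominus>\<^bsub>K\<^esub> l \<in> valuation_ge K w N))"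

definition local_field :: "'a ring \<Rightarrow> nat \<Rightarrow> bool" where
  "local_field K q \<longleftrightarrow>
     (\<exists>w. discrete_valuation K w \<and> valuation_complete K w \<and>
          finite (carrier (residue_field K w)) \<and> card (carrier (residue_field K w)) = q)"

definition two_dim_local_field :: "'a ring \<Rightarrow> nat \<Rightarrow> bool" where
  "two_dim_local_field K q \<longleftrightarrow>
     (\<exists>w. discrete_valuation K w \<and> valuation_complete K w \<and> local_field (residue_field K w) q)"

definition ring_of_class :: "'a::comm_ring_1 ring" where
  "ring_of_class = \<lparr>carrier = UNIV, mult = (*), one = 1, zero = 0, add = (+)\<rparr>"

definition lex_le :: "int \<times> int \<Rightarrow> int \<times> int \<Rightarrow> bool"  \<comment> \<open>lexicographic from the right\<close> where
  "lex_le m n \<longleftrightarrow> snd m < snd n \<or> snd m = snd n \<and> fst m \<le> fst n"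

definition rank_two_valuation :: "('f::field \<Rightarrow> int \<times> int) \<Rightarrow> bool" where
  "rank_two_valuation v \<longleftrightarrow>
     v ` (- {0}) = UNIV \<and>
     (\<forall>x y. x \<noteq> 0 \<and> y \<noteq> 0 \<longrightarrow>
        v (x * y) = (fst (v x) + fst (v y), snd (v x) + snd (v y)) \<and>
        (x + y \<noteq> 0 \<longrightarrow> lex_le (v x) (v (x + y)) \<or> lex_le (v y) (v (x + y))))"


section \<open>The group, its Iwahori subgroup and double cosets\<close>

definition SL2 :: "('f::field ^ 2 ^ 2) monoid" where
  "SL2 = \<lparr>carrier = {A. det A = 1}, mult = (**), one = mat 1\<rparr>"

definition mat2 :: "'f::field \<Rightarrow> 'f \<Rightarrow> 'f \<Rightarrow> 'f \<Rightarrow> 'f ^ 2 ^ 2" where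
  "mat2 a b c d = vector [vector [a, b], vector [c, d]]"

text \<open>The upper index \<open>a \<in> {1, 2}\<close>: \<open>Diag\<close> stands for 1 and \<open>Anti\<close> for 2.\<close>

datatype kind = Diag | Anti

locale sl2_data =
  fixes v :: "'f::field \<Rightarrow> int \<times> int"
    and t1 t2 :: 'f
    and q :: nat
begin

definition int_ring :: "'f set" where
  "int_ring = {x. x = 0 \<or> lex_le (0, 0) (v x)}"

definition t1_ideal :: "'f set" where
  "t1_ideal = (*) t1 ` int_ring"

definition iwahori :: "('f ^ 2 ^ 2) set" where
  "iwahori = {A \<in> carrier SL2. (\<forall>i j. A $ i $ j \<in> int_ring) \<and> A $ 2 $ 1 \<in> t1_ideal}"

fun eta :: "kind \<Rightarrow> int \<Rightarrow> int \<Rightarrow> 'f ^ 2 ^ 2" where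
  "eta Diag i j = mat2 (t1 powi i * t2 powi j) 0 0 (t1 powi (- i) * t2 powi (- j))"
| "eta Anti i j = mat2 0 (t1 powi i * t2 powi j) (- (t1 powi (- i) * t2 powi (- j))) 0"

definition cell :: "kind \<Rightarrow> int \<Rightarrow> int \<Rightarrow> ('f ^ 2 ^ 2) set" where
  "cell a i j = iwahori <#>\<^bsub>SL2\<^esub> {eta a i j} <#>\<^bsub>SL2\<^esub> iwahori"

definition level :: "int \<Rightarrow> ('f ^ 2 ^ 2) set" where
  "level j = (\<Union>m. cell Diag m j \<union> cell Anti m j)"

definition eta_of :: "'f ^ 2 ^ 2 \<Rightarrow> 'f ^ 2 ^ 2" where
  "eta_of x = (THE y. \<exists>a i j. x \<in> cell a i j \<and> y = eta a i j)"

text \<open>Functions on \<open>SL2\<close> are represented as functions on all matrices, vanishing off \<open>SL2\<close>.\<close>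

definition chi :: "kind \<Rightarrow> int \<Rightarrow> int \<Rightarrow> 'f ^ 2 ^ 2 \<Rightarrow> complex" where
  "chi a i j = indicator (cell a i j)"


section \<open>Convolution and the Hecke algebra\<close>

text \<open>
  All infinite sums below are meant for families with only finitely many nonzero terms.
  The sum over representatives \<open>z\<close> of the right cosets contained in a double coset is a sum over
  these cosets, with \<open>z\<close> chosen in each; the summand does not depend on the choice, because
  \<open>chi a i j\<close> is right invariant under the Iwahori subgroup.
\<close>

definition conv_chi :: "kind \<times> int \<times> int \<Rightarrow> kind \<times> int \<times> int \<Rightarrow> 'f ^ 2 ^ 2 \<Rightarrow> complex" where
  "conv_chi = (\<lambda>(a, i, j) (b, k, l) x.
     if x \<in> level (j + l) \<and> 0 \<le> j * l
     then inverse (of_nat q) *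
       (\<Sum>\<^sub>\<infinity>K \<in> (\<lambda>z. iwahori #>\<^bsub>SL2\<^esub> z) ` cell b k l.
          chi a i j (eta_of x \<otimes>\<^bsub>SL2\<^esub> inv\<^bsub>SL2\<^esub> (SOME z. z \<in> K)))
     else 0)"

inductive_set hecke_space :: "('f ^ 2 ^ 2 \<Rightarrow> complex) set" where
  pos: "0 < j \<Longrightarrow> (\<lambda>x. \<Sum>\<^sub>\<infinity>r \<in> {..i}. c r * chi a r j x) \<in> hecke_space"
| neg: "j < 0 \<Longrightarrow> (\<lambda>x. \<Sum>\<^sub>\<infinity>r \<in> {i..}. c r * chi a r j x) \<in> hecke_space"
| zero: "(\<lambda>x. \<Sum>r \<in> {i..i'}. c r * chi a r 0 x) \<in> hecke_space"
| add: "f \<in> hecke_space \<Longrightarrow> g \<in> hecke_space \<Longrightarrow> (\<lambda>x. f x + g x) \<in> hecke_space"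
| scale: "f \<in> hecke_space \<Longrightarrow> (\<lambda>x. c * f x) \<in> hecke_space"

text \<open>
  The (infinite-)linear extension of \<open>conv_chi\<close>. The double cosets being disjoint, the coefficient
  of \<open>chi a i j\<close> in \<open>f\<close> is the value of \<open>f\<close> on \<open>cell a i j\<close>, that is, at \<open>eta a i j\<close>.
\<close>

definition coefficient :: "('f ^ 2 ^ 2 \<Rightarrow> complex) \<Rightarrow> kind \<times> int \<times> int \<Rightarrow> complex" where
  "coefficient f = (\<lambda>(a, i, j). f (eta a i j))"

definition conv :: "('f ^ 2 ^ 2 \<Rightarrow> complex) \<Rightarrow> ('f ^ 2 ^ 2 \<Rightarrow> complex) \<Rightarrow> 'f ^ 2 ^ 2 \<Rightarrow> complex" where
  "conv f g = (\<lambda>x. \<Sum>\<^sub>\<infinity>(\<alpha>, \<beta>) \<in> UNIV. coefficient f \<alpha> * coefficient g \<beta> * conv_chi \<alpha> \<beta> x)"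

definition iota :: "'f ^ 2 ^ 2 \<Rightarrow> complex" where
  "iota = (\<lambda>x. of_nat q * chi Diag 0 0 x)"

definition hecke_algebra :: "(complex, 'f ^ 2 ^ 2 \<Rightarrow> complex) module" where
  "hecke_algebra =
     \<lparr>carrier = hecke_space, mult = conv, one = iota,
      zero = (\<lambda>x. 0), add = (\<lambda>f g x. f x + g x), smult = (\<lambda>c f x. c * f x)\<rparr>"

definition Theta_1_0 :: "'f ^ 2 ^ 2 \<Rightarrow> complex" where
  "Theta_1_0 = chi Diag 1 0"

definition Theta_m1_0 :: "'f ^ 2 ^ 2 \<Rightarrow> complex" where
  "Theta_m1_0 = (\<lambda>x.
     chi Diag (- 1) 0 x - (of_nat q - 1) * chi Anti (- 1) 0 x - (of_nat q - 1) * chi Anti 0 0 x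
       + of_nat q * (of_nat q + inverse (of_nat q) - 2) * chi Diag 0 0 x)"

definition Theta_0_1 :: "'f ^ 2 ^ 2 \<Rightarrow> complex" where
  "Theta_0_1 = chi Diag 0 1"

definition Theta_0_m1 :: "'f ^ 2 ^ 2 \<Rightarrow> complex" where
  "Theta_0_m1 = (\<lambda>x.
     chi Diag 0 (- 1) x
       - (of_nat q - 1) * (\<Sum>\<^sub>\<infinity>i \<in> UNIV. of_nat q ^ i * chi Anti (int i) (- 1) x))"

end

locale sl2_two_dim_local_field = sl2_data v t1 t2 q
  for v :: "'f::field \<Rightarrow> int \<times> int" and t1 t2 :: 'f and q :: nat +
  assumes two_dim: "two_dim_local_field (ring_of_class :: 'f ring) q"
    and valuation: "rank_two_valuation v"
    and t1: "t1 \<noteq> 0" "v t1 = (1, 0)"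
    and t2: "t2 \<noteq> 0" "v t2 = (0, 1)"
    \<comment> \<open>identifies \<open>O / t\<^sub>1 O\<close> with the last residue field in \<open>two_dim\<close>, up to isomorphism of finite fields\<close>
    and last_residue_field:
      "card (carrier (((ring_of_class :: 'f ring)\<lparr>carrier := int_ring\<rparr>) Quot t1_ideal)) = q"


section \<open>Subalgebras and algebra isomorphisms\<close>

definition is_subalgebra :: "'a set \<Rightarrow> ('s, 'a) module \<Rightarrow> bool" where
  "is_subalgebra B H \<longleftrightarrow>
     B \<subseteq> carrier H \<and> \<one>\<^bsub>H\<^esub> \<in> B \<and> \<zero>\<^bsub>H\<^esub> \<in> B \<and>
     (\<forall>f \<in> B. \<forall>g \<in> B. f \<oplus>\<^bsub>H\<^esub> g \<in> B \<and> f \<otimes>\<^bsub>H\<^esub> g \<in> B) \<and>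
     (\<forall>c. \<forall>f \<in> B. c \<odot>\<^bsub>H\<^esub> f \<in> B)"

definition generated_subalgebra :: "('s, 'a) module \<Rightarrow> 'a set \<Rightarrow> ('s, 'a) module" where
  "generated_subalgebra H S = H\<lparr>carrier := \<Inter>{B. is_subalgebra B H \<and> S \<subseteq> B}\<rparr>"

definition algebra_isomorphic :: "('s, 'a) module \<Rightarrow> ('s, 'b) module \<Rightarrow> bool" where
  "algebra_isomorphic A B \<longleftrightarrow>
     (\<exists>h \<in> ring_iso A B. \<forall>c. \<forall>f \<in> carrier A. h (c \<odot>\<^bsub>A\<^esub> f) = c \<odot>\<^bsub>B\<^esub> h f)"

definition (in sl2_data) Theta_algebra :: "(complex, 'f ^ 2 ^ 2 \<Rightarrow> complex) module" where
  "Theta_algebra =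
     generated_subalgebra hecke_algebra {Theta_1_0, Theta_m1_0, Theta_0_1, Theta_0_m1}"


section \<open>The algebra \<open>\<complex>[X, X\<inverse>, Y, Z] / (Y Z)\<close>\<close>

text \<open>
  \<open>\<complex>[X, X\<inverse>, Y, Z]\<close> is the monoid algebra of \<open>\<int> \<times> \<nat> \<times> \<nat>\<close>: the monomial
  \<open>X\<^sup>a Y\<^sup>b Z\<^sup>c\<close> is the basis element with exponent \<open>(a, b, c)\<close>, and multiplication of finitely
  supported maps is convolution.
\<close>

type_synonym laurent_XYZ = "(int \<times> nat \<times> nat) \<Rightarrow>\<^sub>0 complex"

definition Y_var :: laurent_XYZ where "Y_var = Poly_Mapping.single (0, 1, 0) 1"

definition Z_var :: laurent_XYZ where "Z_var = Poly_Mapping.single (0, 0, 1) 1"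

definition quotient_algebra_YZ :: "(complex, laurent_XYZ set) module" where
  "quotient_algebra_YZ =
     (let R = ring_of_class :: laurent_XYZ ring;
          I = PIdl\<^bsub>R\<^esub> (Y_var * Z_var);
          Q = R Quot I
      in ring.extend Q
           \<lparr>smult = (\<lambda>c K. (I +>\<^bsub>R\<^esub> Poly_Mapping.single 0 c) \<otimes>\<^bsub>Q\<^esub> K)\<rparr>)"

end

theory Submission
  imports Defs "HOL-Computational_Algebra.Formal_Laurent_Series"
begin

text \<open>
  Write \<open>X\<close>, \<open>Y\<close>, \<open>Z\<close> for \<open>\<Theta>\<^bsub>1,0\<^esub>\<close>, \<open>\<Theta>\<^bsub>0,1\<^esub>\<close>, \<open>\<Theta>\<^bsub>0,-1\<^esub>\<close>. The convolution of functions of levels of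
  opposite signs is zero by definition, so \<open>YZ = ZY = 0\<close>. What has to be shown is that the
  monomials \<open>X\<^sup>a Y\<^sup>b\<close> and \<open>X\<^sup>a Z\<^sup>c\<close> multiply as in the Laurent polynomial ring (\<open>EF_mult\<close>) and are
  linearly independent (\<open>\<Phi>_eq_0_iff\<close>). Then the linear map \<open>\<Phi>\<close> sending a Laurent polynomial to the
  corresponding combination of monomials is multiplicative, its image is the algebra generated by
  the four elements, and its kernel is the ideal generated by \<open>YZ\<close>. The products of monomials are
  computed one pair of factors at a time, because the truncation to one level does not respect
  products in general.

  A biinvariant function is a family of coefficients indexed by the double cosets of the Iwahori
  subgroup \<open>I\<close>. A matrix lies in the double coset determined by its entry of smallest weight
  (\<open>Cell_iff_lead\<close>), and this makes every product of matrices below easy to locate.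

  \<^item> Level zero. The element \<open>X\<close> is \<open>q\<^sup>-\<^sup>1 T\<^sub>s T\<^sub>0\<close> for the two simple reflections \<open>s\<close> and \<open>s\<^sub>0\<close>. Their double
    cosets consist of \<open>q\<close> left cosets of \<open>I\<close>, so that left convolution with them is an explicit
    operator on coefficients (\<open>Ls\<close>, \<open>L0\<close>), which satisfies a quadratic relation. Hence left
    convolution with \<open>X\<close> is an invertible operator \<open>LX\<close>. It is triangular with respect to the sign of
    the level, which is why the truncation does no harm to its powers. An anti-automorphism of
    \<open>SL2\<close> preserving \<open>I\<close> turns left into right convolution.

  \<^item> Positive levels. Lengths add, and \<open>X\<^sup>a Y\<^sup>b\<close> is a multiple of a single characteristic function
    (\<open>full_conv_positive\<close>).

  \<^item> Negative levels. Functions of a fixed negative level, with coefficients bounded below, are pairs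
    \<open>(A, B)\<close> of Laurent series. Counting cosets (\<open>full_conv_negative\<close>) shows that left convolution
    with \<open>(A, B)\<close> is multiplication of both components by \<open>q\<^sup>-\<^sup>1 (A + c B)\<close> for a fixed series \<open>c\<close>.
    As \<open>Z\<close> is the pair \<open>(1, d)\<close> for a series \<open>d\<close> and \<open>X\<close> acts as \<open>q x\<close>, where \<open>x\<close> is the variable, \<open>X\<^sup>a Z\<^sup>m\<close>
    is a multiple of \<open>x\<^sup>a \<phi>\<^bsup>m-1\<^esup> (1, d)\<close> with \<open>\<phi> = 1 + c d\<close>. The field of Laurent series has no zero
    divisors and \<open>\<phi>\<close> has constant term 1, so these are linearly independent.
\<close>

section \<open>Matrices and the valuation ring\<close>

text \<open>Valuations form a group, so only the sign of an element in the lexicographic order from the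
  right has to be considered.\<close>

definition lex_nonneg :: "int \<times> int \<Rightarrow> bool" where
  "lex_nonneg e \<longleftrightarrow> snd e > 0 \<or> snd e = 0 \<and> fst e \<ge> 0"

definition lex_pos :: "int \<times> int \<Rightarrow> bool" where
  "lex_pos e \<longleftrightarrow> snd e > 0 \<or> snd e = 0 \<and> fst e > 0"

lemma mat2_nth [simp]:
  "mat2 a b c d $ 1 $ 1 = a" "mat2 a b c d $ 1 $ 2 = b"
  "mat2 a b c d $ 2 $ 1 = c" "mat2 a b c d $ 2 $ 2 = d"
  by (simp_all add: mat2_def vector_2)

lemma mat2_cases: obtains a b c d where "A = mat2 a b c d"
proof
  show "A = mat2 (A $ 1 $ 1) (A $ 1 $ 2) (A $ 2 $ 1) (A $ 2 $ 2)"
    by (simp add: vec_eq_iff forall_2)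
qed

lemma mat2_eq_iff [simp]: "mat2 a b c d = mat2 a' b' c' d' \<longleftrightarrow> a = a' \<and> b = b' \<and> c = c' \<and> d = d'"
  by (simp add: vec_eq_iff forall_2)

lemma mat2_mult [simp]:
  "mat2 a b c d ** mat2 a' b' c' d' =
   mat2 (a * a' + b * c') (a * b' + b * d') (c * a' + d * c') (c * b' + d * d')"
  by (simp add: vec_eq_iff forall_2 matrix_matrix_mult_def sum_2)

lemma det_mat2 [simp]: "det (mat2 a b c d) = a * d - b * c"
  by (simp add: det_2)

lemma mat_1_mat2: "mat 1 = mat2 1 0 0 1"
  by (simp add: vec_eq_iff forall_2 mat_def)

lemma carrier_SL2 [simp]: "A \<in> carrier SL2 \<longleftrightarrow> det A = 1"
  by (simp add: SL2_def)

lemma mult_SL2 [simp]: "A \<otimes>\<^bsub>SL2\<^esub> B = A ** B"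
  by (simp add: SL2_def)

lemma one_SL2 [simp]: "\<one>\<^bsub>SL2\<^esub> = mat 1"
  by (simp add: SL2_def)

text \<open>The adjugate, which is the inverse on \<open>SL2\<close>.\<close>

definition adj :: "'f::field ^ 2 ^ 2 \<Rightarrow> 'f ^ 2 ^ 2" where
  "adj A = mat2 (A $ 2 $ 2) (- A $ 1 $ 2) (- A $ 2 $ 1) (A $ 1 $ 1)"

lemma adj_mat2 [simp]: "adj (mat2 a b c d) = mat2 d (- b) (- c) a"
  by (simp add: adj_def)

lemma det_adj [simp]: "det (adj A) = det A"
  by (cases A rule: mat2_cases) (simp add: mult.commute)

lemma adj_adj [simp]: "adj (adj A) = A"
  by (cases A rule: mat2_cases) simp

lemma adj_mult: "adj (A ** B) = adj B ** adj A"
  by (cases A rule: mat2_cases, cases B rule: mat2_cases) (simp add: algebra_simps)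

lemma adj_inverse:
  assumes "det A = 1"
  shows "adj A ** A = mat 1" "A ** adj A = mat 1"
  using assms
  by (cases A rule: mat2_cases; simp add: mat_1_mat2 algebra_simps)+

lemma group_SL2: "group (SL2 :: ('f::field ^ 2 ^ 2) monoid)"
proof (rule groupI)
  fix A :: "'f ^ 2 ^ 2" assume "A \<in> carrier SL2"
  then show "\<exists>B\<in>carrier SL2. B \<otimes>\<^bsub>SL2\<^esub> A = \<one>\<^bsub>SL2\<^esub>"
    by (intro bexI [of _ "adj A"]) (simp_all add: adj_inverse)
qed (simp_all add: det_mul matrix_mul_assoc)

lemma inv_SL2: "det A = 1 \<Longrightarrow> inv\<^bsub>SL2\<^esub> A = adj A"
  by (rule group.inv_equality [OF group_SL2]) (simp_all add: adj_inverse)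

context sl2_two_dim_local_field
begin

abbreviation (input) \<O> where "\<O> \<equiv> int_ring"
abbreviation (input) \<P> where "\<P> \<equiv> t1_ideal"

lemma v_mult: "x \<noteq> 0 \<Longrightarrow> y \<noteq> 0 \<Longrightarrow> v (x * y) = v x + v y"
  using valuation unfolding rank_two_valuation_def by (simp add: prod_eq_iff)

lemma v_1 [simp]: "v 1 = 0"
  using v_mult [of 1 1] by simp

lemma v_minus [simp]: "v (- x) = v x"
proof (cases "x = 0")
  case False
  have "v (- 1) + v (- 1) = 0"
    using v_mult [of "- 1" "- 1"] by simp
  then have "v (- 1) = 0"
    by (auto simp: prod_eq_iff)
  then show ?thesis
    using v_mult [of "- 1" x] False by simp
qed simp

lemma v_inverse: "x \<noteq> 0 \<Longrightarrow> v (inverse x) = - v x"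
  using v_mult [of x "inverse x"] by (simp add: eq_neg_iff_add_eq_0 add.commute)

lemma v_divide: "x \<noteq> 0 \<Longrightarrow> y \<noteq> 0 \<Longrightarrow> v (x / y) = v x - v y"
  by (simp add: divide_inverse v_mult v_inverse)

lemma v_power: "x \<noteq> 0 \<Longrightarrow> v (x ^ n) = (int n * fst (v x), int n * snd (v x))"
  by (induction n) (simp_all add: v_mult prod_eq_iff algebra_simps)

lemma v_powi: "x \<noteq> 0 \<Longrightarrow> v (x powi n) = (n * fst (v x), n * snd (v x))"
  by (auto simp: power_int_def v_power v_inverse power_inverse)

lemma int_ring_iff: "x \<in> \<O> \<longleftrightarrow> x = 0 \<or> lex_nonneg (v x)"
  by (auto simp: int_ring_def lex_le_def lex_nonneg_def)

lemma t1_ideal_iff: "x \<in> \<P> \<longleftrightarrow> x = 0 \<or> lex_pos (v x)"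
proof
  assume "x \<in> \<P>"
  then obtain y where "y \<in> \<O>" "x = t1 * y"
    by (auto simp: t1_ideal_def)
  then show "x = 0 \<or> lex_pos (v x)"
    using t1 by (auto simp: int_ring_iff v_mult lex_pos_def lex_nonneg_def)
next
  assume *: "x = 0 \<or> lex_pos (v x)"
  have "x / t1 \<in> \<O>"
    using * t1 by (auto simp: int_ring_iff v_divide lex_pos_def lex_nonneg_def)
  then show "x \<in> \<P>"
    using t1 unfolding t1_ideal_def by (intro image_eqI [of _ _ "x / t1"]) auto
qed

lemma int_ring_add: "x \<in> \<O> \<Longrightarrow> y \<in> \<O> \<Longrightarrow> x + y \<in> \<O>"
  using valuation unfolding rank_two_valuation_def
  by (cases "x = 0"; cases "y = 0"; cases "x + y = 0")
     (auto simp: int_ring_iff lex_nonneg_def lex_le_def, smt+)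

lemma int_ring_mult: "x \<in> \<O> \<Longrightarrow> y \<in> \<O> \<Longrightarrow> x * y \<in> \<O>"
  by (cases "x = 0"; cases "y = 0") (auto simp: int_ring_iff v_mult lex_nonneg_def)

lemma int_ring_minus [simp]: "- x \<in> \<O> \<longleftrightarrow> x \<in> \<O>"
  by (simp add: int_ring_iff)

lemma int_ring_diff: "x \<in> \<O> \<Longrightarrow> y \<in> \<O> \<Longrightarrow> x - y \<in> \<O>"
  using int_ring_add [of x "- y"] by simp

lemma int_ring_0 [simp]: "0 \<in> \<O>" and int_ring_1 [simp]: "1 \<in> \<O>"
  by (simp_all add: int_ring_iff lex_nonneg_def)

lemma t1_ideal_0 [simp]: "0 \<in> \<P>" and t1_ideal_1 [simp]: "1 \<notin> \<P>"
  by (simp_all add: t1_ideal_iff lex_pos_def)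

lemma t1_ideal_subset: "x \<in> \<P> \<Longrightarrow> x \<in> \<O>"
  by (auto simp: t1_ideal_iff int_ring_iff lex_pos_def lex_nonneg_def)

lemma t1_ideal_minus [simp]: "- x \<in> \<P> \<longleftrightarrow> x \<in> \<P>"
  by (simp add: t1_ideal_iff)

lemma t1_ideal_add: "x \<in> \<P> \<Longrightarrow> y \<in> \<P> \<Longrightarrow> x + y \<in> \<P>"
  unfolding t1_ideal_def using int_ring_add by (auto simp: distrib_left [symmetric])

lemma t1_ideal_diff: "x \<in> \<P> \<Longrightarrow> y \<in> \<P> \<Longrightarrow> x - y \<in> \<P>"
  using t1_ideal_add [of x "- y"] by simp

lemma t1_ideal_mult: "x \<in> \<P> \<Longrightarrow> y \<in> \<O> \<Longrightarrow> x * y \<in> \<P>"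
  unfolding t1_ideal_def using int_ring_mult by (auto simp: mult.assoc)

lemma t1_ideal_mult': "x \<in> \<O> \<Longrightarrow> y \<in> \<P> \<Longrightarrow> x * y \<in> \<P>"
  by (metis mult.commute t1_ideal_mult)

lemma t1_mult_t1_ideal [simp]: "t1 * x \<in> \<P> \<longleftrightarrow> x \<in> \<O>"
  using t1 by (auto simp: t1_ideal_def)

lemmas valuation_ring_intros =
  int_ring_add int_ring_mult int_ring_diff t1_ideal_add t1_ideal_mult t1_ideal_mult' t1_ideal_diff

lemma int_ring_total: "x \<noteq> 0 \<Longrightarrow> x \<notin> \<O> \<Longrightarrow> inverse x \<in> \<P>"
  by (auto simp: int_ring_iff t1_ideal_iff v_inverse lex_pos_def lex_nonneg_def)

lemma unit_iff: "x \<in> \<O> \<and> x \<notin> \<P> \<longleftrightarrow> x \<noteq> 0 \<and> v x = 0"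
  by (auto simp: int_ring_iff t1_ideal_iff lex_pos_def lex_nonneg_def prod_eq_iff)

lemma unit_add: "x \<in> \<O> \<Longrightarrow> x \<notin> \<P> \<Longrightarrow> y \<in> \<P> \<Longrightarrow> x + y \<noteq> 0 \<and> v (x + y) = 0"
  using t1_ideal_diff [of "x + y" y] t1_ideal_subset [of y] int_ring_add [of x y]
  by (simp flip: unit_iff) blast

subsection \<open>The elements \<open>t1\<^sup>i t2\<^sup>j\<close>\<close>

definition mon :: "int \<Rightarrow> int \<Rightarrow> 'f" where
  "mon i j = t1 powi i * t2 powi j"

lemma mon_nonzero [simp]: "mon i j \<noteq> 0"
  using t1 t2 by (simp add: mon_def)

lemma v_mon [simp]: "v (mon i j) = (i, j)"
  using t1 t2 by (simp add: mon_def v_mult v_powi)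

lemma eta_mon: "eta Diag i j = mat2 (mon i j) 0 0 (inverse (mon i j))"
  "eta Anti i j = mat2 0 (mon i j) (- inverse (mon i j)) 0"
  by (simp_all add: mon_def power_int_minus)

lemma det_eta [simp]: "det (eta \<kappa> i j) = 1"
  by (cases \<kappa>) (simp_all add: eta_mon del: eta.simps)

declare eta.simps [simp del]

text \<open>The last residue field of a two-dimensional local field is finite, so \<open>q\<close> is its number of
  elements and not the default value 0 for the cardinality of an infinite set.\<close>

lemma q_pos: "q > 0"
proof -
  obtain w where w: "local_field (residue_field (ring_of_class :: 'f ring) w) q"
    using two_dim by (auto simp: two_dim_local_field_def)
  then obtain w' where
    fin: "finite (carrier (residue_field (residue_field (ring_of_class :: 'f ring) w) w'))"
    and card: "card (carrier (residue_field (residue_field (ring_of_class :: 'f ring) w) w')) = q"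
    and dv: "discrete_valuation (residue_field (ring_of_class :: 'f ring) w) w'"
    by (auto simp: local_field_def)
  let ?K = "residue_field (ring_of_class :: 'f ring) w"
  interpret K: field ?K
    using dv by (simp add: discrete_valuation_def)
  have "\<zero>\<^bsub>?K\<^esub> \<in> valuation_ge ?K w' 0"
    by (simp add: valuation_ge_def)
  then have "carrier (residue_field ?K w') \<noteq> {}"
    by (auto simp: residue_field_def FactRing_def A_RCOSETS_def')
  then show ?thesis
    using fin card by (auto simp: card_gt_0_iff)
qed

end

context sl2_two_dim_local_field
begin

section \<open>The Iwahori subgroup and its double cosets\<close>

lemma iwahori_mat2 [simp]:
  "mat2 a b c d \<in> iwahori \<longleftrightarrow> a * d - b * c = 1 \<and> a \<in> \<O> \<and> b \<in> \<O> \<and> d \<in> \<O> \<and> c \<in> \<P>"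
  using t1_ideal_subset by (auto simp: iwahori_def forall_2)

lemma det_iwahori: "A \<in> iwahori \<Longrightarrow> det A = 1"
  by (simp add: iwahori_def)

lemma mat_1_iwahori [simp]: "mat 1 \<in> iwahori"
  by (simp add: mat_1_mat2)

lemma iwahori_mult: "A \<in> iwahori \<Longrightarrow> B \<in> iwahori \<Longrightarrow> A ** B \<in> iwahori"
proof (cases A rule: mat2_cases, cases B rule: mat2_cases)
  fix a b c d a' b' c' d'
  assume *: "A \<in> iwahori" "B \<in> iwahori" "A = mat2 a b c d" "B = mat2 a' b' c' d'"
  then have "det (A ** B) = 1"
    by (simp only: det_mul det_iwahori) simp
  moreover have "a * a' + b * c' \<in> \<O>" "a * b' + b * d' \<in> \<O>" "c * b' + d * d' \<in> \<O>"
    "c * a' + d * c' \<in> \<P>"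
    using *(1,2) unfolding *(3,4) iwahori_mat2
    by (blast intro: valuation_ring_intros t1_ideal_subset)+
  ultimately show ?thesis
    using * by simp
qed

lemma iwahori_adj [simp]: "adj A \<in> iwahori \<longleftrightarrow> A \<in> iwahori"
  by (cases A rule: mat2_cases) (auto simp: mult.commute)

lemma iwahori_diagonal_units:
  assumes "mat2 p r s t \<in> iwahori"
  shows "p \<in> \<O> - \<P>" "t \<in> \<O> - \<P>"
proof -
  have *: "p \<in> \<O>" "t \<in> \<O>" "r * s \<in> \<P>" and eq: "p * t = 1 + r * s"
    using assms by (auto intro!: valuation_ring_intros simp: algebra_simps)
  have "p * t \<notin> \<P>"
  proof
    assume "p * t \<in> \<P>"
    then have "p * t - r * s \<in> \<P>" using * by (intro t1_ideal_diff)
    then show False using eq by simp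
  qed
  then show "p \<in> \<O> - \<P>" "t \<in> \<O> - \<P>"
    using * by (auto intro: valuation_ring_intros)
qed

definition Eta :: "kind \<times> int \<times> int \<Rightarrow> 'f ^ 2 ^ 2" where
  "Eta = (\<lambda>(\<kappa>, i, j). eta \<kappa> i j)"

definition Cell :: "kind \<times> int \<times> int \<Rightarrow> ('f ^ 2 ^ 2) set" where
  "Cell = (\<lambda>(\<kappa>, i, j). cell \<kappa> i j)"

lemma det_Eta [simp]: "det (Eta \<gamma>) = 1"
  by (cases \<gamma>) (simp add: Eta_def)

lemma Cell_iff: "M \<in> Cell \<gamma> \<longleftrightarrow> (\<exists>k\<in>iwahori. \<exists>k'\<in>iwahori. M = k ** Eta \<gamma> ** k')"
  by (cases \<gamma>) (auto simp: Cell_def Eta_def cell_def set_mult_def)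

lemma det_Cell: "M \<in> Cell \<gamma> \<Longrightarrow> det M = 1"
  by (auto simp: Cell_iff det_mul det_iwahori)

lemma Eta_in_Cell [simp]: "Eta \<gamma> \<in> Cell \<gamma>"
  unfolding Cell_iff by (rule bexI [of _ "mat 1"], rule bexI [of _ "mat 1"]) simp_all

lemma Cell_mult_left [simp]:
  assumes "k \<in> iwahori"
  shows "k ** M \<in> Cell \<gamma> \<longleftrightarrow> M \<in> Cell \<gamma>"
proof -
  have *: "k ** M \<in> Cell \<gamma>" if "k \<in> iwahori" "M \<in> Cell \<gamma>" for k M
    using that iwahori_mult unfolding Cell_iff by (metis matrix_mul_assoc)
  show ?thesis
    using *[OF assms, of M] *[of "adj k" "k ** M"] assms
    by (auto simp: matrix_mul_assoc adj_inverse det_iwahori)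
qed

lemma Cell_mult_right [simp]:
  assumes "k \<in> iwahori"
  shows "M ** k \<in> Cell \<gamma> \<longleftrightarrow> M \<in> Cell \<gamma>"
proof -
  have *: "M ** k \<in> Cell \<gamma>" if "k \<in> iwahori" "M \<in> Cell \<gamma>" for k M
    using that iwahori_mult unfolding Cell_iff by (metis matrix_mul_assoc)
  show ?thesis
    using *[OF assms, of M] *[of "adj k" "M ** k"] assms
    by (auto simp: adj_inverse det_iwahori simp flip: matrix_mul_assoc)
qed

text \<open>A double coset is recognised by the entry of smallest weight, where an entry \<open>x\<close> on the
  diagonal has weight \<open>2 v(x)\<close> and the off-diagonal entries \<open>b\<close>, \<open>c\<close> have the weights
  \<open>2 v(b) + 1\<close>, \<open>2 v(c) - 1\<close> in the first component. Multiplication by the Iwahori subgroup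
  changes the leading entry by a unit only, as all the other contributions to it have larger weight.\<close>

definition lead :: "kind \<times> int \<times> int \<Rightarrow> 'f ^ 2 ^ 2 \<Rightarrow> bool" where
  "lead = (\<lambda>(\<kappa>, e) M. det M = 1 \<and>
     (let a = M $ 1 $ 1; b = M $ 1 $ 2; c = M $ 2 $ 1; d = M $ 2 $ 2 in
      case \<kappa> of
        Diag \<Rightarrow> (if \<not> lex_pos e then a \<noteq> 0 \<and> v a = e \<and> b / a \<in> \<O> \<and> c / a \<in> \<P>
                 else d \<noteq> 0 \<and> v d = - e \<and> b / d \<in> \<O> \<and> c / d \<in> \<P>)
      | Anti \<Rightarrow> (if \<not> lex_nonneg e then b \<noteq> 0 \<and> v b = e \<and> a / b \<in> \<P> \<and> d / b \<in> \<P>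
                 else c \<noteq> 0 \<and> v c = - e \<and> a / c \<in> \<O> \<and> d / c \<in> \<O>)))"

lemma lead_simps:
  "lead (Diag, e) (mat2 a b c d) \<longleftrightarrow> a * d - b * c = 1 \<and>
     (if \<not> lex_pos e then a \<noteq> 0 \<and> v a = e \<and> b / a \<in> \<O> \<and> c / a \<in> \<P>
      else d \<noteq> 0 \<and> v d = - e \<and> b / d \<in> \<O> \<and> c / d \<in> \<P>)"
  "lead (Anti, e) (mat2 a b c d) \<longleftrightarrow> a * d - b * c = 1 \<and>
     (if \<not> lex_nonneg e then b \<noteq> 0 \<and> v b = e \<and> a / b \<in> \<P> \<and> d / b \<in> \<P>
      else c \<noteq> 0 \<and> v c = - e \<and> a / c \<in> \<O> \<and> d / c \<in> \<O>)"
  by (simp_all add: lead_def Let_def)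

lemma leading_entry_change:
  assumes "L \<noteq> 0" "L' / L = u + w" "u \<in> \<O> - \<P>" "w \<in> \<P>"
  shows "L' \<noteq> 0" "v L' = v L" "x / L \<in> \<O> \<Longrightarrow> x / L' \<in> \<O>" "x / L \<in> \<P> \<Longrightarrow> x / L' \<in> \<P>"
proof -
  have *: "L' / L \<noteq> 0" "v (L' / L) = 0"
    using unit_add [of u w] assms by auto
  then show L': "L' \<noteq> 0" "v L' = v L"
    using assms(1) by (auto simp: v_divide)
  show "x / L \<in> \<O> \<Longrightarrow> x / L' \<in> \<O>" "x / L \<in> \<P> \<Longrightarrow> x / L' \<in> \<P>"
    using L' assms(1) by (cases "x = 0"; auto simp: int_ring_iff t1_ideal_iff v_divide)+
qed

text \<open>The valuation of the entry opposite to the leading one is controlled by the determinant and the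
  sign of \<open>e\<close>; the other entries are controlled by \<open>lead\<close> itself.\<close>

lemma lead_mult_left:
  assumes "k \<in> iwahori" "lead \<gamma> M"
  shows "lead \<gamma> (k ** M)"
proof -
  obtain a b c d where M: "M = mat2 a b c d" by (rule mat2_cases)
  obtain p r s t where k: "k = mat2 p r s t" by (rule mat2_cases)
  obtain \<kappa> e where \<gamma>: "\<gamma> = (\<kappa>, e)" by (metis surj_pair)
  have I: "p \<in> \<O> - \<P>" "t \<in> \<O> - \<P>" "p \<in> \<O>" "t \<in> \<O>" "r \<in> \<O>" "s \<in> \<P>"
    using iwahori_diagonal_units [of p r s t] assms by (auto simp: k)
  have det: "a * d - b * c = 1"
    using assms by (cases \<kappa>) (auto simp: \<gamma> M lead_simps)
  have det': "(p * a + r * c) * (s * b + t * d) - (p * b + r * d) * (s * a + t * c) = 1"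
    using assms(1) det_mul [of k M] det by (simp add: k M)
  show ?thesis
  proof (cases \<kappa>)
    case Diag
    show ?thesis
    proof (cases "lex_pos e")
      case False
      have h: "a \<noteq> 0" "v a = e" "b / a \<in> \<O>" "c / a \<in> \<P>"
        using assms False by (auto simp: \<gamma> M Diag lead_simps)
      have "d / a = inverse (a * a) + (b / a) * (c / a)"
        using det h by (simp add: field_simps)
      moreover have "inverse (a * a) \<in> \<O>"
        using h False by (auto simp: int_ring_iff v_inverse v_mult lex_nonneg_def lex_pos_def)
      ultimately have d: "d / a \<in> \<O>"
        using h by (metis int_ring_add int_ring_diff int_ring_mult t1_ideal_diff t1_ideal_mult t1_ideal_subset)
      note * = leading_entry_change [of a "p * a + r * c" p "r * (c / a)"]
      have l: "(p * a + r * c) / a = p + r * (c / a)" "r * (c / a) \<in> \<P>"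
        "(p * b + r * d) / a = p * (b / a) + r * (d / a)"
        "(s * a + t * c) / a = s + t * (c / a)"
        using h(1) by (simp add: field_simps, use h I in \<open>blast intro: valuation_ring_intros\<close>,
            simp_all add: field_simps)
      have "(p * b + r * d) / a \<in> \<O>" "(s * a + t * c) / a \<in> \<P>"
        unfolding l using h I d by (blast intro: valuation_ring_intros t1_ideal_subset)+
      then show ?thesis
        using * h I l det' False by (simp add: \<gamma> M k Diag lead_simps)
    next
      case True
      have h: "d \<noteq> 0" "v d = - e" "b / d \<in> \<O>" "c / d \<in> \<P>"
        using assms True by (auto simp: \<gamma> M Diag lead_simps)
      have "a / d = inverse (d * d) + (b / d) * (c / d)"
        using det h by (simp add: field_simps)
      moreover have "inverse (d * d) \<in> \<O>"
        using h True by (auto simp: int_ring_iff v_inverse v_mult lex_nonneg_def lex_pos_def)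
      ultimately have a: "a / d \<in> \<O>"
        using h by (metis int_ring_add int_ring_diff int_ring_mult t1_ideal_diff t1_ideal_mult t1_ideal_subset)
      note * = leading_entry_change [of d "s * b + t * d" t "s * (b / d)"]
      have l: "(s * b + t * d) / d = t + s * (b / d)" "s * (b / d) \<in> \<P>"
        "(p * b + r * d) / d = p * (b / d) + r"
        "(s * a + t * c) / d = s * (a / d) + t * (c / d)"
        using h(1) by (simp add: field_simps, use h I in \<open>blast intro: valuation_ring_intros\<close>,
            simp_all add: field_simps)
      have "(p * b + r * d) / d \<in> \<O>" "(s * a + t * c) / d \<in> \<P>"
        unfolding l using h I a by (blast intro: valuation_ring_intros t1_ideal_subset)+
      then show ?thesis
        using * h I l det' True by (simp add: \<gamma> M k Diag lead_simps)
    qed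
  next
    case Anti
    show ?thesis
    proof (cases "lex_nonneg e")
      case False
      have h: "b \<noteq> 0" "v b = e" "a / b \<in> \<P>" "d / b \<in> \<P>"
        using assms False by (auto simp: \<gamma> M Anti lead_simps)
      have "c / b = (a / b) * (d / b) - inverse (b * b)"
        using det h by (simp add: field_simps)
      moreover have "inverse (b * b) \<in> \<P>"
        using h False by (auto simp: t1_ideal_iff v_inverse v_mult lex_nonneg_def lex_pos_def)
      ultimately have c: "c / b \<in> \<P>"
        using h by (metis int_ring_add int_ring_diff int_ring_mult t1_ideal_diff t1_ideal_mult t1_ideal_subset)
      note * = leading_entry_change [of b "p * b + r * d" p "r * (d / b)"]
      have l: "(p * b + r * d) / b = p + r * (d / b)" "r * (d / b) \<in> \<P>"
        "(p * a + r * c) / b = p * (a / b) + r * (c / b)"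
        "(s * b + t * d) / b = s + t * (d / b)"
        using h(1) by (simp add: field_simps, use h I in \<open>blast intro: valuation_ring_intros\<close>,
            simp_all add: field_simps)
      have "(p * a + r * c) / b \<in> \<P>" "(s * b + t * d) / b \<in> \<P>"
        unfolding l using h I c by (blast intro: valuation_ring_intros t1_ideal_subset)+
      then show ?thesis
        using * h I l det' False by (simp add: \<gamma> M k Anti lead_simps)
    next
      case True
      have h: "c \<noteq> 0" "v c = - e" "a / c \<in> \<O>" "d / c \<in> \<O>"
        using assms True by (auto simp: \<gamma> M Anti lead_simps)
      have "b / c = (a / c) * (d / c) - inverse (c * c)"
        using det h by (simp add: field_simps)
      moreover have "inverse (c * c) \<in> \<O>"
        using h True by (auto simp: int_ring_iff v_inverse v_mult lex_nonneg_def lex_pos_def)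
      ultimately have b: "b / c \<in> \<O>"
        using h by (metis int_ring_diff int_ring_mult)
      note * = leading_entry_change [of c "s * a + t * c" t "s * (a / c)"]
      have l: "(s * a + t * c) / c = t + s * (a / c)" "s * (a / c) \<in> \<P>"
        "(p * a + r * c) / c = p * (a / c) + r"
        "(s * b + t * d) / c = s * (b / c) + t * (d / c)"
        using h(1) by (simp add: field_simps, use h I in \<open>blast intro: valuation_ring_intros\<close>,
            simp_all add: field_simps)
      have "(p * a + r * c) / c \<in> \<O>" "(s * b + t * d) / c \<in> \<O>"
        unfolding l using h I b by (blast intro: valuation_ring_intros t1_ideal_subset)+
      then show ?thesis
        using * h I l det' True by (simp add: \<gamma> M k Anti lead_simps)
    qed
  qed
qed

text \<open>The anti-automorphism \<open>\<sigma>\<close> preserves the Iwahori subgroup. It fixes the cells of kind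
  \<open>Diag\<close> and permutes the cells of kind \<open>Anti\<close>; it turns statements on left multiplication into
  statements on right multiplication.\<close>

definition \<sigma> :: "'f ^ 2 ^ 2 \<Rightarrow> 'f ^ 2 ^ 2" where
  "\<sigma> M = mat2 (M $ 1 $ 1) (- M $ 2 $ 1 / t1) (- t1 * M $ 1 $ 2) (M $ 2 $ 2)"

lemma sigma_mat2 [simp]: "\<sigma> (mat2 a b c d) = mat2 a (- c / t1) (- t1 * b) d"
  by (simp add: \<sigma>_def)

lemma sigma_sigma [simp]: "\<sigma> (\<sigma> M) = M"
  using t1 by (cases M rule: mat2_cases) simp

lemma sigma_mult: "\<sigma> (A ** B) = \<sigma> B ** \<sigma> A"
  using t1 by (cases A rule: mat2_cases, cases B rule: mat2_cases) (simp add: field_simps)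

lemma det_sigma [simp]: "det (\<sigma> M) = det M"
  using t1 by (cases M rule: mat2_cases) simp

lemma sigma_adj: "\<sigma> (adj M) = adj (\<sigma> M)"
  by (cases M rule: mat2_cases) simp

lemma divide_t1_int_ring [simp]: "x / t1 \<in> \<O> \<longleftrightarrow> x \<in> \<P>"
  using t1 t1_mult_t1_ideal [of "x / t1"] by simp

lemma sigma_iwahori [simp]: "\<sigma> M \<in> iwahori \<longleftrightarrow> M \<in> iwahori"
proof -
  obtain a b c d where M: "M = mat2 a b c d" by (rule mat2_cases)
  have eq: "a * d - - c / t1 * (- t1 * b) = a * d - b * c"
    using t1 by simp
  have O: "- c / t1 \<in> \<O> \<longleftrightarrow> c \<in> \<P>"
    using divide_t1_int_ring [of "- c"] by (simp del: divide_t1_int_ring)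
  have P: "- t1 * b \<in> \<P> \<longleftrightarrow> b \<in> \<O>"
    by simp
  show ?thesis
    unfolding M sigma_mat2 iwahori_mat2 eq O P by blast
qed

definition swap :: "kind \<times> int \<times> int \<Rightarrow> kind \<times> int \<times> int" where
  "swap = (\<lambda>(\<kappa>, i, j). case \<kappa> of Diag \<Rightarrow> (Diag, i, j) | Anti \<Rightarrow> (Anti, - 1 - i, - j))"

lemma swap_simps [simp]:
  "swap (Diag, e) = (Diag, e)" "swap (Anti, i, j) = (Anti, - 1 - i, - j)"
  by (simp_all add: swap_def split: prod.splits)

lemma swap_swap [simp]: "swap (swap \<gamma>) = \<gamma>"
  by (simp add: swap_def split: prod.splits kind.splits)

lemma v_t1_mult: "x \<noteq> 0 \<Longrightarrow> v (t1 * x) = v x + (1, 0)"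
  using t1 by (simp add: v_mult add.commute)

lemma lead_sigma:
  assumes "lead \<gamma> M"
  shows "lead (swap \<gamma>) (\<sigma> M)"
proof -
  obtain a b c d where M: "M = mat2 a b c d" by (rule mat2_cases)
  obtain \<kappa> i j where \<gamma>: "\<gamma> = (\<kappa>, i, j)" by (cases \<gamma>) auto
  have det: "a * d - b * c = 1" "a * d - c * b = 1"
    using assms by (cases \<kappa>; auto simp: M \<gamma> lead_simps mult.commute)+
  have O: "x \<in> \<O> \<Longrightarrow> t1 * x \<in> \<P>" "x \<in> \<P> \<Longrightarrow> x / t1 \<in> \<O>" for x
    using t1 t1_mult_t1_ideal [of "x / t1"] by auto
  show ?thesis
  proof (cases \<kappa>)
    case Diag
    have "- c / t1 / x \<in> \<O>" if "c / x \<in> \<P>" for x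
      using O(2) [OF that] int_ring_minus [of "c / x / t1"] by (simp add: mult.commute)
    moreover have "- t1 * b / x \<in> \<P>" if "b / x \<in> \<O>" for x
      using O(1) [OF that] t1_ideal_minus [of "t1 * (b / x)"] by simp
    ultimately show ?thesis
      using assms t1 det by (auto simp: M \<gamma> Diag lead_simps split: if_splits)
  next
    case Anti
    have neg: "- x / (t1 * y) \<in> \<O> \<longleftrightarrow> x / y / t1 \<in> \<O>" "x * t1 / y \<in> \<P> \<longleftrightarrow> x / y \<in> \<O>" for x y
      using int_ring_minus [of "x / y / t1"] t1_mult_t1_ideal [of "x / y"]
      by (simp_all add: mult.commute)
    have lex: "lex_nonneg (- 1 - i, - j) \<longleftrightarrow> \<not> lex_nonneg (i, j)"
      by (auto simp: lex_nonneg_def)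
    have "x / (- (t1 * b)) \<in> \<O>" if "x / b \<in> \<P>" for x
      using O(2) [OF that] int_ring_minus [of "x / b / t1"] by (simp add: mult.commute)
    moreover have "x / (- (c / t1)) \<in> \<P>" if "x / c \<in> \<O>" for x
      using O(1) [OF that] t1_ideal_minus [of "t1 * (x / c)"] by (simp add: mult.commute)
    ultimately show ?thesis
      using assms t1 lex det
      by (auto simp: M \<gamma> Anti lead_simps v_t1_mult v_divide v_mult prod_eq_iff split: if_splits)
  qed
qed

lemma lead_mult_right:
  assumes "k \<in> iwahori" "lead \<gamma> M"
  shows "lead \<gamma> (M ** k)"
  using lead_sigma [OF lead_mult_left [OF _ lead_sigma [OF assms(2)], of "\<sigma> k"]] assms(1)
  by (simp add: sigma_mult)

lemma lead_Eta: "lead \<gamma> (Eta \<gamma>)"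
proof -
  obtain \<kappa> i j where \<gamma>: "\<gamma> = (\<kappa>, i, j)" by (cases \<gamma>) auto
  show ?thesis
    by (cases \<kappa>) (auto simp: \<gamma> Eta_def eta_mon lead_simps v_inverse)
qed

lemma lead_of_Cell: "M \<in> Cell \<gamma> \<Longrightarrow> lead \<gamma> M"
  unfolding Cell_iff using lead_mult_left lead_mult_right lead_Eta by blast

lemma quotient_of_same_valuation:
  assumes "x \<noteq> 0" "y \<noteq> 0" "v x = v y"
  shows "x / y \<in> \<O>"
  using assms by (simp add: int_ring_iff v_divide lex_nonneg_def)

text \<open>Gaussian elimination: a pivot \<open>a\<close>, \<open>d\<close>, \<open>b\<close> or \<open>c\<close> that divides the other entries of its row and
  column in the manner of the Iwahori subgroup determines the double coset.\<close>

lemma Cell_Diag_a: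
  assumes "a * d - b * c = 1" "a \<noteq> 0" "b / a \<in> \<O>" "c / a \<in> \<P>"
  shows "mat2 a b c d \<in> Cell (Diag, v a)"
proof -
  obtain i j where e: "v a = (i, j)" by (cases "v a")
  let ?m = "mon i j"
  have "mat2 a b c d = mat2 1 0 (c / a) 1 ** Eta (Diag, i, j) **
      mat2 (a / ?m) (b / ?m) 0 (?m / a)"
    using assms(1,2) by (simp add: Eta_def eta_mon field_simps)
  moreover have "b / ?m \<in> \<O>"
    using int_ring_mult [OF assms(3) quotient_of_same_valuation [of a ?m]] assms(2) e by simp
  ultimately show ?thesis
    unfolding Cell_iff e using assms e
    by (intro bexI [of _ "mat2 1 0 (c / a) 1"] bexI [of _ "mat2 (a / ?m) (b / ?m) 0 (?m / a)"])
       (auto simp: quotient_of_same_valuation)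
qed

lemma Cell_Diag_d:
  assumes "a * d - b * c = 1" "d \<noteq> 0" "b / d \<in> \<O>" "c / d \<in> \<P>"
  shows "mat2 a b c d \<in> Cell (Diag, - v d)"
proof -
  obtain i j where e: "v d = (i, j)" by (cases "v d")
  let ?m = "mon (- i) (- j)"
  have v: "v (?m * d) = 0" using assms(2) e by (simp add: v_mult prod_eq_iff)
  have "mat2 a b c d = mat2 1 (b / d) 0 1 ** Eta (Diag, - i, - j) **
      mat2 (1 / (d * ?m)) 0 (c * ?m) (d * ?m)"
    using assms(1,2) by (simp add: Eta_def eta_mon field_simps)
  moreover have unit: "?m * d \<in> \<O>" "1 / (?m * d) \<in> \<O>"
    using assms(2) v quotient_of_same_valuation [of 1 "?m * d"]
    by (auto simp: int_ring_iff lex_nonneg_def)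
  moreover have "c / d * (?m * d) \<in> \<P>"
    using assms(4) unit(1) by (rule t1_ideal_mult)
  then have "c * ?m \<in> \<P>"
    using assms(2) by simp
  ultimately show ?thesis
    unfolding Cell_iff e using assms e
    by (intro bexI [of _ "mat2 1 (b / d) 0 1"]
          bexI [of _ "mat2 (1 / (d * ?m)) 0 (c * ?m) (d * ?m)"])
       (auto simp: mult.commute)
qed

lemma Cell_Anti_b:
  assumes "a * d - b * c = 1" "b \<noteq> 0" "a / b \<in> \<P>" "d / b \<in> \<P>"
  shows "mat2 a b c d \<in> Cell (Anti, v b)"
proof -
  obtain i j where e: "v b = (i, j)" by (cases "v b")
  let ?m = "mon i j"
  have "mat2 a b c d = mat2 1 0 (d / b) 1 ** Eta (Anti, i, j) **
      mat2 (?m / b) 0 (a / ?m) (b / ?m)"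
    using assms(1,2) by (simp add: Eta_def eta_mon field_simps)
  moreover have "a / ?m \<in> \<P>"
    using t1_ideal_mult [OF assms(3) quotient_of_same_valuation [of b ?m]] assms(2) e by simp
  ultimately show ?thesis
    unfolding Cell_iff e using assms e
    by (intro bexI [of _ "mat2 1 0 (d / b) 1"] bexI [of _ "mat2 (?m / b) 0 (a / ?m) (b / ?m)"])
       (auto simp: quotient_of_same_valuation)
qed

lemma Cell_Anti_c:
  assumes "a * d - b * c = 1" "c \<noteq> 0" "a / c \<in> \<O>" "d / c \<in> \<O>"
  shows "mat2 a b c d \<in> Cell (Anti, - v c)"
proof -
  obtain i j where e: "v c = (i, j)" by (cases "v c")
  let ?m = "mon (- i) (- j)"
  have v: "v (?m * c) = 0" using assms(2) e by (simp add: v_mult prod_eq_iff)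
  have "mat2 a b c d = mat2 1 (a / c) 0 1 ** Eta (Anti, - i, - j) **
      mat2 (- c * ?m) (- d * ?m) 0 (- 1 / (c * ?m))"
    using assms(1,2) by (simp add: Eta_def eta_mon field_simps)
  moreover have unit: "?m * c \<in> \<O>" "1 / (?m * c) \<in> \<O>"
    using assms(2) v quotient_of_same_valuation [of 1 "?m * c"]
    by (auto simp: int_ring_iff lex_nonneg_def)
  moreover have "d / c * (?m * c) \<in> \<O>"
    using assms(4) unit(1) by (rule int_ring_mult)
  then have "d * ?m \<in> \<O>"
    using assms(2) by simp
  moreover have "- 1 / (c * ?m) \<in> \<O> \<longleftrightarrow> 1 / (?m * c) \<in> \<O>"
    using int_ring_minus [of "1 / (?m * c)"] by (simp add: mult.commute)
  ultimately show ?thesis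
    unfolding Cell_iff e using assms e
    by (intro bexI [of _ "mat2 1 (a / c) 0 1"]
          bexI [of _ "mat2 (- c * ?m) (- d * ?m) 0 (- 1 / (c * ?m))"])
       (auto simp: mult.commute)
qed

lemma Cell_iff_lead: "M \<in> Cell \<gamma> \<longleftrightarrow> lead \<gamma> M"
proof
  assume l: "lead \<gamma> M"
  obtain a b c d where M: "M = mat2 a b c d" by (rule mat2_cases)
  obtain \<kappa> e where \<gamma>: "\<gamma> = (\<kappa>, e)" by (metis surj_pair)
  show "M \<in> Cell \<gamma>"
    using l Cell_Diag_a [of a d b c] Cell_Diag_d [of a d b c] Cell_Anti_b [of a d b c]
      Cell_Anti_c [of a d b c]
    by (cases \<kappa>) (auto simp: M \<gamma> lead_simps split: if_splits)
qed (rule lead_of_Cell)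

text \<open>One row operation from the Iwahori subgroup clears \<open>c\<close> or \<open>a\<close>, whichever is larger in the
  valuation. In the remaining triangular matrix one of the entries is a pivot.\<close>

lemma Bruhat_exists:
  assumes "det M = 1"
  shows "\<exists>\<gamma>. M \<in> Cell \<gamma>"
proof -
  obtain a b c d where M: "M = mat2 a b c d" by (rule mat2_cases)
  have det: "a * d - b * c = 1" using assms M by simp
  have dich: "x / y \<in> \<O> \<or> y / x \<in> \<P>" if "x \<noteq> 0" "y \<noteq> 0" for x y
    using int_ring_total [of "x / y"] that by auto
  show ?thesis
  proof (cases "a \<noteq> 0 \<and> c / a \<in> \<P>")
    case True
    define k where "k = mat2 1 0 (- c / a) (1 :: 'f)"
    have k: "k \<in> iwahori" using True by (simp add: k_def)
    have kM: "k ** M = mat2 a b 0 (1 / a)"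
      using True det by (simp add: k_def M field_simps)
    have "\<exists>\<gamma>. k ** M \<in> Cell \<gamma>"
    proof (cases "b = 0 \<or> b / a \<in> \<O>")
      case *: True
      then have "b / a \<in> \<O>" by auto
        have "mat2 a b 0 (1 / a) \<in> Cell (Diag, v a)"
          using \<open>b / a \<in> \<O>\<close> True by (intro Cell_Diag_a) auto
        then show ?thesis
          unfolding kM by blast
    next
      case b: False
      then have ab: "a / b \<in> \<P>" using dich [of b a] True by auto
      show ?thesis
      proof (cases "a * b \<in> \<O>")
        case *: True
        have "mat2 a b 0 (1 / a) \<in> Cell (Diag, - v (1 / a))"
          using * True by (intro Cell_Diag_d) (auto simp: mult.commute)
        then show ?thesis
          unfolding kM by blast
      next
        case *: False
        then have "1 / a / b \<in> \<P>" using int_ring_total [of "a * b"] b True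
          by (auto simp: field_simps)
        have "mat2 a b 0 (1 / a) \<in> Cell (Anti, v b)"
          using \<open>1 / a / b \<in> \<P>\<close> True b ab by (intro Cell_Anti_b) auto
        then show ?thesis
          unfolding kM by blast
      qed
    qed
    then show ?thesis using k by simp
  next
    case False
    have c: "c \<noteq> 0" using False det by auto
    have ac: "a / c \<in> \<O>" using dich [of a c] False c by (cases "a = 0") auto
    define k where "k = mat2 1 (- a / c) 0 (1 :: 'f)"
    have k: "k \<in> iwahori" using ac by (simp add: k_def)
    have kM: "k ** M = mat2 0 (- 1 / c) c d"
      using c det by (simp add: k_def M field_simps)
    have "\<exists>\<gamma>. k ** M \<in> Cell \<gamma>"
    proof (cases "d = 0 \<or> d / c \<in> \<O>")
      case *: True
      then have "d / c \<in> \<O>" by auto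
        have "mat2 0 (- 1 / c) c d \<in> Cell (Anti, - v c)"
          using \<open>d / c \<in> \<O>\<close> c by (intro Cell_Anti_c) auto
        then show ?thesis
          unfolding kM by blast
    next
      case d: False
      then have cd: "c / d \<in> \<P>" using dich [of d c] c by auto
      show ?thesis
      proof (cases "c * d \<in> \<P>")
        case True
        then have "d / (- 1 / c) \<in> \<P>" by (simp add: mult.commute)
        have "mat2 0 (- 1 / c) c d \<in> Cell (Anti, v (- 1 / c))"
          using \<open>d / (- 1 / c) \<in> \<P>\<close> c by (intro Cell_Anti_b) auto
        then show ?thesis
          unfolding kM by blast
      next
        case *: False
        then have "- (1 / (c * d)) \<in> \<O>" using dich [of 1 "c * d"] c d by auto
        then have "- 1 / c / d \<in> \<O>" by simp
        have "mat2 0 (- 1 / c) c d \<in> Cell (Diag, - v d)"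
          using \<open>- 1 / c / d \<in> \<O>\<close> d cd c by (intro Cell_Diag_d) auto
        then show ?thesis
          unfolding kM by blast
      qed
    qed
    then show ?thesis using k by simp
  qed
qed

text \<open>Entries on and off the diagonal cannot both lead. If \<open>a\<close> and \<open>d\<close> both lead, or \<open>b\<close> and \<open>c\<close>, then the
  determinant forces their valuations to be opposite, so both give the same index.\<close>

lemma Cell_disjoint:
  assumes "M \<in> Cell \<gamma>" "M \<in> Cell \<gamma>'"
  shows "\<gamma> = \<gamma>'"
proof -
  obtain a b c d where M: "M = mat2 a b c d" by (rule mat2_cases)
  have det: "a * d - b * c = 1" using det_Cell [OF assms(1)] M by simp
  have contra: False if "x / y \<in> \<O>" "y / x \<in> \<P>" "x \<noteq> 0" "y \<noteq> 0" for x y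
    using t1_ideal_mult [OF that(2,1)] that(3,4) by simp
  have ad: "v a + v d = 0" if "a \<noteq> 0" "d \<noteq> 0" "b / a \<in> \<O>" "c / d \<in> \<P>"
  proof -
    have "1 / (a * d) = (a * d - b * c) / (a * d)" using det by simp
    also have "\<dots> = 1 + - ((b / a) * (c / d))" using that by (simp add: diff_divide_distrib)
    finally have eq: "1 / (a * d) = 1 + - ((b / a) * (c / d))" .
    have "- ((b / a) * (c / d)) \<in> \<P>"
      using that by (simp only: t1_ideal_minus t1_ideal_mult')
    then have "v (1 / (a * d)) = 0"
      unfolding eq by (intro unit_add [THEN conjunct2]) simp_all
    then show ?thesis using that by (simp add: v_divide v_mult neg_eq_iff_add_eq_0)
  qed
  have bc: "v b + v c = 0" if "b \<noteq> 0" "c \<noteq> 0" "a / c \<in> \<O>" "d / b \<in> \<P>"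
  proof -
    have "- 1 / (b * c) = (b * c - a * d) / (b * c)" using det by (simp add: algebra_simps)
    also have "\<dots> = 1 + - ((a / c) * (d / b))"
      using that by (simp add: diff_divide_distrib mult.commute)
    finally have eq: "- 1 / (b * c) = 1 + - ((a / c) * (d / b))" .
    have "- ((a / c) * (d / b)) \<in> \<P>"
      using that by (simp only: t1_ideal_minus t1_ideal_mult')
    then have "v (- 1 / (b * c)) = 0"
      unfolding eq by (intro unit_add [THEN conjunct2]) simp_all
    then show ?thesis using that by (simp add: v_divide v_mult neg_eq_iff_add_eq_0)
  qed
  obtain \<kappa> e \<kappa>' e' where \<gamma>: "\<gamma> = (\<kappa>, e)" "\<gamma>' = (\<kappa>', e')" by (metis surj_pair)
  have diag: "e = v a \<and> a \<noteq> 0 \<and> b / a \<in> \<O> \<and> c / a \<in> \<P> \<or>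
      e = - v d \<and> d \<noteq> 0 \<and> b / d \<in> \<O> \<and> c / d \<in> \<P>" if "lead (Diag, e) M" for e
    using that by (auto simp: lead_simps M split: if_splits)
  have anti: "e = v b \<and> b \<noteq> 0 \<and> a / b \<in> \<P> \<and> d / b \<in> \<P> \<or>
      e = - v c \<and> c \<noteq> 0 \<and> a / c \<in> \<O> \<and> d / c \<in> \<O>" if "lead (Anti, e) M" for e
    using that by (auto simp: lead_simps M split: if_splits)
  have mixed: False if "lead (Diag, e) M" "lead (Anti, e') M" for e e'
    using diag [OF that(1)] anti [OF that(2)] contra by metis
  have ad': "a \<noteq> 0 \<Longrightarrow> d \<noteq> 0 \<Longrightarrow> b / a \<in> \<O> \<Longrightarrow> c / d \<in> \<P> \<Longrightarrow> v a = - v d"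
    using ad by (simp add: eq_neg_iff_add_eq_0)
  have bc': "b \<noteq> 0 \<Longrightarrow> c \<noteq> 0 \<Longrightarrow> a / c \<in> \<O> \<Longrightarrow> d / b \<in> \<P> \<Longrightarrow> v b = - v c"
    using bc by (simp add: eq_neg_iff_add_eq_0)
  have "e = e'" if "\<kappa> = \<kappa>'"
  proof (cases \<kappa>)
    case Diag
    then show ?thesis
      using assms that diag [of e] diag [of e'] ad' unfolding Cell_iff_lead \<gamma> by metis
  next
    case Anti
    then show ?thesis
      using assms that anti [of e] anti [of e'] bc' unfolding Cell_iff_lead \<gamma> by metis
  qed
  moreover have "\<kappa> = \<kappa>'"
    using assms mixed [of e e'] mixed [of e' e] unfolding Cell_iff_lead \<gamma>
    by (cases \<kappa>; cases \<kappa>') simp_all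
  ultimately show ?thesis by (simp add: \<gamma>)
qed

end

context sl2_two_dim_local_field
begin

(* Indices of double cosets are kept as single variables where possible. *)
declare split_paired_All [simp del] split_paired_Ex [simp del]

section \<open>Biinvariant functions and their convolution\<close>

text \<open>The function on the group with prescribed values on the double cosets. By the Bruhat
  decomposition every biinvariant function has this form; it is the link between functions and
  families of coefficients.\<close>

definition ev :: "(kind \<times> int \<times> int \<Rightarrow> complex) \<Rightarrow> 'f ^ 2 ^ 2 \<Rightarrow> complex" where
  "ev F M = (if \<exists>\<gamma>. M \<in> Cell \<gamma> then F (THE \<gamma>. M \<in> Cell \<gamma>) else 0)"

lemma the_Cell: "M \<in> Cell \<gamma> \<Longrightarrow> (THE \<gamma>. M \<in> Cell \<gamma>) = \<gamma>"
  using Cell_disjoint by blast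

lemma ev_Cell: "M \<in> Cell \<gamma> \<Longrightarrow> ev F M = F \<gamma>"
  using the_Cell by (auto simp: ev_def)

lemma ev_Eta [simp]: "ev F (Eta \<gamma>) = F \<gamma>"
  by (rule ev_Cell) simp

lemma ev_no_det: "det M \<noteq> 1 \<Longrightarrow> ev F M = 0"
  using det_Cell by (auto simp: ev_def)

lemma ev_left [simp]: "k \<in> iwahori \<Longrightarrow> ev F (k ** M) = ev F M"
  by (simp add: ev_def)

lemma ev_right [simp]: "k \<in> iwahori \<Longrightarrow> ev F (M ** k) = ev F M"
  by (simp add: ev_def)

lemma ev_zero [simp]: "ev (\<lambda>\<gamma>. 0) = (\<lambda>M. 0)"
  by (auto simp: ev_def)

lemma ev_add: "ev (\<lambda>\<gamma>. F \<gamma> + G \<gamma>) M = ev F M + ev G M"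
  by (simp add: ev_def)

lemma ev_scale: "ev (\<lambda>\<gamma>. c * F \<gamma>) M = c * ev F M"
  by (simp add: ev_def)

lemma ev_sum: "ev (\<lambda>\<gamma>. \<Sum>i\<in>A. F i \<gamma>) M = (\<Sum>i\<in>A. ev (F i) M)"
  by (simp add: ev_def)

lemma ev_eq_iff: "ev F = ev G \<longleftrightarrow> F = G"
  by (metis ev_Eta ext)

lemma coefficient_ev [simp]: "coefficient (ev F) = F"
  by (auto simp: coefficient_def fun_eq_iff simp flip: Eta_def [THEN fun_cong, of "(\<kappa>, i, j)" for \<kappa> i j, simplified])

definition unit_coeff :: "kind \<times> int \<times> int \<Rightarrow> kind \<times> int \<times> int \<Rightarrow> complex" where
  "unit_coeff \<alpha> = (\<lambda>\<gamma>. of_bool (\<gamma> = \<alpha>))"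

lemma ev_unit_coeff: "ev (unit_coeff \<alpha>) = indicator (Cell \<alpha>)"
  using the_Cell by (auto simp: fun_eq_iff ev_def unit_coeff_def indicator_def)

lemma chi_ev: "chi \<kappa> i j = ev (unit_coeff (\<kappa>, i, j))"
  by (simp add: chi_def ev_unit_coeff Cell_def)

text \<open>Right cosets of the Iwahori subgroup, with the representatives that occur in the
  definition of the convolution.\<close>

definition rcos :: "'f ^ 2 ^ 2 \<Rightarrow> ('f ^ 2 ^ 2) set" where
  "rcos x = (\<lambda>k. k ** x) ` iwahori"

definition RC :: "('f ^ 2 ^ 2) set set" where
  "RC = rcos ` {x. det x = 1}"

definition rep :: "('f ^ 2 ^ 2) set \<Rightarrow> 'f ^ 2 ^ 2" where
  "rep K = (SOME z. z \<in> K)"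

lemma r_coset_rcos: "iwahori #>\<^bsub>SL2\<^esub> x = rcos x"
  by (auto simp: r_coset_def rcos_def)

lemma self_in_rcos: "x \<in> rcos x"
  unfolding rcos_def by (rule image_eqI [of _ _ "mat 1"]) simp_all

lemma rep_rcos: "\<exists>k\<in>iwahori. rep (rcos x) = k ** x"
proof -
  have "rep (rcos x) \<in> rcos x"
    unfolding rep_def by (rule someI [of _ x]) (rule self_in_rcos)
  then show ?thesis by (auto simp: rcos_def)
qed

lemma rcos_eqI:
  assumes "det x = 1" "det y = 1" "x ** adj y \<in> iwahori"
  shows "rcos x = rcos y"
proof -
  have *: "rcos x \<subseteq> rcos y" if "det x = 1" "det y = 1" "x ** adj y \<in> iwahori" for x y
  proof
    fix z assume "z \<in> rcos x"
    then obtain k where "k \<in> iwahori" "z = k ** x" by (auto simp: rcos_def)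
    moreover have "x = (x ** adj y) ** y"
      using that by (simp add: adj_inverse flip: matrix_mul_assoc)
    ultimately show "z \<in> rcos y"
      using iwahori_mult [OF _ that(3)] unfolding rcos_def by (metis image_eqI matrix_mul_assoc)
  qed
  have "y ** adj x \<in> iwahori"
    using assms(3) iwahori_adj [of "x ** adj y"] by (simp add: adj_mult)
  then show ?thesis using * assms by blast
qed

lemma rcos_eqD:
  assumes "rcos x = rcos y" "det y = 1"
  shows "x ** adj y \<in> iwahori"
proof -
  obtain k where "k \<in> iwahori" "x = k ** y"
    using assms self_in_rcos [of x] by (auto simp: rcos_def)
  then show ?thesis using assms by (simp add: adj_inverse flip: matrix_mul_assoc)
qed

lemma ev_rep [simp]: "ev F (rep (rcos y)) = ev F y"
  using rep_rcos [of y] by auto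

lemma ev_adj_rep [simp]: "ev F (x ** adj (rep (rcos y))) = ev F (x ** adj y)"
  using rep_rcos [of y] by (auto simp: adj_mult matrix_mul_assoc)

lemma det_rep: "K \<in> RC \<Longrightarrow> det (rep K) = 1"
  using rep_rcos by (auto simp: RC_def) (metis det_iwahori det_mul mult_1)

lemma rcos_rep: "K \<in> RC \<Longrightarrow> rcos (rep K) = K"
proof -
  assume "K \<in> RC"
  then obtain x where x: "det x = 1" "K = rcos x" by (auto simp: RC_def)
  obtain k where k: "k \<in> iwahori" "rep K = k ** x" using rep_rcos x by auto
  then have "rcos (k ** x) = rcos x"
    using x by (intro rcos_eqI)
      (auto simp: det_mul det_iwahori adj_inverse simp flip: matrix_mul_assoc)
  then show ?thesis using k x by simp
qed

text \<open>The convolution of the group without its normalising factor and without its truncation to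
  certain levels.\<close>

definition full_conv :: "('f ^ 2 ^ 2 \<Rightarrow> complex) \<Rightarrow> ('f ^ 2 ^ 2 \<Rightarrow> complex) \<Rightarrow> 'f ^ 2 ^ 2 \<Rightarrow> complex" where
  "full_conv f g x = (\<Sum>\<^sub>\<infinity>K\<in>RC. f (x ** adj (rep K)) * g (rep K))"

lemma full_conv_finite:
  assumes "finite A" "A \<subseteq> RC"
    and "\<And>K. K \<in> RC - A \<Longrightarrow> f (x ** adj (rep K)) * g (rep K) = 0"
  shows "full_conv f g x = (\<Sum>K\<in>A. f (x ** adj (rep K)) * g (rep K))"
  unfolding full_conv_def infsum_finite [OF assms(1), symmetric]
  by (rule infsum_cong_neutral) (use assms in auto)

lemma full_conv_left [simp]: "k \<in> iwahori \<Longrightarrow> full_conv (ev F) g (k ** x) = full_conv (ev F) g x"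
  unfolding full_conv_def by (simp flip: matrix_mul_assoc)

text \<open>This finiteness makes \<open>full_conv f g\<close> a finite sum at each point, whatever \<open>g\<close> is.\<close>

definition left_finite :: "('f ^ 2 ^ 2 \<Rightarrow> complex) \<Rightarrow> bool" where
  "left_finite f \<longleftrightarrow> (\<forall>x. det x = 1 \<longrightarrow> finite {K \<in> RC. f (x ** adj (rep K)) \<noteq> 0})"

lemma left_finite_sum:
  assumes "finite A" "\<And>i. i \<in> A \<Longrightarrow> left_finite (f i)"
  shows "left_finite (\<lambda>M. \<Sum>i\<in>A. f i M)"
  unfolding left_finite_def
proof (intro allI impI)
  fix x :: "'f ^ 2 ^ 2" assume "det x = 1"
  then have "finite (\<Union>i\<in>A. {K \<in> RC. f i (x ** adj (rep K)) \<noteq> 0})"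
    using assms by (auto simp: left_finite_def)
  then show "finite {K \<in> RC. (\<Sum>i\<in>A. f i (x ** adj (rep K))) \<noteq> 0}"
    by (rule finite_subset [rotated]) (auto elim: sum.not_neutral_contains_not_neutral)
qed

lemma left_finite_translate:
  assumes "left_finite f" "det y = 1"
  shows "left_finite (\<lambda>M. f (y ** M))"
  using assms by (auto simp: left_finite_def det_mul matrix_mul_assoc)

lemma left_finite_scale: "left_finite f \<Longrightarrow> left_finite (\<lambda>M. c * f M)"
  unfolding left_finite_def by (auto elim!: finite_subset [rotated])

lemma full_conv_sum:
  assumes "finite A" "\<And>i. i \<in> A \<Longrightarrow> left_finite (f i)" "det x = 1"
  shows "full_conv (\<lambda>M. \<Sum>i\<in>A. c i * f i M) g x = (\<Sum>i\<in>A. c i * full_conv (f i) g x)"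
proof -
  define B where "B = (\<Union>i\<in>A. {K \<in> RC. f i (x ** adj (rep K)) \<noteq> 0})"
  have B: "finite B" "B \<subseteq> RC"
    using assms by (auto simp: left_finite_def B_def)
  have 1: "full_conv (f i) g x = (\<Sum>K\<in>B. f i (x ** adj (rep K)) * g (rep K))" if "i \<in> A" for i
    by (rule full_conv_finite [OF B]) (use that in \<open>auto simp: B_def\<close>)
  have "full_conv (\<lambda>M. \<Sum>i\<in>A. c i * f i M) g x =
      (\<Sum>K\<in>B. (\<Sum>i\<in>A. c i * f i (x ** adj (rep K))) * g (rep K))"
    by (rule full_conv_finite [OF B]) (auto simp: B_def intro!: sum.neutral)
  also have "\<dots> = (\<Sum>i\<in>A. c i * (\<Sum>K\<in>B. f i (x ** adj (rep K)) * g (rep K)))"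
    unfolding sum_distrib_left sum_distrib_right mult.assoc by (rule sum.swap)
  finally show ?thesis using 1 by simp
qed

lemma full_conv_translate: "full_conv (\<lambda>M. f (y ** M)) g x = full_conv f g (y ** x)"
  by (simp add: full_conv_def matrix_mul_assoc)

definition left_reps :: "('f ^ 2 ^ 2) set \<Rightarrow> kind \<times> int \<times> int \<Rightarrow> bool" where
  "left_reps Y \<alpha> \<longleftrightarrow> finite Y \<and> Y \<subseteq> Cell \<alpha> \<and> (\<forall>M\<in>Cell \<alpha>. \<exists>!y. y \<in> Y \<and> adj y ** M \<in> iwahori)"

text \<open>For given \<open>x\<close>, the coset \<open>I z\<close> contributes if and only if \<open>x z\<^sup>-\<^sup>1\<close> lies in one of the left cosets \<open>y I\<close>,
  that is \<open>I z = I y\<^sup>-\<^sup>1 x\<close>.\<close>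

lemma
  assumes Y: "left_reps Y \<alpha>" and x: "det x = 1"
  shows full_conv_unit_coeff: "full_conv (ev (unit_coeff \<alpha>)) (ev G) x = (\<Sum>y\<in>Y. ev G (adj y ** x))"
    and finite_unit_coeff: "finite {K \<in> RC. ev (unit_coeff \<alpha>) (x ** adj (rep K)) \<noteq> 0}"
proof -
  have detY: "det y = 1" if "y \<in> Y" for y
    using that Y det_Cell [of y \<alpha>] by (auto simp: left_reps_def)
  define \<phi> where "\<phi> y = rcos (adj y ** x)" for y
  have inj: "inj_on \<phi> Y"
  proof (rule inj_onI)
    fix y z assume yz: "y \<in> Y" "z \<in> Y" "\<phi> y = \<phi> z"
    then have "adj y ** x ** adj (adj z ** x) \<in> iwahori"
      using x detY unfolding \<phi>_def by (intro rcos_eqD) (simp_all add: det_mul)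
    then have "adj y ** z \<in> iwahori"
      using x by (simp add: adj_mult adj_inverse flip: matrix_mul_assoc)
        (simp add: adj_inverse matrix_mul_assoc)
    moreover have "adj z ** z \<in> iwahori"
      using yz detY by (simp add: adj_inverse)
    ultimately show "y = z"
      using yz Y unfolding left_reps_def by blast
  qed
  have sub: "{K \<in> RC. ev (unit_coeff \<alpha>) (x ** adj (rep K)) \<noteq> 0} \<subseteq> \<phi> ` Y"
  proof
    fix K assume "K \<in> {K \<in> RC. ev (unit_coeff \<alpha>) (x ** adj (rep K)) \<noteq> 0}"
    then have K: "K \<in> RC" "x ** adj (rep K) \<in> Cell \<alpha>"
      by (auto simp: ev_unit_coeff indicator_def split: if_splits)
    then obtain y where y: "y \<in> Y" "adj y ** (x ** adj (rep K)) \<in> iwahori"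
      using Y by (auto simp: left_reps_def)
    have "rcos (adj y ** x) = rcos (rep K)"
      using y K x detY det_rep by (intro rcos_eqI) (simp_all add: det_mul matrix_mul_assoc)
    then show "K \<in> \<phi> ` Y"
      using y K rcos_rep by (auto simp: \<phi>_def)
  qed
  then show "finite {K \<in> RC. ev (unit_coeff \<alpha>) (x ** adj (rep K)) \<noteq> 0}"
    using Y by (auto simp: left_reps_def elim: finite_subset)
  have RC: "\<phi> ` Y \<subseteq> RC"
    using x detY by (auto simp: RC_def \<phi>_def det_mul)
  have "full_conv (ev (unit_coeff \<alpha>)) (ev G) x =
      (\<Sum>K\<in>\<phi> ` Y. ev (unit_coeff \<alpha>) (x ** adj (rep K)) * ev G (rep K))"
    using Y sub RC by (intro full_conv_finite) (auto simp: left_reps_def)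
  also have "\<dots> = (\<Sum>y\<in>Y. ev (unit_coeff \<alpha>) (x ** adj (adj y ** x)) * ev G (adj y ** x))"
    by (subst sum.reindex [OF inj]) (simp add: \<phi>_def)
  also have "\<dots> = (\<Sum>y\<in>Y. ev G (adj y ** x))"
  proof (rule sum.cong [OF refl])
    fix y assume y: "y \<in> Y"
    have "x ** adj (adj y ** x) = y"
      using x by (simp add: adj_mult adj_inverse matrix_mul_assoc)
    then show "ev (unit_coeff \<alpha>) (x ** adj (adj y ** x)) * ev G (adj y ** x) = ev G (adj y ** x)"
      using y Y by (auto simp: ev_unit_coeff left_reps_def)
  qed
  finally show "full_conv (ev (unit_coeff \<alpha>)) (ev G) x = (\<Sum>y\<in>Y. ev G (adj y ** x))" .
qed

text \<open>\<open>acts F \<Lambda>\<close> says that convolution from the left with the function with coefficients \<open>F\<close>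
  is given on coefficients by \<open>\<Lambda>\<close>.\<close>

definition acts :: "(kind \<times> int \<times> int \<Rightarrow> complex) \<Rightarrow>
    ((kind \<times> int \<times> int \<Rightarrow> complex) \<Rightarrow> kind \<times> int \<times> int \<Rightarrow> complex) \<Rightarrow> bool" where
  "acts F \<Lambda> \<longleftrightarrow> left_finite (ev F) \<and> (\<forall>G x. det x = 1 \<longrightarrow> full_conv (ev F) (ev G) x = ev (\<Lambda> G) x)"

lemma acts_lincomb:
  assumes "acts F \<Lambda>" "acts F' \<Lambda>'"
  shows "acts (\<lambda>\<gamma>. c * F \<gamma> + c' * F' \<gamma>) (\<lambda>G \<gamma>. c * \<Lambda> G \<gamma> + c' * \<Lambda>' G \<gamma>)"
proof -
  have eq: "ev (\<lambda>\<gamma>. c * F \<gamma> + c' * F' \<gamma>) =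
      (\<lambda>M. \<Sum>b\<in>UNIV. (if b then c else c') * ev (if b then F else F') M)"
    by (rule ext) (simp add: UNIV_bool ev_add ev_scale)
  have fin: "left_finite (ev (if b then F else F'))" for b
    using assms by (auto simp: acts_def)
  show ?thesis
    unfolding acts_def
  proof (intro conjI allI impI)
    show "left_finite (ev (\<lambda>\<gamma>. c * F \<gamma> + c' * F' \<gamma>))"
      unfolding eq by (intro left_finite_sum left_finite_scale fin) simp
    fix G and x :: "'f ^ 2 ^ 2" assume x: "det x = 1"
    have "full_conv (ev (\<lambda>\<gamma>. c * F \<gamma> + c' * F' \<gamma>)) (ev G) x =
        (\<Sum>b\<in>UNIV. (if b then c else c') * full_conv (ev (if b then F else F')) (ev G) x)"
      unfolding eq by (intro full_conv_sum fin x) simp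
    also have "\<dots> = ev (\<lambda>\<gamma>. c * \<Lambda> G \<gamma> + c' * \<Lambda>' G \<gamma>) x"
      using assms x by (simp add: UNIV_bool ev_add ev_scale acts_def)
    finally show "full_conv (ev (\<lambda>\<gamma>. c * F \<gamma> + c' * F' \<gamma>)) (ev G) x =
        ev (\<lambda>\<gamma>. c * \<Lambda> G \<gamma> + c' * \<Lambda>' G \<gamma>) x" .
  qed
qed

text \<open>If \<open>\<Lambda>\<^sub>0\<close> describes the convolution with a double coset at the representatives \<open>Eta \<gamma>\<close>, then
  it does so everywhere, because both sides are biinvariant.\<close>

lemma sum_left_reps:
  assumes Y: "left_reps Y \<alpha>" and x: "det x = 1"
    and \<Lambda>\<^sub>0: "\<And>\<gamma>. (\<Sum>y\<in>Y. ev G (adj y ** Eta \<gamma>)) = \<Lambda>\<^sub>0 G \<gamma>"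
  shows "(\<Sum>y\<in>Y. ev G (adj y ** x)) = ev (\<Lambda>\<^sub>0 G) x"
proof -
  obtain \<gamma> where \<gamma>: "x \<in> Cell \<gamma>" using Bruhat_exists x by blast
  then obtain k k' where k: "k \<in> iwahori" "k' \<in> iwahori" "x = k ** Eta \<gamma> ** k'"
    by (auto simp: Cell_iff)
  have "(\<Sum>y\<in>Y. ev G (adj y ** x)) = (\<Sum>y\<in>Y. ev G (adj y ** (k ** Eta \<gamma>)))"
    using k by (simp add: matrix_mul_assoc)
  also have "\<dots> = full_conv (ev (unit_coeff \<alpha>)) (ev G) (k ** Eta \<gamma>)"
    using k by (intro full_conv_unit_coeff [OF Y, symmetric]) (simp add: det_mul det_iwahori)
  also have "\<dots> = (\<Sum>y\<in>Y. ev G (adj y ** Eta \<gamma>))"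
    using k by (simp add: full_conv_unit_coeff [OF Y])
  finally show ?thesis
    using \<Lambda>\<^sub>0 \<gamma> by (simp add: ev_Cell)
qed

lemma acts_unit_coeff:
  assumes "left_reps Y \<alpha>" "\<And>G \<gamma>. (\<Sum>y\<in>Y. ev G (adj y ** Eta \<gamma>)) = \<Lambda>\<^sub>0 G \<gamma>"
  shows "acts (unit_coeff \<alpha>) \<Lambda>\<^sub>0"
  unfolding acts_def left_finite_def
  using finite_unit_coeff [OF assms(1)] full_conv_unit_coeff [OF assms(1)]
    sum_left_reps [OF assms(1)] assms(2) by simp

text \<open>Associativity for a first factor consisting of finitely many left cosets \<open>y I\<close>: it is a sum of
  translations by \<open>y\<^sup>-\<^sup>1\<close>, and these commute with the sum over right cosets.\<close>

lemma acts_comp: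
  assumes "left_reps Y \<alpha>" "\<And>G \<gamma>. (\<Sum>y\<in>Y. ev G (adj y ** Eta \<gamma>)) = \<Lambda>\<^sub>0 G \<gamma>"
    and "acts F \<Lambda>"
  shows "acts (\<Lambda>\<^sub>0 F) (\<lambda>G. \<Lambda>\<^sub>0 (\<Lambda> G))"
proof -
  have det: "det y = 1" if "y \<in> Y" for y
    using assms(1) det_Cell [of y \<alpha>] that by (auto simp: left_reps_def)
  have finY: "finite Y" using assms(1) by (auto simp: left_reps_def)
  have eq: "ev (\<Lambda>\<^sub>0 F) x = (\<Sum>y\<in>Y. 1 * ev F (adj y ** x))" for x
  proof (cases "det x = 1")
    case True
    then show ?thesis using sum_left_reps [OF assms(1) True, of F \<Lambda>\<^sub>0] assms(2) by simp
  next
    case False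
    then have "det (adj y ** x) \<noteq> 1" if "y \<in> Y" for y
      using det [OF that] by (simp add: det_mul)
    then show ?thesis using False by (simp add: ev_no_det)
  qed
  have lf: "left_finite (\<lambda>M. ev F (adj y ** M))" if "y \<in> Y" for y
    using assms(3) that det by (intro left_finite_translate) (simp_all add: acts_def)
  show ?thesis
    unfolding acts_def
  proof (intro conjI allI impI)
    show "left_finite (ev (\<Lambda>\<^sub>0 F))"
      unfolding eq by (intro left_finite_sum finY left_finite_scale lf)
    fix G and x :: "'f ^ 2 ^ 2" assume x: "det x = 1"
    have "full_conv (ev (\<Lambda>\<^sub>0 F)) (ev G) x = (\<Sum>y\<in>Y. 1 * full_conv (\<lambda>M. ev F (adj y ** M)) (ev G) x)"
      unfolding eq by (intro full_conv_sum finY lf x)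
    also have "\<dots> = (\<Sum>y\<in>Y. ev (\<Lambda> G) (adj y ** x))"
      using assms(3) det x by (intro sum.cong refl) (simp add: full_conv_translate acts_def det_mul)
    also have "\<dots> = ev (\<Lambda>\<^sub>0 (\<Lambda> G)) x"
      by (rule sum_left_reps [OF assms(1) x assms(2)])
    finally show "full_conv (ev (\<Lambda>\<^sub>0 F)) (ev G) x = ev (\<Lambda>\<^sub>0 (\<Lambda> G)) x" .
  qed
qed

end

context sl2_two_dim_local_field
begin

lemma adj_mat_1 [simp]: "adj (mat 1) = mat 1"
  by (simp add: mat_1_mat2)

section \<open>The simple reflections\<close>

text \<open>The representative of the zero class is chosen to be 0, so that the remaining ones are units.\<close>

lemma residue_reps_exist:
  "\<exists>U. finite U \<and> card U = q \<and> 0 \<in> U \<and> U \<subseteq> \<O> \<and> (\<forall>b\<in>\<O>. \<exists>!u. u \<in> U \<and> b - u \<in> \<P>)"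
proof -
  define cs where "cs a = {x. x - a \<in> \<P>}" for a
  define C where "C = cs ` \<O>"
  have "(\<lambda>h. h + a) ` \<P> = cs a" for a
  proof (intro equalityI subsetI)
    fix x assume "x \<in> cs a"
    then show "x \<in> (\<lambda>h. h + a) ` \<P>"
      by (intro image_eqI [of _ _ "x - a"]) (simp_all add: cs_def)
  qed (auto simp: cs_def)
  then have "carrier (((ring_of_class :: 'f ring)\<lparr>carrier := \<O>\<rparr>) Quot \<P>) = C"
    by (auto simp: FactRing_def A_RCOSETS_def' a_r_coset_def' ring_of_class_def C_def
        UNION_singleton_eq_range image_image)
  then have card: "card C = q"
    using last_residue_field by simp
  then have fin: "finite C"
    using q_pos card_gt_0_iff by metis
  have self: "a \<in> cs a" for a
    by (simp add: cs_def)
  have cs_eq: "cs a = cs b" if "a \<in> cs b" for a b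
  proof -
    have "a - b \<in> \<P>" using that by (simp add: cs_def)
    then have "x - a \<in> \<P> \<longleftrightarrow> x - b \<in> \<P>" for x
      using t1_ideal_add [of "x - a" "a - b"] t1_ideal_diff [of "x - b" "a - b"] by auto
    then show ?thesis by (simp add: cs_def)
  qed
  define r where "r K = (if 0 \<in> K then 0 else SOME x. x \<in> K)" for K :: "'f set"
  have r: "r (cs a) \<in> cs a" for a
    using self [of a] someI [of "\<lambda>x. x \<in> cs a" a] by (simp add: r_def)
  have cs_r: "cs (r K) = K" if "K \<in> C" for K
    using that r cs_eq by (auto simp: C_def)
  have sub: "cs b \<subseteq> \<O>" if "b \<in> \<O>" for b
    using that int_ring_add [of b "x - b" for x] t1_ideal_subset by (fastforce simp: cs_def)
  have inj: "inj_on r C"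
    using cs_r by (metis inj_onI)
  show ?thesis
  proof (intro exI [of _ "r ` C"] conjI ballI)
    show "finite (r ` C)" "card (r ` C) = q"
      using fin card card_image [OF inj] by auto
    show "0 \<in> r ` C"
      by (rule image_eqI [of _ _ "cs 0"]) (auto simp: r_def C_def self)
    show "r ` C \<subseteq> \<O>"
      using r sub by (auto simp: C_def)
    fix b assume b: "b \<in> \<O>"
    have neg: "b - u \<in> \<P> \<longleftrightarrow> u \<in> cs b" for u
      using t1_ideal_minus [of "b - u"] by (simp add: cs_def)
    show "\<exists>!u. u \<in> r ` C \<and> b - u \<in> \<P>"
    proof (rule ex1I [of _ "r (cs b)"])
      show "r (cs b) \<in> r ` C \<and> b - r (cs b) \<in> \<P>"
        using b r neg by (simp add: C_def)
      fix u assume u: "u \<in> r ` C \<and> b - u \<in> \<P>"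
      then obtain K where K: "K \<in> C" "u = r K" by auto
      then have "cs b = K"
        using u neg cs_eq cs_r by metis
      then show "u = r (cs b)" using K by simp
    qed
  qed
qed

definition residue_reps :: "'f set" where
  "residue_reps = (SOME U. finite U \<and> card U = q \<and> 0 \<in> U \<and> U \<subseteq> \<O> \<and>
     (\<forall>b\<in>\<O>. \<exists>!u. u \<in> U \<and> b - u \<in> \<P>))"

lemma finite_residue_reps [simp]: "finite residue_reps"
  and card_residue_reps: "card residue_reps = q"
  and zero_residue_reps [simp]: "0 \<in> residue_reps"
  and residue_reps_subset: "u \<in> residue_reps \<Longrightarrow> u \<in> \<O>"
  and residue_reps_ex1: "b \<in> \<O> \<Longrightarrow> \<exists>!u. u \<in> residue_reps \<and> b - u \<in> \<P>"
  using someI_ex [OF residue_reps_exist] unfolding residue_reps_def [symmetric] by blast+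

lemma residue_reps_unit:
  assumes "u \<in> residue_reps" "u \<noteq> 0"
  shows "u \<in> \<O>" "u \<notin> \<P>" "v u = 0"
proof -
  show u: "u \<in> \<O>" "u \<notin> \<P>"
    using assms residue_reps_ex1 [of u] residue_reps_subset by force+
  then show "v u = 0" using unit_iff by blast
qed

lemma sum_residue_reps:
  assumes "f 0 = A" "\<And>u. u \<in> residue_reps \<Longrightarrow> u \<noteq> 0 \<Longrightarrow> f u = B"
  shows "(\<Sum>u\<in>residue_reps. f u) = A + (of_nat q - 1) * (B :: complex)"
proof -
  have "(\<Sum>u\<in>residue_reps. f u) = f 0 + (\<Sum>u\<in>residue_reps - {0}. f u)"
    by (rule sum.remove) simp_all
  also have "(\<Sum>u\<in>residue_reps - {0}. f u) = (\<Sum>u\<in>residue_reps - {0}. B)"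
    using assms by (intro sum.cong) auto
  also have "\<dots> = (of_nat q - 1) * B"
    using q_pos by (simp add: card_Diff_singleton card_residue_reps of_nat_diff)
  finally show ?thesis using assms by simp
qed

lemma sum_residue_reps_const:
  assumes "\<And>u. u \<in> residue_reps \<Longrightarrow> f u = A"
  shows "(\<Sum>u\<in>residue_reps. f u) = of_nat q * (A :: complex)"
  using sum_residue_reps [of f A A] assms by (simp add: algebra_simps)

text \<open>The operators of left convolution with the two simple reflections \<open>(Anti, 0, 0)\<close> and
  \<open>(Anti, -1, 0)\<close> of the affine Weyl group. They are the usual Hecke operators
  \<open>T\<^sub>s T\<^sub>w = T\<^sub>s\<^sub>w\<close> or \<open>q T\<^sub>s\<^sub>w + (q - 1) T\<^sub>w\<close> in transposed form, acting on coefficients.\<close>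

definition Ls :: "(kind \<times> int \<times> int \<Rightarrow> complex) \<Rightarrow> kind \<times> int \<times> int \<Rightarrow> complex" where
  "Ls F = (\<lambda>(\<kappa>, i, j). case \<kappa> of
     Diag \<Rightarrow> if lex_pos (i, j) then F (Anti, - i, - j) + (of_nat q - 1) * F (Diag, i, j)
             else of_nat q * F (Anti, - i, - j)
   | Anti \<Rightarrow> if lex_nonneg (i, j) then F (Diag, - i, - j) + (of_nat q - 1) * F (Anti, i, j)
             else of_nat q * F (Diag, - i, - j))"

definition L0 :: "(kind \<times> int \<times> int \<Rightarrow> complex) \<Rightarrow> kind \<times> int \<times> int \<Rightarrow> complex" where
  "L0 F = (\<lambda>(\<kappa>, i, j). case \<kappa> of
     Diag \<Rightarrow> if lex_nonneg (i, j) then of_nat q * F (Anti, - 1 - i, - j)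
             else F (Anti, - 1 - i, - j) + (of_nat q - 1) * F (Diag, i, j)
   | Anti \<Rightarrow> if lex_nonneg (i, j) then of_nat q * F (Diag, - 1 - i, - j)
             else F (Diag, - 1 - i, - j) + (of_nat q - 1) * F (Anti, i, j))"

lemma residue_reps_left_reps:
  assumes lead: "\<And>u. u \<in> residue_reps \<Longrightarrow> y u \<in> Cell \<alpha>"
    and iff: "\<And>M. M \<in> Cell \<alpha> \<Longrightarrow> \<exists>b\<in>\<O>. \<forall>u\<in>residue_reps. adj (y u) ** M \<in> iwahori \<longleftrightarrow> b - u \<in> \<P>"
  shows "left_reps (y ` residue_reps) \<alpha>"
  unfolding left_reps_def
proof (intro conjI ballI)
  fix M assume "M \<in> Cell \<alpha>"
  then obtain b where b: "b \<in> \<O>"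
    "\<And>u. u \<in> residue_reps \<Longrightarrow> adj (y u) ** M \<in> iwahori \<longleftrightarrow> b - u \<in> \<P>"
    using iff by blast
  then show "\<exists>!z. z \<in> y ` residue_reps \<and> adj z ** M \<in> iwahori"
    using residue_reps_ex1 [OF b(1)] by blast
qed (use lead in auto)

text \<open>The double coset of the first reflection \<open>s\<close> is the union of the left cosets of the matrices
  \<open>(1 u; 0 1) s\<close>, and that of the second one, \<open>s\<^sub>0\<close>, of the matrices \<open>(1 0; t1 u 1) s\<^sub>0\<close>, where \<open>u\<close> runs over
  the representatives of the residue field.\<close>

definition s_rep :: "'f \<Rightarrow> 'f ^ 2 ^ 2" where "s_rep u = mat2 (- u) 1 (- 1) 0"

definition s0_rep :: "'f \<Rightarrow> 'f ^ 2 ^ 2" where "s0_rep u = mat2 0 (1 / t1) (- t1) u"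

lemma left_reps_s_rep: "left_reps (s_rep ` residue_reps) (Anti, 0, 0)"
proof (rule residue_reps_left_reps)
  fix u assume "u \<in> residue_reps"
  then show "s_rep u \<in> Cell (Anti, 0, 0)"
    using Cell_Anti_c [of "- u" 0 1 "- 1"] residue_reps_subset
    by (simp add: s_rep_def flip: zero_prod_def)
next
  fix M assume M: "M \<in> Cell (Anti, 0, 0)"
  obtain a b c d where M': "M = mat2 a b c d" by (rule mat2_cases)
  have h: "a * d - b * c = 1" "c \<noteq> 0" "v c = 0" "a / c \<in> \<O>" "d / c \<in> \<O>"
    using M unfolding Cell_iff_lead M' by (auto simp: lead_simps lex_nonneg_def prod_eq_iff)
  have c: "c \<in> \<O>" "1 / c \<in> \<O>"
    using h by (auto simp: int_ring_iff lex_nonneg_def v_divide)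
  have d: "d \<in> \<O>" using int_ring_mult [OF h(5) c(1)] h(2) by simp
  have "adj (s_rep u) ** M \<in> iwahori \<longleftrightarrow> a / c - u \<in> \<P>" if u: "u \<in> residue_reps" for u
  proof
    assume "adj (s_rep u) ** M \<in> iwahori"
    then have "a - u * c \<in> \<P>" by (simp add: s_rep_def M')
    from t1_ideal_mult [OF this c(2)] show "a / c - u \<in> \<P>"
      using h by (simp add: field_simps)
  next
    assume *: "a / c - u \<in> \<P>"
    from t1_ideal_mult [OF this c(1)] have 1: "a - u * c \<in> \<P>"
      using h by (simp add: left_diff_distrib)
    have "b - u * d = (a / c - u) * d - 1 / c"
      using h by (simp add: field_simps)
    then have "b - u * d \<in> \<O>"
      using * d c by (metis int_ring_diff int_ring_mult t1_ideal_subset)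
    moreover have "det (adj (s_rep u) ** M) = 1"
      using h by (simp add: det_mul s_rep_def M' del: mat2_mult)
    ultimately show "adj (s_rep u) ** M \<in> iwahori"
      using 1 c d by (simp add: s_rep_def M')
  qed
  then show "\<exists>b\<in>\<O>. \<forall>u\<in>residue_reps. adj (s_rep u) ** M \<in> iwahori \<longleftrightarrow> b - u \<in> \<P>"
    using h by blast
qed

lemma left_reps_s0_rep: "left_reps (s0_rep ` residue_reps) (Anti, - 1, 0)"
proof (rule residue_reps_left_reps)
  fix u assume "u \<in> residue_reps"
  then have "t1 * u \<in> \<P>" using residue_reps_subset by simp
  then have "u / (1 / t1) \<in> \<P>" by (simp add: mult.commute)
  moreover have "v (1 / t1) = (- 1, 0)" using t1 by (simp add: v_divide)
  ultimately show "s0_rep u \<in> Cell (Anti, - 1, 0)"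
    using Cell_Anti_b [of 0 u "1 / t1" "- t1"] t1 by (simp add: s0_rep_def)
next
  fix M assume M: "M \<in> Cell (Anti, - 1, 0)"
  obtain a b c d where M': "M = mat2 a b c d" by (rule mat2_cases)
  have h: "a * d - b * c = 1" "b \<noteq> 0" "v b = (- 1, 0)" "a / b \<in> \<P>" "d / b \<in> \<P>"
    using M unfolding Cell_iff_lead M' by (auto simp: lead_simps lex_nonneg_def)
  have tb: "t1 * b \<in> \<O>" "1 / (t1 * b) \<in> \<O>" "t1 * b \<noteq> 0"
    using h t1 by (auto simp: int_ring_iff lex_nonneg_def v_divide v_mult)
  have "a / b / t1 * (t1 * b) \<in> \<O>"
    using tb(1) h(4) by (intro int_ring_mult [of "a / b / t1" "t1 * b"]) (simp only: divide_t1_int_ring)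
  then have a: "a \<in> \<O>" using h t1 by simp
  have "adj (s0_rep u) ** M \<in> iwahori \<longleftrightarrow> d / b / t1 - u \<in> \<P>" if u: "u \<in> residue_reps" for u
  proof
    assume "adj (s0_rep u) ** M \<in> iwahori"
    then have "u * b - d / t1 \<in> \<O>" by (simp add: s0_rep_def M')
    then have "- (t1 * (u * b - d / t1)) \<in> \<P>"
      by simp
    note t1_ideal_mult [OF this tb(2)]
    moreover have "- (t1 * (u * b - d / t1)) * (1 / (t1 * b)) = d / b / t1 - u"
      using h t1 by (simp add: field_simps)
    ultimately show "d / b / t1 - u \<in> \<P>"
      by metis
  next
    assume "d / b / t1 - u \<in> \<P>"
    from t1_ideal_mult [OF this tb(1)] have "- ((d / b / t1 - u) * (t1 * b)) / t1 \<in> \<O>"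
      by (simp only: divide_t1_int_ring t1_ideal_minus)
    moreover have "- ((d / b / t1 - u) * (t1 * b)) / t1 = u * b - d / t1"
      using h t1 by (simp add: field_simps)
    ultimately have 1: "u * b - d / t1 \<in> \<O>"
      by metis
    have "(u * a - c / t1) * (t1 * b) = u * a * b * t1 - b * c"
      using t1 by (simp add: field_simps)
    moreover have "1 + (u * b - d / t1) * (t1 * a) = u * a * b * t1 + (1 - a * d)"
      using t1 by (simp add: field_simps)
    ultimately have "(u * a - c / t1) * (t1 * b) = 1 + (u * b - d / t1) * (t1 * a)"
      using h(1) by (simp add: algebra_simps)
    then have "u * a - c / t1 = (1 + (u * b - d / t1) * (t1 * a)) * (1 / (t1 * b))"
      using tb(3) by (simp add: nonzero_eq_divide_eq)
    moreover have "t1 * a \<in> \<P>" using a by simp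
    ultimately have "u * a - c / t1 \<in> \<O>"
      using 1 tb by (metis int_ring_add int_ring_mult int_ring_1 t1_ideal_subset)
    moreover have "det (adj (s0_rep u) ** M) = 1"
      using h t1 by (simp add: det_mul s0_rep_def M' del: mat2_mult)
    ultimately show "adj (s0_rep u) ** M \<in> iwahori"
      using 1 tb a by (simp add: s0_rep_def M')
  qed
  moreover have "d / b / t1 \<in> \<O>" using h by (simp only: divide_t1_int_ring)
  ultimately show "\<exists>b\<in>\<O>. \<forall>u\<in>residue_reps. adj (s0_rep u) ** M \<in> iwahori \<longleftrightarrow> b - u \<in> \<P>"
    by blast
qed

text \<open>Let \<open>w = Eta \<gamma>\<close>. For \<open>u = 0\<close> the matrix is \<open>s\<^sup>-\<^sup>1 w\<close>. If the unipotent subgroup of \<open>s\<close> is conjugated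
  into the Iwahori subgroup by \<open>w\<^sup>-\<^sup>1\<close>, then all other \<open>u\<close> give the same double coset; otherwise they
  give the double coset of \<open>w\<close>, since a lower unipotent matrix with unit entry is a product of an
  upper one, \<open>s\<close>, a diagonal one and an upper one.\<close>

lemma sum_s_rep: "(\<Sum>y\<in>s_rep ` residue_reps. ev G (adj y ** Eta \<gamma>)) = Ls G \<gamma>"
proof -
  obtain \<kappa> i j where \<gamma>: "\<gamma> = (\<kappa>, i, j)" by (cases \<gamma>) auto
  define A where "A = mon i j"
  have A: "A \<noteq> 0" "v A = (i, j)" by (simp_all add: A_def)
  have "(\<Sum>y\<in>s_rep ` residue_reps. ev G (adj y ** Eta \<gamma>)) =
      (\<Sum>u\<in>residue_reps. ev G (adj (s_rep u) ** Eta \<gamma>))"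
    by (subst sum.reindex) (auto simp: inj_on_def s_rep_def)
  also have "\<dots> = Ls G \<gamma>"
  proof (cases \<kappa>)
    case Diag
    have eq: "adj (s_rep u) ** Eta \<gamma> = mat2 0 (- 1 / A) A (- u / A)" for u
      by (simp add: \<gamma> Diag Eta_def eta_mon s_rep_def A_def divide_inverse)
    show ?thesis
    proof (cases "lex_pos (i, j)")
      case False
      have "mat2 0 (- 1 / A) A (- u / A) \<in> Cell (Anti, - i, - j)" if "u \<in> residue_reps" for u
      proof -
        have "1 / (A * A) \<in> \<O>"
          using A False by (auto simp: int_ring_iff v_divide v_mult lex_nonneg_def lex_pos_def)
        then have "- (u * (1 / (A * A))) \<in> \<O>"
          using residue_reps_subset that by (simp only: int_ring_minus int_ring_mult)
        then show ?thesis
          using Cell_Anti_c [of 0 "- u / A" "- 1 / A" A] A by simp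
      qed
      then have "(\<Sum>u\<in>residue_reps. ev G (adj (s_rep u) ** Eta \<gamma>)) = of_nat q * G (Anti, - i, - j)"
        by (intro sum_residue_reps_const) (auto simp: eq ev_Cell)
      then show ?thesis
        using False by (simp add: Ls_def \<gamma> Diag)
    next
      case True
      have "(\<Sum>u\<in>residue_reps. ev G (adj (s_rep u) ** Eta \<gamma>)) =
          G (Anti, - i, - j) + (of_nat q - 1) * G (Diag, i, j)"
      proof (intro sum_residue_reps)
        have "v (- 1 / A) = (- i, - j)" using A by (simp add: v_divide)
        then have "mat2 0 (- 1 / A) A 0 \<in> Cell (Anti, - i, - j)"
          using Cell_Anti_b [of 0 0 "- 1 / A" A] A by simp
        then show "ev G (adj (s_rep 0) ** Eta \<gamma>) = G (Anti, - i, - j)"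
          by (simp add: eq ev_Cell)
        fix u assume u: "u \<in> residue_reps" "u \<noteq> 0"
        note u' = residue_reps_unit [OF u]
        have "1 / u \<in> \<O>" "A / (- u / A) \<in> \<P>" "v (- u / A) = - (i, j)"
          using A True u u'
          by (auto simp: int_ring_iff t1_ideal_iff v_divide v_mult lex_nonneg_def lex_pos_def)
        then have "mat2 0 (- 1 / A) A (- u / A) \<in> Cell (Diag, i, j)"
          using Cell_Diag_d [of 0 "- u / A" "- 1 / A" A] A u by simp
        then show "ev G (adj (s_rep u) ** Eta \<gamma>) = G (Diag, i, j)"
          by (simp add: eq ev_Cell)
      qed
      then show ?thesis
        using True by (simp add: Ls_def \<gamma> Diag)
    qed
  next
    case Anti
    have eq: "adj (s_rep u) ** Eta \<gamma> = mat2 (1 / A) 0 (u / A) A" for u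
      by (simp add: \<gamma> Anti Eta_def eta_mon s_rep_def A_def divide_inverse)
    show ?thesis
    proof (cases "lex_nonneg (i, j)")
      case False
      have "mat2 (1 / A) 0 (u / A) A \<in> Cell (Diag, - i, - j)" if "u \<in> residue_reps" for u
      proof -
        have "1 / (A * A) \<in> \<P>"
          using A False by (auto simp: t1_ideal_iff v_divide v_mult lex_nonneg_def lex_pos_def)
        then have "u * (1 / (A * A)) \<in> \<P>"
          using residue_reps_subset that by (simp only: t1_ideal_mult')
        then show ?thesis
          using Cell_Diag_d [of "1 / A" A 0 "u / A"] A by simp
      qed
      then have "(\<Sum>u\<in>residue_reps. ev G (adj (s_rep u) ** Eta \<gamma>)) = of_nat q * G (Diag, - i, - j)"
        by (intro sum_residue_reps_const) (auto simp: eq ev_Cell)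
      then show ?thesis
        using False by (simp add: Ls_def \<gamma> Anti)
    next
      case True
      have "(\<Sum>u\<in>residue_reps. ev G (adj (s_rep u) ** Eta \<gamma>)) =
          G (Diag, - i, - j) + (of_nat q - 1) * G (Anti, i, j)"
      proof (intro sum_residue_reps)
        have "mat2 (1 / A) 0 0 A \<in> Cell (Diag, - i, - j)"
          using Cell_Diag_d [of "1 / A" A 0 0] A by simp
        then show "ev G (adj (s_rep 0) ** Eta \<gamma>) = G (Diag, - i, - j)"
          by (simp add: eq ev_Cell)
        fix u assume u: "u \<in> residue_reps" "u \<noteq> 0"
        note u' = residue_reps_unit [OF u]
        have "1 / A / (u / A) \<in> \<O>" "A / (u / A) \<in> \<O>" "v (u / A) = - (i, j)"
          using A True u u'
          by (auto simp: int_ring_iff v_divide v_mult lex_nonneg_def)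
        then have "mat2 (1 / A) 0 (u / A) A \<in> Cell (Anti, i, j)"
          using Cell_Anti_c [of "1 / A" A 0 "u / A"] A u by simp
        then show "ev G (adj (s_rep u) ** Eta \<gamma>) = G (Anti, i, j)"
          by (simp add: eq ev_Cell)
      qed
      then show ?thesis
        using True by (simp add: Ls_def \<gamma> Anti)
    qed
  qed
  finally show ?thesis .
qed

lemma sum_s0_rep: "(\<Sum>y\<in>s0_rep ` residue_reps. ev G (adj y ** Eta \<gamma>)) = L0 G \<gamma>"
proof -
  obtain \<kappa> i j where \<gamma>: "\<gamma> = (\<kappa>, i, j)" by (cases \<gamma>) auto
  define A where "A = mon i j"
  have A: "A \<noteq> 0" "v A = (i, j)" by (simp_all add: A_def)
  have "(\<Sum>y\<in>s0_rep ` residue_reps. ev G (adj y ** Eta \<gamma>)) =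
      (\<Sum>u\<in>residue_reps. ev G (adj (s0_rep u) ** Eta \<gamma>))"
    by (subst sum.reindex) (auto simp: inj_on_def s0_rep_def)
  also have "\<dots> = L0 G \<gamma>"
  proof (cases \<kappa>)
    case Diag
    have eq: "adj (s0_rep u) ** Eta \<gamma> = mat2 (u * A) (- 1 / (t1 * A)) (t1 * A) 0" for u
      by (simp add: \<gamma> Diag Eta_def eta_mon s0_rep_def A_def divide_inverse)
    have vb: "v (- 1 / (t1 * A)) = (- 1 - i, - j)" using A t1 by (simp add: v_divide v_mult)
    show ?thesis
    proof (cases "lex_nonneg (i, j)")
      case True
      have "mat2 (u * A) (- 1 / (t1 * A)) (t1 * A) 0 \<in> Cell (Anti, - 1 - i, - j)"
        if "u \<in> residue_reps" for u
      proof -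
        have "A * A \<in> \<O>"
          using A True by (auto simp: int_ring_iff v_mult lex_nonneg_def)
        then have "t1 * (u * (A * A)) \<in> \<P>"
          using residue_reps_subset that by (simp add: int_ring_mult)
        moreover have "u * A * (t1 * A) = t1 * (u * (A * A))" by (simp add: ac_simps)
        ultimately have "u * A * (t1 * A) \<in> \<P>" by metis
        then show ?thesis
          using Cell_Anti_b [of "u * A" 0 "- 1 / (t1 * A)" "t1 * A"] A t1 vb by simp
      qed
      then have "(\<Sum>u\<in>residue_reps. ev G (adj (s0_rep u) ** Eta \<gamma>)) = of_nat q * G (Anti, - 1 - i, - j)"
        by (intro sum_residue_reps_const) (auto simp: eq ev_Cell)
      then show ?thesis
        using True by (simp add: L0_def \<gamma> Diag)
    next
      case False
      have "(\<Sum>u\<in>residue_reps. ev G (adj (s0_rep u) ** Eta \<gamma>)) =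
          G (Anti, - 1 - i, - j) + (of_nat q - 1) * G (Diag, i, j)"
      proof (intro sum_residue_reps)
        have "mat2 0 (- 1 / (t1 * A)) (t1 * A) 0 \<in> Cell (Anti, - 1 - i, - j)"
          using Cell_Anti_b [of 0 0 "- 1 / (t1 * A)" "t1 * A"] A t1 vb by simp
        then show "ev G (adj (s0_rep 0) ** Eta \<gamma>) = G (Anti, - 1 - i, - j)"
          by (simp add: eq ev_Cell)
        fix u assume u: "u \<in> residue_reps" "u \<noteq> 0"
        note u' = residue_reps_unit [OF u]
        have "- 1 / (t1 * A) / (u * A) \<in> \<O>" "t1 * A / (u * A) \<in> \<P>" "v (u * A) = (i, j)"
          using A False u u' t1
          by (auto simp: int_ring_iff t1_ideal_iff v_divide v_mult lex_nonneg_def lex_pos_def)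
        then have "mat2 (u * A) (- 1 / (t1 * A)) (t1 * A) 0 \<in> Cell (Diag, i, j)"
          using Cell_Diag_a [of "u * A" 0 "- 1 / (t1 * A)" "t1 * A"] A u t1 by simp
        then show "ev G (adj (s0_rep u) ** Eta \<gamma>) = G (Diag, i, j)"
          by (simp add: eq ev_Cell)
      qed
      then show ?thesis
        using False by (simp add: L0_def \<gamma> Diag)
    qed
  next
    case Anti
    have eq: "adj (s0_rep u) ** Eta \<gamma> = mat2 (1 / (t1 * A)) (u * A) 0 (t1 * A)" for u
      by (simp add: \<gamma> Anti Eta_def eta_mon s0_rep_def A_def divide_inverse)
    have va: "v (1 / (t1 * A)) = (- 1 - i, - j)" using A t1 by (simp add: v_divide v_mult)
    show ?thesis
    proof (cases "lex_nonneg (i, j)")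
      case True
      have "mat2 (1 / (t1 * A)) (u * A) 0 (t1 * A) \<in> Cell (Diag, - 1 - i, - j)"
        if "u \<in> residue_reps" for u
      proof -
        have "A * A \<in> \<O>"
          using A True by (auto simp: int_ring_iff v_mult lex_nonneg_def)
        then have "t1 * (u * (A * A)) \<in> \<O>"
          using residue_reps_subset that by (intro t1_ideal_subset) (simp add: int_ring_mult)
        moreover have "u * A * (t1 * A) = t1 * (u * (A * A))" by (simp add: ac_simps)
        ultimately have "u * A * (t1 * A) \<in> \<O>" by metis
        then show ?thesis
          using Cell_Diag_a [of "1 / (t1 * A)" "t1 * A" "u * A" 0] A t1 va by simp
      qed
      then have "(\<Sum>u\<in>residue_reps. ev G (adj (s0_rep u) ** Eta \<gamma>)) = of_nat q * G (Diag, - 1 - i, - j)"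
        by (intro sum_residue_reps_const) (auto simp: eq ev_Cell)
      then show ?thesis
        using True by (simp add: L0_def \<gamma> Anti)
    next
      case False
      have "(\<Sum>u\<in>residue_reps. ev G (adj (s0_rep u) ** Eta \<gamma>)) =
          G (Diag, - 1 - i, - j) + (of_nat q - 1) * G (Anti, i, j)"
      proof (intro sum_residue_reps)
        have "mat2 (1 / (t1 * A)) 0 0 (t1 * A) \<in> Cell (Diag, - 1 - i, - j)"
          using Cell_Diag_a [of "1 / (t1 * A)" "t1 * A" 0 0] A t1 va by simp
        then show "ev G (adj (s0_rep 0) ** Eta \<gamma>) = G (Diag, - 1 - i, - j)"
          by (simp add: eq ev_Cell)
        fix u assume u: "u \<in> residue_reps" "u \<noteq> 0"
        note u' = residue_reps_unit [OF u]
        have "1 / (t1 * A) / (u * A) \<in> \<P>" "t1 * A / (u * A) \<in> \<P>" "v (u * A) = (i, j)"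
          using A False u u' t1
          by (auto simp: t1_ideal_iff v_divide v_mult lex_nonneg_def lex_pos_def)
        then have "mat2 (1 / (t1 * A)) (u * A) 0 (t1 * A) \<in> Cell (Anti, i, j)"
          using Cell_Anti_b [of "1 / (t1 * A)" "t1 * A" "u * A" 0] A u t1 by simp
        then show "ev G (adj (s0_rep u) ** Eta \<gamma>) = G (Anti, i, j)"
          by (simp add: eq ev_Cell)
      qed
      then show ?thesis
        using False by (simp add: L0_def \<gamma> Anti)
    qed
  qed
  finally show ?thesis .
qed

lemmas acts_Ls = acts_comp [OF left_reps_s_rep sum_s_rep]
  and acts_L0 = acts_comp [OF left_reps_s0_rep sum_s0_rep]

lemma left_reps_1: "left_reps {mat 1} (Diag, 0, 0)"
proof -
  have "Cell (Diag, 0, 0) = iwahori"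
  proof -
    have "Eta (Diag, 0, 0) = mat 1"
      by (simp add: Eta_def eta_mon mon_def mat_1_mat2)
    then show ?thesis
      using iwahori_mult unfolding Cell_iff set_eq_iff
      by (metis mat_1_iwahori matrix_mul_lid matrix_mul_rid)
  qed
  then show ?thesis
    by (auto simp: left_reps_def)
qed

lemma acts_unit: "acts (unit_coeff (Diag, 0, 0)) (\<lambda>G. G)"
  by (rule acts_unit_coeff [OF left_reps_1]) simp

end

type_synonym coeffs = "kind \<times> int \<times> int \<Rightarrow> complex"

context sl2_two_dim_local_field
begin

section \<open>Powers of \<open>\<Theta>\<^bsub>1,0\<^esub>\<close>\<close>

lemma q_nonzero [simp]: "q \<noteq> 0" "q > 0" "(of_nat q :: complex) \<noteq> 0"
  using q_pos by simp_all

lemma Ls_lincomb: "Ls (\<lambda>\<gamma>. c * F \<gamma> + c' * F' \<gamma>) = (\<lambda>\<gamma>. c * Ls F \<gamma> + c' * Ls F' \<gamma>)"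
  by (auto simp: Ls_def fun_eq_iff algebra_simps split: kind.splits)

lemma L0_lincomb: "L0 (\<lambda>\<gamma>. c * F \<gamma> + c' * F' \<gamma>) = (\<lambda>\<gamma>. c * L0 F \<gamma> + c' * L0 F' \<gamma>)"
  by (auto simp: L0_def fun_eq_iff algebra_simps split: kind.splits)

lemma Ls_Ls: "Ls (Ls F) = (\<lambda>\<gamma>. (of_nat q - 1) * Ls F \<gamma> + of_nat q * F \<gamma>)"
  by (auto simp: Ls_def fun_eq_iff algebra_simps lex_pos_def lex_nonneg_def split: kind.splits)

lemma L0_L0: "L0 (L0 F) = (\<lambda>\<gamma>. (of_nat q - 1) * L0 F \<gamma> + of_nat q * F \<gamma>)"
  by (auto simp: L0_def fun_eq_iff algebra_simps lex_pos_def lex_nonneg_def split: kind.splits)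

text \<open>Left convolution with \<open>\<Theta>\<^bsub>1,0\<^esub>\<close> is \<open>LX = q\<^sup>-\<^sup>1 T\<^sub>s T\<^sub>0\<close>. By the quadratic relations
  \<open>T\<^sup>2 = (q - 1) T + q\<close> the inverse of \<open>T\<close> is \<open>q\<^sup>-\<^sup>1 (T - (q - 1))\<close>, which gives \<open>LX'\<close>.\<close>

definition LX :: "coeffs \<Rightarrow> coeffs" where
  "LX F = (\<lambda>\<gamma>. inverse (of_nat q) * Ls (L0 F) \<gamma>)"

definition Ls' :: "coeffs \<Rightarrow> coeffs" where
  "Ls' F = (\<lambda>\<gamma>. 1 * Ls F \<gamma> + - (of_nat q - 1) * F \<gamma>)"

definition L0' :: "coeffs \<Rightarrow> coeffs" where
  "L0' F = (\<lambda>\<gamma>. 1 * L0 F \<gamma> + - (of_nat q - 1) * F \<gamma>)"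

definition LX' :: "coeffs \<Rightarrow> coeffs" where
  "LX' F = (\<lambda>\<gamma>. inverse (of_nat q) * L0' (Ls' F) \<gamma>)"

lemma Ls_scale: "Ls (\<lambda>\<gamma>. c * F \<gamma>) = (\<lambda>\<gamma>. c * Ls F \<gamma>)"
  and L0_scale: "L0 (\<lambda>\<gamma>. c * F \<gamma>) = (\<lambda>\<gamma>. c * L0 F \<gamma>)"
  using Ls_lincomb [of c F 0] L0_lincomb [of c F 0] by simp_all

lemma LX_lincomb: "LX (\<lambda>\<gamma>. c * F \<gamma> + c' * F' \<gamma>) = (\<lambda>\<gamma>. c * LX F \<gamma> + c' * LX F' \<gamma>)"
  by (simp add: LX_def L0_lincomb Ls_lincomb algebra_simps)

lemma Ls'_scale: "Ls' (\<lambda>\<gamma>. c * F \<gamma>) = (\<lambda>\<gamma>. c * Ls' F \<gamma>)"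
  and L0'_scale: "L0' (\<lambda>\<gamma>. c * F \<gamma>) = (\<lambda>\<gamma>. c * L0' F \<gamma>)"
  by (simp_all add: Ls'_def L0'_def Ls_scale L0_scale algebra_simps)

lemma Ls_Ls': "Ls (Ls' F) = (\<lambda>\<gamma>. of_nat q * F \<gamma>)"
  and Ls'_Ls: "Ls' (Ls F) = (\<lambda>\<gamma>. of_nat q * F \<gamma>)"
  unfolding Ls'_def Ls_lincomb Ls_Ls by (simp_all add: fun_eq_iff algebra_simps)

lemma L0_L0': "L0 (L0' F) = (\<lambda>\<gamma>. of_nat q * F \<gamma>)"
  and L0'_L0: "L0' (L0 F) = (\<lambda>\<gamma>. of_nat q * F \<gamma>)"
  unfolding L0'_def L0_lincomb L0_L0 by (simp_all add: fun_eq_iff algebra_simps)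

lemma LX_LX' [simp]: "LX (LX' F) = F"
  by (simp add: LX_def LX'_def L0_scale Ls_scale L0_L0' Ls_Ls') (simp add: fun_eq_iff field_simps)

lemma LX'_LX [simp]: "LX' (LX F) = F"
  by (simp add: LX_def LX'_def L0'_scale Ls'_scale L0'_L0 Ls'_Ls) (simp add: fun_eq_iff field_simps)

definition LXpow :: "int \<Rightarrow> coeffs \<Rightarrow> coeffs" where
  "LXpow i = (if i \<ge> 0 then LX ^^ nat i else LX' ^^ nat (- i))"

lemma LXpow_0 [simp]: "LXpow 0 F = F"
  by (simp add: LXpow_def)

lemma LXpow_plus1: "LXpow (i + 1) F = LX (LXpow i F)"
proof (cases "i \<ge> 0")
  case True
  then show ?thesis by (simp add: LXpow_def nat_add_distrib)
next
  case False
  define n where "n = nat (- i - 1)"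
  have "nat (- i) = Suc n" "nat (- i - 1) = n" "0 \<le> i + 1 \<longleftrightarrow> n = 0" "nat (i + 1) = 0"
    using False by (auto simp: n_def)
  then show ?thesis using False by (cases "n = 0") (simp_all add: LXpow_def)
qed

lemma LXpow_1 [simp]: "LXpow 1 F = LX F"
  using LXpow_plus1 [of 0 F] by simp

lemma LXpow_minus1: "LXpow (i - 1) F = LX' (LXpow i F)"
  using LXpow_plus1 [of "i - 1" F] by simp

lemma LXpow_cong_shift:
  assumes "\<And>i. LX (A i) = A (i + 1)"
  shows "LXpow i (A k) = A (i + k)"
proof (induction i rule: int_induct [where k = 0])
  case (step1 i)
  then show ?case using assms [of "i + k"] unfolding LXpow_plus1 by (simp add: algebra_simps)
next
  case (step2 i)
  have "LX (A (i - 1 + k)) = A (i + k)"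
    using assms [of "i - 1 + k"] by (simp add: algebra_simps)
  then have "LX' (A (i + k)) = A (i - 1 + k)"
    by (metis LX'_LX)
  then show ?case using step2 by (simp add: LXpow_minus1)
qed simp

text \<open>The coefficients of \<open>X\<^sup>i\<close>; for \<open>i = 0\<close> this is the identity \<open>iota\<close>.\<close>

definition XF :: "int \<Rightarrow> coeffs" where
  "XF i = LXpow i (\<lambda>\<gamma>. of_nat q * unit_coeff (Diag, 0, 0) \<gamma>)"

lemma LX_XF: "LX (XF i) = XF (i + 1)"
  by (simp add: XF_def LXpow_plus1)

lemma LXpow_XF: "LXpow i (XF k) = XF (i + k)"
  by (rule LXpow_cong_shift) (rule LX_XF)

lemma acts_LX: "acts F \<Lambda> \<Longrightarrow> acts (LX F) (\<lambda>G. LX (\<Lambda> G))"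
  using acts_lincomb [OF acts_Ls [OF acts_L0] acts_Ls [OF acts_L0], of F \<Lambda> F \<Lambda> "inverse (of_nat q)" 0]
  by (simp add: LX_def)

lemma acts_LX':
  assumes "acts F \<Lambda>"
  shows "acts (LX' F) (\<lambda>G. LX' (\<Lambda> G))"
proof -
  have "acts (Ls' F) (\<lambda>G. Ls' (\<Lambda> G))"
    unfolding Ls'_def by (intro acts_lincomb acts_Ls assms)
  then have "acts (L0' (Ls' F)) (\<lambda>G. L0' (Ls' (\<Lambda> G)))"
    unfolding L0'_def by (intro acts_lincomb acts_L0)
  from acts_lincomb [OF this this, of "inverse (of_nat q)" 0] show ?thesis
    by (simp add: LX'_def)
qed

lemma acts_XF: "acts (XF i) (\<lambda>G \<gamma>. of_nat q * LXpow i G \<gamma>)"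
proof -
  have scale: "(\<lambda>\<gamma>. c * LX F \<gamma>) = LX (\<lambda>\<gamma>. c * F \<gamma>)" for c F
    using LX_lincomb [of c F 0] by simp
  have scale': "(\<lambda>\<gamma>. c * LX' F \<gamma>) = LX' (\<lambda>\<gamma>. c * F \<gamma>)" for c F
    by (metis scale LX'_LX LX_LX')
  show ?thesis
  proof (induction i rule: int_induct [where k = 0])
    case base
    show ?case
      using acts_lincomb [OF acts_unit acts_unit, of "of_nat q" 0] by (simp add: XF_def)
  next
    case (step1 i)
    then show ?case using acts_LX [OF step1(2)] by (simp add: XF_def LXpow_plus1 scale)
  next
    case (step2 i)
    then show ?case using acts_LX' [OF step2(2)] by (simp add: XF_def LXpow_minus1 scale')
  qed
qed

lemma full_conv_XF_left: "det x = 1 \<Longrightarrow> full_conv (ev (XF i)) (ev G) x = of_nat q * ev (LXpow i G) x"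
  using acts_XF [of i] by (simp add: acts_def ev_scale)

text \<open>The matrix of \<open>LX\<close>. It is triangular with respect to the decomposition into negative and
  positive levels: the values of \<open>LX F\<close> at negative levels depend on those of \<open>F\<close> at negative
  levels only.\<close>

lemma LX_negative_level: "j < 0 \<Longrightarrow> LX F (\<kappa>, i, j) = of_nat q * F (\<kappa>, i - 1, j)"
  by (cases \<kappa>) (auto simp: LX_def Ls_def L0_def lex_pos_def lex_nonneg_def)

lemma LX_unit_coeff:
  assumes "lex_nonneg (i, j)"
  shows "LX (\<lambda>\<gamma>. c * unit_coeff (Diag, i, j) \<gamma>) =
    (\<lambda>\<gamma>. inverse (of_nat q) * c * unit_coeff (Diag, i + 1, j) \<gamma>)"
proof
  fix \<gamma> :: "kind \<times> int \<times> int"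
  obtain \<kappa> k l where \<gamma>: "\<gamma> = (\<kappa>, k, l)" by (cases \<gamma>) auto
  show "LX (\<lambda>\<gamma>. c * unit_coeff (Diag, i, j) \<gamma>) \<gamma> =
      inverse (of_nat q) * c * unit_coeff (Diag, i + 1, j) \<gamma>"
    using assms
    by (cases \<kappa>) (auto simp: \<gamma> LX_def Ls_def L0_def unit_coeff_def lex_pos_def lex_nonneg_def)
qed

lemma XF_positive: "XF (int n + 1) = (\<lambda>\<gamma>. inverse (of_nat q) ^ n * unit_coeff (Diag, int n + 1, 0) \<gamma>)"
proof (induction n)
  case 0
  show ?case using LX_unit_coeff [of 0 0 "of_nat q"] by (simp add: XF_def lex_nonneg_def fun_eq_iff)
next
  case (Suc n)
  then show ?case
    using LX_XF [of "int n + 1"] LX_unit_coeff [of "int n + 1" 0 "inverse (of_nat q) ^ n"]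
    by (simp add: lex_nonneg_def algebra_simps)
qed

lemma XF_minus1: "XF (- 1) = (\<lambda>\<gamma>. unit_coeff (Diag, - 1, 0) \<gamma>
    - (of_nat q - 1) * unit_coeff (Anti, - 1, 0) \<gamma> - (of_nat q - 1) * unit_coeff (Anti, 0, 0) \<gamma>
    + of_nat q * (of_nat q + inverse (of_nat q) - 2) * unit_coeff (Diag, 0, 0) \<gamma>)" (is "_ = ?T")
proof
  fix \<gamma> :: "kind \<times> int \<times> int"
  obtain \<kappa> k l where \<gamma>: "\<gamma> = (\<kappa>, k, l)" by (cases \<gamma>) auto
  have eq: "XF (- 1) = LX' (\<lambda>\<gamma>. of_nat q * unit_coeff (Diag, 0, 0) \<gamma>)"
    using LXpow_minus1 [of 0] by (simp add: XF_def)
  show "XF (- 1) \<gamma> = ?T \<gamma>"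
    unfolding eq
    by (cases \<kappa>)
       (auto simp: \<gamma> LX'_def L0'_def Ls'_def Ls_def L0_def unit_coeff_def lex_pos_def
          lex_nonneg_def field_simps)
qed

subsection \<open>Supports\<close>

definition level_supported :: "int \<Rightarrow> coeffs \<Rightarrow> bool" where
  "level_supported j F \<longleftrightarrow> (\<forall>\<kappa> i l. F (\<kappa>, i, l) \<noteq> 0 \<longrightarrow> l = j)"

lemma
  assumes "level_supported 0 F"
  shows level_supported_Ls: "level_supported 0 (Ls F)"
    and level_supported_L0: "level_supported 0 (L0 F)"
proof -
  have F: "F (\<kappa>, i, l) = 0" if "l \<noteq> 0" for \<kappa> i l
    using assms that by (auto simp: level_supported_def)
  have "Ls F (\<kappa>, i, l) = 0 \<and> L0 F (\<kappa>, i, l) = 0" if "l \<noteq> 0" for \<kappa> i l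
    using that by (cases \<kappa>) (simp_all add: Ls_def L0_def F)
  then show "level_supported 0 (Ls F)" "level_supported 0 (L0 F)"
    unfolding level_supported_def by blast+
qed

lemma finite_support_involution:
  assumes "finite {\<gamma>. F \<gamma> \<noteq> 0}" "\<And>\<gamma>. f (f \<gamma>) = \<gamma>" "\<And>\<gamma>. F \<gamma> = 0 \<Longrightarrow> F (f \<gamma>) = 0 \<Longrightarrow> G \<gamma> = 0"
  shows "finite {\<gamma>. G \<gamma> \<noteq> 0}"
proof (rule finite_subset)
  show "{\<gamma>. G \<gamma> \<noteq> 0} \<subseteq> {\<gamma>. F \<gamma> \<noteq> 0} \<union> f ` {\<gamma>. F \<gamma> \<noteq> 0}"
  proof
    fix \<gamma> assume "\<gamma> \<in> {\<gamma>. G \<gamma> \<noteq> 0}"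
    then have "F \<gamma> \<noteq> 0 \<or> F (f \<gamma>) \<noteq> 0" using assms(3) by blast
    then show "\<gamma> \<in> {\<gamma>. F \<gamma> \<noteq> 0} \<union> f ` {\<gamma>. F \<gamma> \<noteq> 0}"
      using image_eqI [of \<gamma> f "f \<gamma>"] assms(2) [of \<gamma>] by auto
  qed
qed (use assms(1) in simp)

lemma
  assumes "finite {\<gamma>. F \<gamma> \<noteq> 0}"
  shows finite_support_Ls: "finite {\<gamma>. Ls F \<gamma> \<noteq> 0}"
    and finite_support_L0: "finite {\<gamma>. L0 F \<gamma> \<noteq> 0}"
proof -
  define op where "op \<kappa> = (case \<kappa> of Diag \<Rightarrow> Anti | Anti \<Rightarrow> Diag)" for \<kappa>
  have op: "op (op \<kappa>) = \<kappa>" for \<kappa> by (cases \<kappa>) (simp_all add: op_def)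
  show "finite {\<gamma>. Ls F \<gamma> \<noteq> 0}"
    by (rule finite_support_involution [OF assms, of "\<lambda>(\<kappa>, i, j). (op \<kappa>, - i, - j)"])
       (auto simp: op op_def Ls_def split: kind.splits prod.splits if_splits)
  show "finite {\<gamma>. L0 F \<gamma> \<noteq> 0}"
    by (rule finite_support_involution [OF assms, of "\<lambda>(\<kappa>, i, j). (op \<kappa>, - 1 - i, - j)"])
       (auto simp: op op_def L0_def split: kind.splits prod.splits if_splits)
qed

lemma finite_support_lincomb:
  assumes "finite {\<gamma>. F \<gamma> \<noteq> 0}" "finite {\<gamma>. F' \<gamma> \<noteq> 0}"
  shows "finite {\<gamma>. c * F \<gamma> + c' * F' \<gamma> \<noteq> (0 :: complex)}"
  by (rule finite_subset [OF _ finite_UnI [OF assms]]) auto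

lemma level_supported_lincomb:
  "level_supported j F \<Longrightarrow> level_supported j F' \<Longrightarrow>
   level_supported j (\<lambda>\<gamma>. c * F \<gamma> + c' * F' \<gamma>)"
  unfolding level_supported_def by (metis add.right_neutral mult_zero_right)

lemma XF_level_0: "level_supported 0 (XF i) \<and> finite {\<gamma>. XF i \<gamma> \<noteq> 0}"
proof (induction i rule: int_induct [where k = 0])
  case base
  show ?case
    by (auto simp: XF_def level_supported_def unit_coeff_def)
next
  case (step1 i)
  have "level_supported 0 (\<lambda>\<gamma>. inverse (of_nat q) * Ls (L0 (XF i)) \<gamma> + 0 * XF i \<gamma>) \<and>
      finite {\<gamma>. inverse (of_nat q) * Ls (L0 (XF i)) \<gamma> + 0 * XF i \<gamma> \<noteq> 0}"
    using step1 by (intro conjI level_supported_lincomb finite_support_lincomb level_supported_Ls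
        level_supported_L0 finite_support_Ls finite_support_L0) auto
  then show ?case by (simp add: LX_XF [symmetric] LX_def)
next
  case (step2 i)
  have "level_supported 0 (Ls' (XF i)) \<and> finite {\<gamma>. Ls' (XF i) \<gamma> \<noteq> 0}"
    unfolding Ls'_def using step2
    by (intro conjI level_supported_lincomb finite_support_lincomb level_supported_Ls
        finite_support_Ls) auto
  then have "level_supported 0 (L0' (Ls' (XF i))) \<and> finite {\<gamma>. L0' (Ls' (XF i)) \<gamma> \<noteq> 0}"
    unfolding L0'_def
    by (intro conjI level_supported_lincomb finite_support_lincomb level_supported_L0
        finite_support_L0) auto
  moreover have "XF (i - 1) = LX' (XF i)"
    by (simp add: XF_def LXpow_minus1)
  ultimately show ?case
    by (auto simp: LX'_def level_supported_def)
qed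

subsection \<open>Right convolution\<close>

text \<open>The action of \<open>\<sigma>\<close> on coefficients.\<close>

definition swap_coeffs :: "coeffs \<Rightarrow> coeffs" where
  "swap_coeffs F = (\<lambda>\<gamma>. F (swap \<gamma>))"

lemma swap_coeffs_SW [simp]: "swap_coeffs (swap_coeffs F) = F"
  by (simp add: swap_coeffs_def)

lemma ev_sigma: "ev F (\<sigma> M) = ev (swap_coeffs F) M"
proof (cases "det M = 1")
  case True
  then obtain \<gamma> where "M \<in> Cell \<gamma>" using Bruhat_exists by blast
  moreover from this have "\<sigma> M \<in> Cell (swap \<gamma>)"
    using lead_sigma by (simp add: Cell_iff_lead)
  ultimately show ?thesis
    by (simp add: ev_Cell swap_coeffs_def)
qed (simp add: ev_no_det)

text \<open>For given \<open>x\<close>, the substitution \<open>k \<mapsto> \<sigma>(k)\<^sup>-\<^sup>1 x\<close> on right cosets exchanges the two factors of the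
  convolution.\<close>

definition flip :: "'f ^ 2 ^ 2 \<Rightarrow> ('f ^ 2 ^ 2) set \<Rightarrow> ('f ^ 2 ^ 2) set" where
  "flip x K = rcos (adj (\<sigma> (rep K)) ** x)"

lemma flip_in_RC: "det x = 1 \<Longrightarrow> K \<in> RC \<Longrightarrow> flip x K \<in> RC"
  using det_rep by (auto simp: flip_def RC_def det_mul)

lemma flip_flip:
  assumes "det x = 1" "K \<in> RC"
  shows "flip (\<sigma> x) (flip x K) = K"
proof -
  let ?k = "rep K"
  obtain h where h: "h \<in> iwahori" "rep (flip x K) = h ** (adj (\<sigma> ?k) ** x)"
    using rep_rcos unfolding flip_def by blast
  have k: "det ?k = 1" using assms det_rep by simp
  have "\<sigma> (rep (flip x K)) = \<sigma> x ** adj ?k ** \<sigma> h"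
    by (simp add: h sigma_mult sigma_adj)
  then have "adj (\<sigma> (rep (flip x K))) ** \<sigma> x = adj (\<sigma> h) ** ?k"
    using assms by (simp add: adj_mult adj_inverse flip: matrix_mul_assoc)
  then have "flip (\<sigma> x) (flip x K) = rcos (adj (\<sigma> h) ** ?k)"
    by (simp add: flip_def)
  also have "\<dots> = rcos ?k"
    using h k det_iwahori [OF h(1)]
    by (intro rcos_eqI) (simp_all add: det_mul adj_inverse flip: matrix_mul_assoc)
  finally show ?thesis using rcos_rep assms by simp
qed

lemma full_conv_sigma:
  assumes "det x = 1"
  shows "full_conv (ev F) (ev G) (\<sigma> x) = full_conv (ev (swap_coeffs G)) (ev (swap_coeffs F)) x"
proof -
  have bij: "bij_betw (flip (\<sigma> x)) RC RC"
  proof (rule bij_betwI [where g = "flip x"])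
    show "flip (\<sigma> x) \<in> RC \<rightarrow> RC" "flip x \<in> RC \<rightarrow> RC"
      using assms flip_in_RC by simp_all
    show "flip x (flip (\<sigma> x) K) = K" if "K \<in> RC" for K
      using flip_flip [of "\<sigma> x" K] assms that by simp
    show "flip (\<sigma> x) (flip x K) = K" if "K \<in> RC" for K
      using flip_flip [of x K] assms that by simp
  qed
  have "full_conv (ev F) (ev G) (\<sigma> x) =
      (\<Sum>\<^sub>\<infinity>K\<in>RC. ev F (\<sigma> x ** adj (rep (flip (\<sigma> x) K))) * ev G (rep (flip (\<sigma> x) K)))"
    unfolding full_conv_def by (rule infsum_reindex_bij_betw [OF bij, symmetric])
  also have "\<dots> = full_conv (ev (swap_coeffs G)) (ev (swap_coeffs F)) x"
    unfolding full_conv_def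
  proof (rule infsum_cong)
    fix K assume K: "K \<in> RC"
    let ?k = "rep K"
    have "\<sigma> x ** adj (adj (\<sigma> ?k) ** \<sigma> x) = \<sigma> ?k"
      using assms by (simp add: adj_mult adj_inverse matrix_mul_assoc)
    then have "ev F (\<sigma> x ** adj (rep (flip (\<sigma> x) K))) = ev (swap_coeffs F) ?k"
      by (simp add: flip_def ev_sigma)
    moreover have "ev G (rep (flip (\<sigma> x) K)) = ev (swap_coeffs G) (x ** adj ?k)"
      by (simp add: flip_def sigma_mult sigma_adj flip: ev_sigma)
    ultimately show "ev F (\<sigma> x ** adj (rep (flip (\<sigma> x) K))) * ev G (rep (flip (\<sigma> x) K)) =
        ev (swap_coeffs G) (x ** adj ?k) * ev (swap_coeffs F) ?k" by simp
  qed
  finally show ?thesis .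
qed

lemma unit_coeff_swap [simp]: "unit_coeff \<alpha> (swap \<gamma>) = unit_coeff (swap \<alpha>) \<gamma>"
proof -
  have "swap \<gamma> = \<alpha> \<longleftrightarrow> \<gamma> = swap \<alpha>" by (metis swap_swap)
  then show ?thesis by (simp add: unit_coeff_def)
qed

text \<open>As \<open>\<sigma>\<close> reverses products and fixes \<open>X\<close> and its inverse, it fixes all their powers.\<close>

lemma swap_coeffs_XF [simp]: "swap_coeffs (XF i) = XF i"
proof -
  have step: "swap_coeffs (XF (i + k)) = XF (i + k)" if "swap_coeffs (XF i) = XF i" "swap_coeffs (XF k) = XF k" for i k
  proof -
    have "of_nat q * ev (swap_coeffs (XF (i + k))) x = of_nat q * ev (XF (i + k)) x" if x: "det x = 1" for x
    proof -
      have "of_nat q * ev (swap_coeffs (XF (i + k))) x = full_conv (ev (XF i)) (ev (XF k)) (\<sigma> x)"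
        using x by (simp add: full_conv_XF_left LXpow_XF ev_sigma)
      also have "\<dots> = full_conv (ev (XF k)) (ev (XF i)) x"
        using x that(1) \<open>swap_coeffs (XF i) = XF i\<close> \<open>swap_coeffs (XF k) = XF k\<close> by (simp add: full_conv_sigma)
      also have "\<dots> = of_nat q * ev (XF (i + k)) x"
        using x by (simp add: full_conv_XF_left LXpow_XF add.commute)
      finally show ?thesis .
    qed
    then have "ev (swap_coeffs (XF (i + k))) (Eta \<gamma>) = ev (XF (i + k)) (Eta \<gamma>)" for \<gamma>
      by (metis det_Eta mult_cancel_left q_nonzero(3))
    then show ?thesis by (simp add: fun_eq_iff field_simps)
  qed
  have "XF 1 = (\<lambda>\<gamma>. 1 * unit_coeff (Diag, 1, 0) \<gamma>)"
    using XF_positive [of 0] by simp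
  then have 1: "swap_coeffs (XF 1) = XF 1" "swap_coeffs (XF (- 1)) = XF (- 1)"
    unfolding XF_minus1 by (simp_all add: swap_coeffs_def fun_eq_iff)
  have 0: "swap_coeffs (XF 0) = XF 0"
    by (simp add: XF_def swap_coeffs_def)
  show ?thesis
    by (induction i rule: int_induct [where k = 0]) (use 0 1 step [of _ 1] step [of _ "- 1"] in auto)
qed

definition RXpow :: "int \<Rightarrow> coeffs \<Rightarrow> coeffs" where
  "RXpow i F = swap_coeffs (LXpow i (swap_coeffs F))"

lemma full_conv_XF_right:
  assumes "det x = 1"
  shows "full_conv (ev G) (ev (XF i)) x = of_nat q * ev (RXpow i G) x"
  using full_conv_sigma [of "\<sigma> x" G "XF i"] assms by (simp add: full_conv_XF_left RXpow_def flip: ev_sigma)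

lemma finite_right_XF: "finite {K \<in> RC. ev (XF i) (rep K) \<noteq> 0}"
proof -
  have "finite {K \<in> RC. ev (XF i) (mat 1 ** adj (rep K)) \<noteq> 0}"
    using acts_XF [of i] det_I unfolding acts_def left_finite_def by blast
  then have "finite (flip (mat 1) ` {K \<in> RC. ev (XF i) (adj (rep K)) \<noteq> 0})"
    by simp
  moreover have "{K \<in> RC. ev (XF i) (rep K) \<noteq> 0} \<subseteq>
      flip (mat 1) ` {K \<in> RC. ev (XF i) (adj (rep K)) \<noteq> 0}"
  proof
    fix K assume K: "K \<in> {K \<in> RC. ev (XF i) (rep K) \<noteq> 0}"
    have s1: "\<sigma> (mat 1) = mat 1" "det (mat 1 :: 'f ^ 2 ^ 2) = 1"
      by (simp_all add: mat_1_mat2)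
    obtain h where h: "h \<in> iwahori" "rep (flip (mat 1) K) = h ** adj (\<sigma> (rep K))"
      using rep_rcos [of "adj (\<sigma> (rep K))"] by (auto simp: flip_def)
    then have "ev (XF i) (adj (rep (flip (mat 1) K))) = ev (XF i) (rep K)"
      by (simp add: adj_mult ev_sigma)
    then show "K \<in> flip (mat 1) ` {K \<in> RC. ev (XF i) (adj (rep K)) \<noteq> 0}"
      using K flip_flip [of "mat 1" K] s1 flip_in_RC [of "mat 1" K]
      by (intro image_eqI [of _ _ "flip (mat 1) K"]) auto
  qed
  ultimately show ?thesis by (rule finite_subset [rotated])
qed

lemma RXpow_cong_shift:
  assumes "\<And>i. RXpow 1 (A i) = A (i + 1)"
  shows "RXpow i (A k) = A (i + k)"
proof -
  have "LX (swap_coeffs (A i)) = swap_coeffs (A (i + 1))" for i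
    using assms [of i] by (simp add: RXpow_def flip: swap_coeffs_SW)
      (metis swap_coeffs_SW)
  then have "LXpow i (swap_coeffs (A k)) = swap_coeffs (A (i + k))"
    by (rule LXpow_cong_shift)
  then show ?thesis by (simp add: RXpow_def)
qed

text \<open>Right multiplication by the group elements of level zero does not mix the levels.\<close>

lemma RX_level_supported:
  assumes "level_supported j F" "j \<noteq> 0"
  shows "level_supported j (RXpow 1 F)"
proof -
  have F: "F (\<kappa>, i, l) = 0" if "l \<noteq> j" for \<kappa> i l
    using assms that by (auto simp: level_supported_def)
  have "RXpow 1 F (\<kappa>, i, l) = 0" if "l \<noteq> j" for \<kappa> i l
    using that
    by (cases \<kappa>) (auto simp: RXpow_def swap_coeffs_def LX_def Ls_def L0_def F)
  then show ?thesis by (auto simp: level_supported_def)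
qed

lemma RX_negative_level:
  assumes "j < 0"
  shows "RXpow 1 F (Diag, i, j) = of_nat q * F (Diag, i - 1, j)"
    and "RXpow 1 F (Anti, i, j) = inverse (of_nat q) * F (Anti, i + 1, j)
      + (of_nat q - 1) * (F (Diag, i, j) + inverse (of_nat q) * F (Diag, i + 1, j))"
  using assms
  by (auto simp: RXpow_def swap_coeffs_def LX_def Ls_def L0_def lex_pos_def lex_nonneg_def field_simps)

end

context sl2_two_dim_local_field
begin

section \<open>The truncated convolution\<close>

lemma level_iff: "x \<in> Cell (\<kappa>, i, j) \<Longrightarrow> x \<in> level l \<longleftrightarrow> l = j"
proof -
  assume x: "x \<in> Cell (\<kappa>, i, j)"
  have "x \<in> level l \<longleftrightarrow> (\<exists>\<kappa>' m. x \<in> Cell (\<kappa>', m, l))"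
    by (auto simp: level_def Cell_def) (metis kind.exhaust)
  then show ?thesis
    using x Cell_disjoint [OF x] by blast
qed

lemma eta_of_Cell: "x \<in> Cell \<gamma> \<Longrightarrow> eta_of x = Eta \<gamma>"
proof -
  assume x: "x \<in> Cell \<gamma>"
  obtain \<kappa> i j where \<gamma>: "\<gamma> = (\<kappa>, i, j)" by (cases \<gamma>) auto
  have cell: "x \<in> cell a k l \<longleftrightarrow> (a, k, l) = \<gamma>" for a k l
    using x Cell_disjoint [OF x, of "(a, k, l)"] by (auto simp: Cell_def)
  show ?thesis
    unfolding eta_of_def cell by (auto simp: \<gamma> Eta_def intro!: the_equality)
qed

lemma conv_chi_Cell:
  assumes x: "x \<in> Cell (\<kappa>, e, l')"
  shows "conv_chi (a, i, j) (b, k, l) x =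
    (if l' = j + l \<and> 0 \<le> j * l
     then inverse (of_nat q) * full_conv (ev (unit_coeff (a, i, j))) (ev (unit_coeff (b, k, l))) (Eta (\<kappa>, e, l'))
     else 0)"
proof -
  have in_RC: "rcos y \<in> RC" if "y \<in> Cell (b, k, l)" for y
    using that det_Cell by (auto simp: RC_def)
  have "(\<Sum>\<^sub>\<infinity>K \<in> (\<lambda>z. iwahori #>\<^bsub>SL2\<^esub> z) ` cell b k l.
          chi a i j (eta_of x \<otimes>\<^bsub>SL2\<^esub> inv\<^bsub>SL2\<^esub> (SOME z. z \<in> K))) =
      (\<Sum>\<^sub>\<infinity>K \<in> rcos ` Cell (b, k, l). ev (unit_coeff (a, i, j)) (Eta (\<kappa>, e, l') ** adj (rep K)))"
    unfolding r_coset_rcos Cell_def prod.case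
  proof (rule infsum_cong)
    fix K assume "K \<in> rcos ` cell b k l"
    then have "K \<in> RC" using in_RC by (auto simp: Cell_def)
    then have "inv\<^bsub>SL2\<^esub> (SOME z. z \<in> K) = adj (rep K)"
      using det_rep inv_SL2 by (auto simp: rep_def)
    then show "chi a i j (eta_of x \<otimes>\<^bsub>SL2\<^esub> inv\<^bsub>SL2\<^esub> (SOME z. z \<in> K)) =
        ev (unit_coeff (a, i, j)) (Eta (\<kappa>, e, l') ** adj (rep K))"
      using eta_of_Cell [OF x] by (simp add: chi_ev)
  qed
  also have "\<dots> = full_conv (ev (unit_coeff (a, i, j))) (ev (unit_coeff (b, k, l))) (Eta (\<kappa>, e, l'))"
    unfolding full_conv_def
  proof (rule infsum_cong_neutral)
    fix K assume K: "K \<in> RC - rcos ` Cell (b, k, l)"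
    then have "rep K \<notin> Cell (b, k, l)"
      using rcos_rep [of K] by (metis DiffE image_eqI)
    then show "ev (unit_coeff (a, i, j)) (Eta (\<kappa>, e, l') ** adj (rep K)) *
        ev (unit_coeff (b, k, l)) (rep K) = 0"
      by (simp add: ev_unit_coeff)
  next
    fix K assume "K \<in> rcos ` Cell (b, k, l) \<inter> RC"
    then show "ev (unit_coeff (a, i, j)) (Eta (\<kappa>, e, l') ** adj (rep K)) =
        ev (unit_coeff (a, i, j)) (Eta (\<kappa>, e, l') ** adj (rep K)) *
        ev (unit_coeff (b, k, l)) (rep K)"
      by (auto simp: ev_Cell unit_coeff_def)
  qed (use in_RC in blast)
  finally show ?thesis
    using level_iff [OF x] by (auto simp: conv_chi_def)
qed

lemma conv_chi_biinvariant: "x \<in> Cell \<gamma> \<Longrightarrow> conv_chi \<alpha> \<beta> x = conv_chi \<alpha> \<beta> (Eta \<gamma>)"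
  using conv_chi_Cell [of x] conv_chi_Cell [OF Eta_in_Cell] by (cases \<alpha>; cases \<beta>; cases \<gamma>) simp

lemma conv_chi_outside: "det x \<noteq> 1 \<Longrightarrow> conv_chi \<alpha> \<beta> x = 0"
proof -
  assume "det x \<noteq> 1"
  then have "x \<notin> level l" for l
    using det_Cell [of x "(\<kappa>, i, l)" for \<kappa> i] by (auto simp: level_def Cell_def)
  then show ?thesis by (cases \<alpha>; cases \<beta>) (simp add: conv_chi_def)
qed

lemma conv_outside: "det x \<noteq> 1 \<Longrightarrow> conv f g x = 0"
  by (simp add: conv_def case_prod_unfold conv_chi_outside)

text \<open>The convolution of biinvariant functions is an infinite sum over pairs of double cosets; it
  is bilinear on functions for which this sum is finite everywhere.\<close>

definition conv_finite :: "coeffs \<Rightarrow> coeffs \<Rightarrow> bool" where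
  "conv_finite F G \<longleftrightarrow> (\<forall>x. finite {p. F (fst p) * G (snd p) * conv_chi (fst p) (snd p) x \<noteq> 0})"

lemma conv_ev: "conv (ev F) (ev G) x = (\<Sum>\<^sub>\<infinity>p\<in>UNIV. F (fst p) * G (snd p) * conv_chi (fst p) (snd p) x)"
  by (simp add: conv_def case_prod_unfold)

lemma conv_finiteI:
  assumes "\<And>\<gamma>. finite {p. F (fst p) * G (snd p) * conv_chi (fst p) (snd p) (Eta \<gamma>) \<noteq> 0}"
  shows "conv_finite F G"
  unfolding conv_finite_def
proof
  fix x
  show "finite {p. F (fst p) * G (snd p) * conv_chi (fst p) (snd p) x \<noteq> 0}"
  proof (cases "det x = 1")
    case True
    then obtain \<kappa> e l where x: "x \<in> Cell (\<kappa>, e, l)" using Bruhat_exists by (metis surj_pair)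
    show ?thesis using assms by (simp add: conv_chi_biinvariant [OF x])
  qed (simp add: conv_chi_outside)
qed

lemma conv_ev_eqI:
  assumes "\<And>\<gamma>. conv (ev F) (ev G) (Eta \<gamma>) = H \<gamma>"
  shows "conv (ev F) (ev G) = ev H"
proof
  fix x
  show "conv (ev F) (ev G) x = ev H x"
  proof (cases "det x = 1")
    case True
    then obtain \<kappa> e l where x: "x \<in> Cell (\<kappa>, e, l)" using Bruhat_exists by (metis surj_pair)
    then have "conv (ev F) (ev G) x = conv (ev F) (ev G) (Eta (\<kappa>, e, l))"
      by (simp add: conv_ev conv_chi_biinvariant [OF x])
    then show ?thesis using assms x by (simp add: ev_Cell)
  qed (simp add: conv_outside ev_no_det)
qed

text \<open>If the sum over cosets that defines \<open>full_conv\<close> is finite, then sorting its terms by double cosets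
  shows that the truncated convolution is a restriction of \<open>full_conv\<close>.\<close>

lemma
  assumes F: "level_supported j F" and G: "level_supported l G"
    and fin: "finite {K \<in> RC. ev F (Eta (\<kappa>, e, l') ** adj (rep K)) \<noteq> 0 \<and> ev G (rep K) \<noteq> 0}"
  shows conv_pairs_finite:
      "finite {p. F (fst p) * G (snd p) * conv_chi (fst p) (snd p) (Eta (\<kappa>, e, l')) \<noteq> 0}"
    and conv_eq_full_conv: "conv (ev F) (ev G) (Eta (\<kappa>, e, l')) =
      (if l' = j + l \<and> 0 \<le> j * l
       then inverse (of_nat q) * full_conv (ev F) (ev G) (Eta (\<kappa>, e, l')) else 0)"
proof -
  let ?\<eta> = "Eta (\<kappa>, e, l')"
  define \<K> where "\<K> = {K \<in> RC. ev F (?\<eta> ** adj (rep K)) \<noteq> 0 \<and> ev G (rep K) \<noteq> 0}"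
  define ix where "ix M = (SOME \<gamma>. M \<in> Cell \<gamma>)" for M
  have ix: "M \<in> Cell \<gamma> \<longleftrightarrow> ix M = \<gamma>" if "det M = 1" for M \<gamma>
    using someI_ex [OF Bruhat_exists [OF that]] Cell_disjoint unfolding ix_def by blast
  define pr where "pr K = (ix (?\<eta> ** adj (rep K)), ix (rep K))" for K
  have det: "det (?\<eta> ** adj (rep K)) = 1" "det (rep K) = 1" if "K \<in> RC" for K
    using that det_rep by (simp_all add: det_mul)
  have evs: "ev H (?\<eta> ** adj (rep K)) = H (fst (pr K))" "ev H (rep K) = H (snd (pr K))"
    if "K \<in> RC" for K H
  proof -
    have "?\<eta> ** adj (rep K) \<in> Cell (ix (?\<eta> ** adj (rep K)))" "rep K \<in> Cell (ix (rep K))"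
      using ix det that by blast+
    then show "ev H (?\<eta> ** adj (rep K)) = H (fst (pr K))" "ev H (rep K) = H (snd (pr K))"
      unfolding pr_def fst_conv snd_conv by (blast intro: ev_Cell)+
  qed
  have \<K>: "finite \<K>" "\<K> \<subseteq> RC" using fin by (auto simp: \<K>_def)
  let ?c = "if l' = j + l \<and> 0 \<le> j * l then inverse (of_nat q) else (0 :: complex)"
  let ?t = "\<lambda>p. F (fst p) * G (snd p) * conv_chi (fst p) (snd p) ?\<eta>"
  have t: "?t p = (\<Sum>K\<in>\<K>. if pr K = p then ?c * (F (fst p) * G (snd p)) else 0)" for p
  proof (cases "F (fst p) * G (snd p) = 0")
    case False
    obtain a i m b k n where p: "p = ((a, i, m), (b, k, n))" by (metis surj_pair)
    have mn: "m = j" "n = l"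
      using False F G by (auto simp: p level_supported_def)
    have "full_conv (ev (unit_coeff (fst p))) (ev (unit_coeff (snd p))) ?\<eta> =
        (\<Sum>K\<in>\<K>. ev (unit_coeff (fst p)) (?\<eta> ** adj (rep K)) * ev (unit_coeff (snd p)) (rep K))"
      using False by (intro full_conv_finite \<K>) (auto simp: \<K>_def evs unit_coeff_def)
    also have "\<dots> = (\<Sum>K\<in>\<K>. if pr K = p then 1 else 0)"
      using \<K> evs by (intro sum.cong) (auto simp: unit_coeff_def prod_eq_iff)
    finally have "conv_chi (fst p) (snd p) ?\<eta> = ?c * (\<Sum>K\<in>\<K>. if pr K = p then 1 else 0)"
      by (auto simp: p mn conv_chi_Cell [OF Eta_in_Cell])
    then have "?t p = (\<Sum>K\<in>\<K>. F (fst p) * G (snd p) * (?c * (if pr K = p then 1 else 0)))"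
      by (simp only: sum_distrib_left)
    also have "\<dots> = (\<Sum>K\<in>\<K>. if pr K = p then ?c * (F (fst p) * G (snd p)) else 0)"
      by (intro sum.cong refl) (simp add: mult.commute)
    finally show ?thesis .
  next
    case True
    then show ?thesis
      by (simp only: mult_zero_left mult_zero_right if_cancel sum.neutral_const)
  qed
  have t0: "?t p = 0" if "p \<notin> pr ` \<K>" for p
    unfolding t using that by (intro sum.neutral) auto
  have sub: "{p. ?t p \<noteq> 0} \<subseteq> pr ` \<K>"
    using t0 by blast
  then show fin': "finite {p. ?t p \<noteq> 0}"
    using \<K> by (auto elim: finite_subset)
  have "conv (ev F) (ev G) ?\<eta> = (\<Sum>p\<in>pr ` \<K>. ?t p)"
    unfolding conv_ev infsum_finite [OF finite_imageI [OF \<K>(1)], symmetric]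
    by (rule infsum_cong_neutral) (use t0 in auto)
  also have "\<dots> = (\<Sum>K\<in>\<K>. \<Sum>p\<in>pr ` \<K>. if pr K = p then ?c * (F (fst p) * G (snd p)) else 0)"
    unfolding t by (rule sum.swap)
  also have "\<dots> = (\<Sum>K\<in>\<K>. ?c * (F (fst (pr K)) * G (snd (pr K))))"
    using \<K> by (intro sum.cong refl) simp
  also have "\<dots> = ?c * (\<Sum>K\<in>\<K>. ev F (?\<eta> ** adj (rep K)) * ev G (rep K))"
    unfolding sum_distrib_left using \<K> evs by (intro sum.cong) auto
  also have "(\<Sum>K\<in>\<K>. ev F (?\<eta> ** adj (rep K)) * ev G (rep K)) = full_conv (ev F) (ev G) ?\<eta>"
    by (rule full_conv_finite [symmetric]) (use \<K> in \<open>auto simp: \<K>_def\<close>)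
  finally show "conv (ev F) (ev G) ?\<eta> =
      (if l' = j + l \<and> 0 \<le> j * l then inverse (of_nat q) * full_conv (ev F) (ev G) ?\<eta> else 0)"
    by simp
qed

lemma conv_opposite_levels:
  assumes "level_supported j F" "level_supported l G" "j * l < 0"
  shows "conv (ev F) (ev G) = (\<lambda>x. 0)" "conv_finite F G"
proof -
  have "F (fst p) * G (snd p) * conv_chi (fst p) (snd p) (Eta \<gamma>) = 0" for p \<gamma>
  proof (cases "F (fst p) * G (snd p) = 0")
    case False
    obtain a i m b k n where p: "p = ((a, i, m), (b, k, n))" by (metis surj_pair)
    obtain \<kappa> e l' where \<gamma>: "\<gamma> = (\<kappa>, e, l')" by (metis surj_pair)
    have mn: "m = j" "n = l"
      using False assms by (auto simp: p level_supported_def)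
    show ?thesis
      using assms(3) unfolding p \<gamma> mn by (simp add: conv_chi_Cell [OF Eta_in_Cell])
  qed auto
  note zero = this
  show "conv_finite F G"
    by (rule conv_finiteI) (simp only: zero not_True_eq_False, simp)
  have "conv (ev F) (ev G) = ev (\<lambda>\<gamma>. 0)"
    by (rule conv_ev_eqI) (simp only: conv_ev zero infsum_0_simp)
  then show "conv (ev F) (ev G) = (\<lambda>x. 0)"
    by simp
qed

text \<open>Convolution with a power of \<open>\<Theta>\<^bsub>1,0\<^esub>\<close> is the restriction to one level of the operator
  that describes the untruncated convolution.\<close>

definition restrict_level :: "int \<Rightarrow> coeffs \<Rightarrow> coeffs" where
  "restrict_level j F = (\<lambda>(\<kappa>, i, l). if l = j then F (\<kappa>, i, l) else 0)"

lemma restrict_level_supported: "level_supported j F \<Longrightarrow> restrict_level j F = F"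
  unfolding restrict_level_def level_supported_def by (rule ext) (auto split: prod.splits; metis)

lemma
  assumes G: "level_supported l G"
  shows conv_XF_left: "conv (ev (XF i)) (ev G) = ev (restrict_level l (LXpow i G))"
    and conv_finite_XF_left: "conv_finite (XF i) G"
proof -
  have fin: "finite {K \<in> RC. ev (XF i) (Eta (\<kappa>, e, l') ** adj (rep K)) \<noteq> 0 \<and> ev G (rep K) \<noteq> 0}" for \<kappa> e l'
  proof (rule finite_subset)
    show "finite {K \<in> RC. ev (XF i) (Eta (\<kappa>, e, l') ** adj (rep K)) \<noteq> 0}"
      using acts_XF [of i] det_Eta unfolding acts_def left_finite_def by blast
  qed auto
  note * = XF_level_0 [of i, THEN conjunct1] G fin
  show "conv (ev (XF i)) (ev G) = ev (restrict_level l (LXpow i G))"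
  proof (rule conv_ev_eqI)
    fix \<gamma> :: "kind \<times> int \<times> int"
    obtain \<kappa> e l' where \<gamma>: "\<gamma> = (\<kappa>, e, l')" by (metis surj_pair)
    show "conv (ev (XF i)) (ev G) (Eta \<gamma>) = restrict_level l (LXpow i G) \<gamma>"
      unfolding \<gamma> conv_eq_full_conv [OF *] by (simp add: full_conv_XF_left restrict_level_def)
  qed
  show "conv_finite (XF i) G"
  proof (rule conv_finiteI)
    fix \<gamma> :: "kind \<times> int \<times> int"
    obtain \<kappa> e l' where \<gamma>: "\<gamma> = (\<kappa>, e, l')" by (metis surj_pair)
    show "finite {p. XF i (fst p) * G (snd p) * conv_chi (fst p) (snd p) (Eta \<gamma>) \<noteq> 0}"
      unfolding \<gamma> by (rule conv_pairs_finite [OF *])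
  qed
qed

lemma
  assumes G: "level_supported l G"
  shows conv_XF_right: "conv (ev G) (ev (XF i)) = ev (restrict_level l (RXpow i G))"
    and conv_finite_XF_right: "conv_finite G (XF i)"
proof -
  have fin: "finite {K \<in> RC. ev G (Eta (\<kappa>, e, l') ** adj (rep K)) \<noteq> 0 \<and> ev (XF i) (rep K) \<noteq> 0}" for \<kappa> e l'
    by (rule finite_subset [OF _ finite_right_XF [of i]]) auto
  note * = G XF_level_0 [of i, THEN conjunct1] fin
  show "conv (ev G) (ev (XF i)) = ev (restrict_level l (RXpow i G))"
  proof (rule conv_ev_eqI)
    fix \<gamma> :: "kind \<times> int \<times> int"
    obtain \<kappa> e l' where \<gamma>: "\<gamma> = (\<kappa>, e, l')" by (metis surj_pair)
    show "conv (ev G) (ev (XF i)) (Eta \<gamma>) = restrict_level l (RXpow i G) \<gamma>"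
      unfolding \<gamma> conv_eq_full_conv [OF *] by (simp add: full_conv_XF_right restrict_level_def)
  qed
  show "conv_finite G (XF i)"
  proof (rule conv_finiteI)
    fix \<gamma> :: "kind \<times> int \<times> int"
    obtain \<kappa> e l' where \<gamma>: "\<gamma> = (\<kappa>, e, l')" by (metis surj_pair)
    show "finite {p. G (fst p) * XF i (snd p) * conv_chi (fst p) (snd p) (Eta \<gamma>) \<noteq> 0}"
      unfolding \<gamma> by (rule conv_pairs_finite [OF *])
  qed
qed

section \<open>Convolution within the positive and within the negative levels\<close>

text \<open>A right coset in the second double coset contributes 1 if its complementary factor lies in the
  first one, and 0 otherwise.\<close>

lemma full_conv_count:
  assumes "\<And>M. M \<in> Cell \<beta> \<Longrightarrow> \<exists>y\<in>Y. rcos M = rcos (z y)" "\<And>y. y \<in> Y \<Longrightarrow> z y \<in> Cell \<beta>"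
    and A: "(\<lambda>y. rcos (z y)) ` {y \<in> Y. x ** adj (z y) \<in> Cell \<alpha>} = A" "finite A"
  shows "full_conv (ev (unit_coeff \<alpha>)) (ev (unit_coeff \<beta>)) x = of_nat (card A)"
proof -
  have AI: "K \<in> A" if K: "K \<in> RC" "x ** adj (rep K) \<in> Cell \<alpha>" "rep K \<in> Cell \<beta>" for K
  proof -
    obtain y where y: "y \<in> Y" "rcos (rep K) = rcos (z y)" using assms(1) K by blast
    then have "ev (unit_coeff \<alpha>) (x ** adj (z y)) = ev (unit_coeff \<alpha>) (x ** adj (rep K))"
      by (metis ev_adj_rep)
    then have "x ** adj (z y) \<in> Cell \<alpha>"
      using K by (simp add: ev_unit_coeff indicator_def split: if_splits)
    then show ?thesis
      using y K rcos_rep A(1) by auto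
  qed
  have RC: "A \<subseteq> RC" using A(1) assms(2) det_Cell unfolding RC_def by blast
  have one: "ev (unit_coeff \<alpha>) (x ** adj (rep K)) * ev (unit_coeff \<beta>) (rep K) = 1" if "K \<in> A" for K
  proof -
    obtain y where y: "K = rcos (z y)" "y \<in> Y" "x ** adj (z y) \<in> Cell \<alpha>"
      using \<open>K \<in> A\<close> A(1) by blast
    show ?thesis
      using ev_Cell [OF y(3)] ev_Cell [OF assms(2) [OF y(2)]] by (simp add: y(1) unit_coeff_def)
  qed
  have "full_conv (ev (unit_coeff \<alpha>)) (ev (unit_coeff \<beta>)) x =
      (\<Sum>K\<in>A. ev (unit_coeff \<alpha>) (x ** adj (rep K)) * ev (unit_coeff \<beta>) (rep K))"
    by (rule full_conv_finite [OF A(2) RC]) (use AI in \<open>auto simp: ev_unit_coeff indicator_def\<close>)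
  then show ?thesis using one by simp
qed

text \<open>The right cosets in the second double coset are those of \<open>diag(b, b\<^sup>-\<^sup>1) (1 0; y 1)\<close>, where \<open>y\<close> is
  determined modulo \<open>b\<^sup>2 t1 O\<close>. Only the class of \<open>y = 0\<close> contributes: the lower right entry of the
  product has to lead, and comparing it with the lower left one shows that \<open>y\<close> is in \<open>b\<^sup>2 t1 O\<close>.\<close>

lemma full_conv_positive:
  assumes mn: "m > 0" "n > 0"
  shows "full_conv (ev (unit_coeff (Diag, i, m))) (ev (unit_coeff (Diag, k, n))) (Eta (\<kappa>, e, m + n)) =
    of_bool (\<kappa> = Diag \<and> e = i + k)"
proof -
  define b where "b = mon k n"
  define A where "A = mon e (m + n)"
  have b: "b \<noteq> 0" "v b = (k, n)" and A: "A \<noteq> 0" "v A = (e, m + n)"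
    by (simp_all add: b_def A_def)
  define z where "z y = mat2 b 0 (y / b) (1 / b)" for y
  have 1: "\<exists>y\<in>\<P>. rcos M = rcos (z y)" if M: "M \<in> Cell (Diag, k, n)" for M
  proof -
    obtain a b' c d where M': "M = mat2 a b' c d" by (rule mat2_cases)
    have h: "a * d - b' * c = 1" "d \<noteq> 0" "v d = (- k, - n)" "b' / d \<in> \<O>" "c / d \<in> \<P>"
      using M mn unfolding Cell_iff_lead M' by (auto simp: lead_simps lex_pos_def)
    have "M ** adj (z (c / d)) = mat2 (1 / (d * b)) (b' / d * (d * b)) 0 (d * b)"
      using h b by (simp add: M' z_def) (simp add: field_simps)
    moreover have db: "d * b \<in> \<O>" "1 / (d * b) \<in> \<O>"
      using h b by (auto simp: int_ring_iff v_divide v_mult lex_nonneg_def)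
    moreover have "b' / d * (d * b) \<in> \<O>" using h db by (blast intro: int_ring_mult)
    ultimately have "M ** adj (z (c / d)) \<in> iwahori"
      using h b by (simp only: iwahori_mat2) simp
    then have "rcos M = rcos (z (c / d))"
      using b h by (intro rcos_eqI) (simp_all add: M' z_def)
    then show ?thesis using h by blast
  qed
  have 2: "z y \<in> Cell (Diag, k, n)" if "y \<in> \<P>" for y
    using Cell_Diag_d [of b "1 / b" 0 "y / b"] that b by (simp add: z_def v_divide)
  have 3: "Eta (\<kappa>, e, m + n) ** adj (z y) \<in> Cell (Diag, i, m) \<longleftrightarrow>
      \<kappa> = Diag \<and> e = i + k \<and> y / (b * b) \<in> \<P>" for y
  proof (cases \<kappa>)
    case Diag
    have "Eta (\<kappa>, e, m + n) ** adj (z y) = mat2 (A / b) 0 (- y / (A * b)) (b / A)"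
      by (simp add: Diag Eta_def eta_mon z_def A_def divide_inverse)
    moreover have "- y / (A * b) / (b / A) = - (y / (b * b))"
      using A b by (simp add: field_simps)
    ultimately show ?thesis
      using A b mn by (auto simp: Diag Cell_iff_lead lead_simps lex_pos_def v_divide)
  next
    case Anti
    have "Eta (\<kappa>, e, m + n) ** adj (z y) = mat2 (- y * A / b) (A * b) (- 1 / (A * b)) 0"
      by (simp add: Anti Eta_def eta_mon z_def A_def divide_inverse)
    then show ?thesis
      using mn by (auto simp: Anti Cell_iff_lead lead_simps lex_pos_def)
  qed
  define Z where "Z = (if \<kappa> = Diag \<and> e = i + k then {rcos (z 0)} else {})"
  have 4: "rcos (z y) = rcos (z 0)" if "y / (b * b) \<in> \<P>" for y
    using that b by (intro rcos_eqI) (simp_all add: z_def)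
  have "(\<lambda>y. rcos (z y)) ` {y \<in> \<P>. Eta (\<kappa>, e, m + n) ** adj (z y) \<in> Cell (Diag, i, m)} = Z"
  proof (cases "\<kappa> = Diag \<and> e = i + k")
    case True
    then have "{y \<in> \<P>. Eta (\<kappa>, e, m + n) ** adj (z y) \<in> Cell (Diag, i, m)} =
        {y \<in> \<P>. y / (b * b) \<in> \<P>}"
      unfolding 3 by simp
    moreover have "(\<lambda>y. rcos (z y)) ` {y \<in> \<P>. y / (b * b) \<in> \<P>} =
        (\<lambda>y. rcos (z 0)) ` {y \<in> \<P>. y / (b * b) \<in> \<P>}"
      by (intro image_cong refl 4) simp
    moreover have "\<dots> = {rcos (z 0)}"
      by (rule image_constant [of 0]) simp
    ultimately show ?thesis
      using True by (simp only: Z_def if_True simp_thms)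
  qed (auto simp: 3 Z_def)
  from full_conv_count [OF 1 2 this] show ?thesis
    by (auto simp: Z_def)
qed

text \<open>Representatives of \<open>O / t1\<^sup>r O\<close>, by their \<open>t1\<close>-adic digits.\<close>

fun digit_reps :: "nat \<Rightarrow> 'f set" where
  "digit_reps 0 = {0}"
| "digit_reps (Suc r) = (\<lambda>(u, y). u + t1 * y) ` (residue_reps \<times> digit_reps r)"

lemma finite_digit_reps [simp]: "finite (digit_reps r)"
  by (induction r) simp_all

lemma digit_reps_subset: "y \<in> digit_reps r \<Longrightarrow> y \<in> \<O>"
proof (induction r arbitrary: y)
  case (Suc r)
  then obtain u w where "u \<in> residue_reps" "w \<in> digit_reps r" "y = u + t1 * w" by auto
  then show ?case
    using Suc.IH residue_reps_subset t1_ideal_subset [of "t1 * w"] by (auto intro: int_ring_add)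
qed simp

lemma digits_inject:
  assumes "u \<in> residue_reps" "u' \<in> residue_reps" "y \<in> \<O>" "y' \<in> \<O>" "b - (u + t1 * y) \<in> \<P>"
    "b - (u' + t1 * y') \<in> \<P>"
  shows "u = u'"
proof -
  have "b - u \<in> \<P>" "b - u' \<in> \<P>"
    using assms t1_ideal_add [of "b - (u + t1 * y)" "t1 * y"]
      t1_ideal_add [of "b - (u' + t1 * y')" "t1 * y'"] by simp_all
  moreover have "b \<in> \<O>"
    using int_ring_add [of "b - u" u] \<open>b - u \<in> \<P>\<close> assms(1) t1_ideal_subset residue_reps_subset
    by fastforce
  ultimately show ?thesis using residue_reps_ex1 assms by blast
qed

lemma card_digit_image:
  assumes "V \<subseteq> residue_reps"
  shows "card ((\<lambda>(u, y). u + t1 * y) ` (V \<times> digit_reps r)) = card V * card (digit_reps r)"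
proof -
  have "inj_on (\<lambda>(u, y). u + t1 * y) (V \<times> digit_reps r)"
  proof (rule inj_onI, clarify)
    fix u y u' y'
    assume *: "u \<in> V" "u' \<in> V" "y \<in> digit_reps r" "y' \<in> digit_reps r" "u + t1 * y = u' + t1 * y'"
    then have "u = u'"
      using digits_inject [of u u' y y' "u + t1 * y"] assms digit_reps_subset by auto
    then show "u = u' \<and> y = y'" using * t1 by simp
  qed
  then show ?thesis by (simp add: card_image card_cartesian_product)
qed

lemma card_digit_reps: "card (digit_reps r) = q ^ r"
  by (induction r) (simp_all add: card_digit_image card_residue_reps)

lemma digit_reps_ex1:
  "b \<in> \<O> \<Longrightarrow> \<exists>!y. y \<in> digit_reps r \<and> (b - y) / t1 ^ r \<in> \<O>"
proof (induction r arbitrary: b)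
  case (Suc r)
  obtain u where u: "u \<in> residue_reps" "b - u \<in> \<P>" using residue_reps_ex1 Suc.prems by blast
  then have "(b - u) / t1 \<in> \<O>" by simp
  from Suc.IH [OF this] obtain w where w: "w \<in> digit_reps r" "((b - u) / t1 - w) / t1 ^ r \<in> \<O>"
    and w': "\<And>y. y \<in> digit_reps r \<Longrightarrow> ((b - u) / t1 - y) / t1 ^ r \<in> \<O> \<Longrightarrow> y = w"
    by blast
  have eq: "(b - (u' + t1 * y)) / t1 ^ Suc r = ((b - u') / t1 - y) / t1 ^ r" for u' y
    using t1 by (simp add: field_simps)
  show ?case
  proof (rule ex1I [of _ "u + t1 * w"])
    show "u + t1 * w \<in> digit_reps (Suc r) \<and> (b - (u + t1 * w)) / t1 ^ Suc r \<in> \<O>"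
      unfolding eq using u w by auto
    fix y assume y: "y \<in> digit_reps (Suc r) \<and> (b - y) / t1 ^ Suc r \<in> \<O>"
    then obtain u' y' where y': "u' \<in> residue_reps" "y' \<in> digit_reps r" "y = u' + t1 * y'" by auto
    have "t1 ^ Suc r \<in> \<P>"
      using t1 by (simp add: t1_ideal_iff v_mult v_power lex_pos_def)
    from t1_ideal_mult [OF this, of "(b - y) / t1 ^ Suc r"]
    have "b - y \<in> \<P>" using y t1 by simp
    moreover have "b - (u + t1 * 0) \<in> \<P>" using u by simp
    ultimately have "u' = u"
      using digits_inject [of u' u y' 0 b] y' u digit_reps_subset by auto
    then show "y = u + t1 * w"
      using w' [of y'] y y' eq [of u' y'] by simp
  qed
qed auto

declare digit_reps.simps [simp del]

definition unit_digit_reps :: "nat \<Rightarrow> 'f set" where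
  "unit_digit_reps r = {y \<in> digit_reps r. y \<notin> \<P>}"

lemma card_unit_digit_reps: "card (unit_digit_reps (Suc r)) = (q - 1) * q ^ r"
proof -
  have "u + t1 * y \<in> \<P> \<longleftrightarrow> u = 0" if "u \<in> residue_reps" "y \<in> digit_reps r" for u y
    using that digit_reps_subset residue_reps_unit [of u] t1_ideal_diff [of "u + t1 * y" "t1 * y"]
    by auto
  then have "unit_digit_reps (Suc r) = (\<lambda>(u, y). u + t1 * y) ` ((residue_reps - {0}) \<times> digit_reps r)"
    unfolding unit_digit_reps_def digit_reps.simps by auto
  then show ?thesis
    by (simp add: card_digit_image card_Diff_singleton card_residue_reps card_digit_reps)
qed

text \<open>The right cosets in the second double coset are those of \<open>w (1 y; 0 1)\<close> or \<open>w (1 0; y 1)\<close> according to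
  its kind, where \<open>y\<close> is determined modulo \<open>b\<^sup>-\<^sup>2 O\<close> and \<open>b\<close> is the leading entry of \<open>w\<close>. If the first
  factor has kind \<open>Diag\<close>, only the class of \<open>y = 0\<close> contributes. If it has kind \<open>Anti\<close>, the entry
  containing \<open>y\<close> has to lead, which prescribes the valuation of \<open>y\<close>, and the power of \<open>q\<close> counts the
  classes modulo \<open>b\<^sup>-\<^sup>2 O\<close> of that valuation.\<close>

lemma full_conv_negative:
  assumes mn: "m < 0" "n < 0"
  shows "full_conv (ev (unit_coeff (\<mu>, i, m))) (ev (unit_coeff (\<nu>, k, n))) (Eta (\<kappa>, e, m + n)) =
    (if \<kappa> = \<nu> then case \<mu> of
        Diag \<Rightarrow> of_bool (e = i + k)
      | Anti \<Rightarrow> (if i + k < e then (of_nat q - 1) * of_nat q ^ (nat (e - i - k) - 1) else 0)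
     else 0)"
proof -
  define b where "b = mon k n"
  define A where "A = mon e (m + n)"
  have b: "b \<noteq> 0" "v b = (k, n)" and A: "A \<noteq> 0" "v A = (e, m + n)"
    by (simp_all add: b_def A_def)
  define z where "z y = (case \<nu> of Diag \<Rightarrow> mat2 b (b * y) 0 (1 / b) | Anti \<Rightarrow> mat2 (b * y) b (- 1 / b) 0)" for y
  define Y where "Y = (case \<nu> of Diag \<Rightarrow> \<O> | Anti \<Rightarrow> \<P>)"
  have 1: "\<exists>y\<in>Y. rcos M = rcos (z y)" if M: "M \<in> Cell (\<nu>, k, n)" for M
  proof -
    obtain a b' c d where M': "M = mat2 a b' c d" by (rule mat2_cases)
    show ?thesis
    proof (cases \<nu>)
      case Diag
      have h: "a * d - b' * c = 1" "a \<noteq> 0" "v a = (k, n)" "b' / a \<in> \<O>" "c / a \<in> \<P>"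
        using M mn unfolding Cell_iff_lead M' Diag by (auto simp: lead_simps lex_pos_def)
      have "M ** adj (z (b' / a)) = mat2 (a / b) 0 (c / a * (a / b)) (b / a)"
      proof -
        have d: "d = (1 + b' * c) / a" using h by (simp add: field_simps)
        show ?thesis using h(2) b by (simp add: M' z_def Diag d) (simp add: field_simps)
      qed
      moreover have ab: "a / b \<in> \<O>" "b / a \<in> \<O>"
        using h b by (auto intro: quotient_of_same_valuation)
      moreover have "c / a * (a / b) \<in> \<P>" using h ab by (blast intro: t1_ideal_mult)
      ultimately have "M ** adj (z (b' / a)) \<in> iwahori"
        using h b by (simp only: iwahori_mat2) simp
      then have "rcos M = rcos (z (b' / a))"
        using b h by (intro rcos_eqI) (simp_all add: M' z_def Diag)
      then show ?thesis using h by (auto simp: Y_def Diag)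
    next
      case Anti
      have h: "a * d - b' * c = 1" "b' \<noteq> 0" "v b' = (k, n)" "a / b' \<in> \<P>" "d / b' \<in> \<P>"
        using M mn unfolding Cell_iff_lead M' Anti by (auto simp: lead_simps lex_nonneg_def)
      have "M ** adj (z (a / b')) = mat2 (b' / b) 0 (d / b' * (b' / b)) (b / b')"
      proof -
        have c: "c = (a * d - 1) / b'" using h by (simp add: field_simps)
        show ?thesis using h(2) b by (simp add: M' z_def Anti c) (simp add: field_simps)
      qed
      moreover have ab: "b' / b \<in> \<O>" "b / b' \<in> \<O>"
        using h b by (auto intro: quotient_of_same_valuation)
      moreover have "d / b' * (b' / b) \<in> \<P>" using h ab by (blast intro: t1_ideal_mult)
      ultimately have "M ** adj (z (a / b')) \<in> iwahori"
        using h b by (simp only: iwahori_mat2) simp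
      then have "rcos M = rcos (z (a / b'))"
        using b h by (intro rcos_eqI) (simp_all add: M' z_def Anti)
      then show ?thesis using h by (auto simp: Y_def Anti)
    qed
  qed
  have 2: "z y \<in> Cell (\<nu>, k, n)" if "y \<in> Y" for y
    using Cell_Diag_a [of b "1 / b" "b * y" 0] Cell_Anti_b [of "b * y" 0 b "- 1 / b"] that b
    by (cases \<nu>) (simp_all add: z_def Y_def)
  define cond where "cond y \<longleftrightarrow> \<kappa> = \<nu> \<and> (case \<mu> of Diag \<Rightarrow> e = i + k \<and> b * b * y \<in> \<O>
      | Anti \<Rightarrow> i + k < e \<and> y \<noteq> 0 \<and> v y = (i - e - k, - 2 * n))" for y
  have upper: "mat2 (A / b) (s * (A * b * y)) 0 (b / A) \<in> Cell (\<mu>, i, m) \<longleftrightarrow> cond y"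
    if "\<kappa> = \<nu>" and s: "s = 1 \<or> s = - 1" for s y
  proof (cases \<mu>)
    case Diag
    have "s * (A * b * y) / (A / b) \<in> \<O> \<longleftrightarrow> b * b * y \<in> \<O>"
    proof -
      have "s * (A * b * y) / (A / b) = s * (b * b * y)" using A b by (simp add: field_simps)
      then show ?thesis using s int_ring_minus [of "b * b * y"] by auto
    qed
    then show ?thesis
      using A b mn that by (auto simp: cond_def Diag Cell_iff_lead lead_simps lex_pos_def v_divide
          simp del: divide_divide_eq_right)
  next
    case Anti
    show ?thesis
    proof (cases "y = 0")
      case False
      have s': "s \<noteq> 0" "v s = 0" using s by auto
      obtain y1 y2 where y: "v y = (y1, y2)" by (cases "v y")
      have v: "v (s * (A * b * y)) = (e + k + y1, m + 2 * n + y2)"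
        "v (A / b / (s * (A * b * y))) = (- 2 * k - y1, - 2 * n - y2)"
        "v (b / A / (s * (A * b * y))) = (- 2 * e - y1, - 2 * (m + n) - y2)"
        using False A b s' y by (simp_all add: v_mult v_divide)
      show ?thesis
        unfolding Cell_iff_lead Anti lead_simps t1_ideal_iff v cond_def y kind.case
        using False A b mn that(1) s' by (auto simp: lex_nonneg_def lex_pos_def)
    qed (use mn in \<open>auto simp: cond_def Anti Cell_iff_lead lead_simps lex_nonneg_def\<close>)
  qed
  have cross: "mat2 0 (s * (A * b)) (- s / (A * b)) w \<notin> Cell (\<mu>, i, m)" if s: "s = 1 \<or> s = - 1" for s w
  proof -
    have s': "s \<noteq> 0" "v s = 0" using s by auto
    then have "v (s * (A * b)) = (e + k, m + 2 * n)" using A b by (simp add: v_mult)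
    then show ?thesis
      using mn by (cases \<mu>) (auto simp: Cell_iff_lead lead_simps lex_nonneg_def lex_pos_def)
  qed
  have 3: "Eta (\<kappa>, e, m + n) ** adj (z y) \<in> Cell (\<mu>, i, m) \<longleftrightarrow> cond y" for y
  proof -
    have DD: "Eta (Diag, e, m + n) ** adj (mat2 b (b * y) 0 (1 / b)) = mat2 (A / b) (- 1 * (A * b * y)) 0 (b / A)"
      and DA: "Eta (Diag, e, m + n) ** adj (mat2 (b * y) b (- 1 / b) 0) = mat2 0 (- 1 * (A * b)) (- (- 1) / (A * b)) (b * y / A)"
      and AD: "Eta (Anti, e, m + n) ** adj (mat2 b (b * y) 0 (1 / b)) = mat2 0 (1 * (A * b)) (- 1 / (A * b)) (b * y / A)"
      and AA: "Eta (Anti, e, m + n) ** adj (mat2 (b * y) b (- 1 / b) 0) = mat2 (A / b) (1 * (A * b * y)) 0 (b / A)"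
      using A b by (simp_all add: Eta_def eta_mon flip: A_def) (simp_all add: field_simps)
    show ?thesis
      using upper [of "- 1" y] upper [of 1 y] cross [of "- 1" "b * y / A"] cross [of 1 "b * y / A"]
      by (cases \<kappa>; cases \<nu>) (simp_all only: z_def kind.case DD DA AD AA, simp_all add: cond_def)
  qed
  have 4: "rcos (z y) = rcos (z y') \<longleftrightarrow> b * b * (y - y') \<in> \<O>" for y y'
  proof -
    have "z y ** adj (z y') \<in> iwahori \<longleftrightarrow> b * b * (y - y') \<in> \<O>"
      using b int_ring_minus [of "b * b * (y - y')"]
      by (cases \<nu>) (simp_all add: z_def algebra_simps)
    moreover have "det (z y) = 1" "det (z y') = 1"
      using b by (cases \<nu>; simp add: z_def)+
    ultimately show ?thesis using rcos_eqI rcos_eqD by blast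
  qed
  have 0: "0 \<in> Y" by (cases \<nu>) (simp_all add: Y_def)
  show ?thesis
  proof (cases "\<kappa> = \<nu>")
    case False
    then have "(\<lambda>y. rcos (z y)) ` {y \<in> Y. Eta (\<kappa>, e, m + n) ** adj (z y) \<in> Cell (\<mu>, i, m)} = {}"
      unfolding 3 by (simp add: cond_def)
    from full_conv_count [OF 1 2 this] show ?thesis using False by simp
  next
    case True
    show ?thesis
    proof (cases \<mu>)
      case Diag
      define Z where "Z = (if e = i + k then {rcos (z 0)} else {})"
      have "(\<lambda>y. rcos (z y)) ` {y \<in> Y. Eta (\<kappa>, e, m + n) ** adj (z y) \<in> Cell (\<mu>, i, m)} = Z"
      proof (cases "e = i + k")
        case e: True
        have "{y \<in> Y. Eta (\<kappa>, e, m + n) ** adj (z y) \<in> Cell (\<mu>, i, m)} = {y \<in> Y. b * b * y \<in> \<O>}"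
          unfolding 3 using True Diag e by (simp add: cond_def)
        moreover have "(\<lambda>y. rcos (z y)) ` {y \<in> Y. b * b * y \<in> \<O>} =
            (\<lambda>y. rcos (z 0)) ` {y \<in> Y. b * b * y \<in> \<O>}"
          using 4 [of _ 0] by (intro image_cong refl) simp
        moreover have "\<dots> = {rcos (z 0)}"
          by (rule image_constant [of 0]) (use 0 in simp)
        ultimately show ?thesis
          using e by (simp only: Z_def if_True simp_thms)
      next
        case False
        then show ?thesis unfolding 3 by (simp add: cond_def Diag Z_def)
      qed
      from full_conv_count [OF 1 2 this] show ?thesis using True Diag by (simp add: Z_def)
    next
      case Anti
      show ?thesis
      proof (cases "i + k < e")
        case lt: False
        then have "(\<lambda>y. rcos (z y)) ` {y \<in> Y. Eta (\<kappa>, e, m + n) ** adj (z y) \<in> Cell (\<mu>, i, m)} = {}"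
          unfolding 3 by (simp add: cond_def Anti)
        from full_conv_count [OF 1 2 this] show ?thesis using True Anti lt by simp
      next
        case lt: True
        define r where "r = nat (e - i - k) - 1"
        have r: "e = i + k + 1 + int r" using lt by (simp add: r_def)
        \<comment> \<open>\<open>p\<close> has the valuation required of \<open>y\<close>. As \<open>b\<^sup>2 p\<close> is exactly \<open>t1\<^bsup>-(r+1)\<^esup>\<close>, the classes become
          those of units modulo \<open>t1\<^bsup>r+1\<^esup>\<close>.\<close>
        define p where "p = mon (i - e - k) (- 2 * n)"
        have p: "p \<noteq> 0" "v p = (i - e - k, - 2 * n)" by (simp_all add: p_def)
        have bp: "b * b * p = 1 / t1 ^ Suc r"
        proof -
          have 1: "t1 powi (k + k + (i - e - k)) = t1 powi k * t1 powi k * t1 powi (i - e - k)"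
            "t2 powi (n + n + - 2 * n) = t2 powi n * t2 powi n * t2 powi (- 2 * n)"
            by (simp_all only: power_int_add [OF disjI1 [OF t1(1)]] power_int_add [OF disjI1 [OF t2(1)]])
          have "b * b * p = t1 powi (k + k + (i - e - k)) * t2 powi (n + n + - 2 * n)"
            unfolding b_def p_def mon_def 1 by (simp only: ac_simps)
          also have "k + k + (i - e - k) = - int (Suc r)" using r by simp
          also have "n + n + - 2 * n = 0" by simp
          finally show ?thesis
            by (simp only: power_int_minus power_int_of_nat power_int_0_right mult_1_right
                divide_inverse mult_1_left)
        qed
        let ?f = "\<lambda>w. rcos (z (p * w))"
        have eq: "?f w = ?f w' \<longleftrightarrow> (w - w') / t1 ^ Suc r \<in> \<O>" for w w'
        proof -
          have "b * b * (p * w - p * w') = b * b * p * (w - w')" by (simp add: algebra_simps)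
          then show ?thesis by (simp add: 4 bp)
        qed
        have "(\<lambda>y. rcos (z y)) ` {y \<in> Y. Eta (\<kappa>, e, m + n) ** adj (z y) \<in> Cell (\<mu>, i, m)} =
            ?f ` unit_digit_reps (Suc r)"
        proof (intro equalityI subsetI)
          fix K assume "K \<in> (\<lambda>y. rcos (z y)) ` {y \<in> Y. Eta (\<kappa>, e, m + n) ** adj (z y) \<in> Cell (\<mu>, i, m)}"
          then obtain y where y: "K = rcos (z y)" "y \<noteq> 0" "v y = (i - e - k, - 2 * n)"
            unfolding 3 using True by (auto simp: cond_def Anti)
          define w where "w = y / p"
          have w: "w \<in> \<O>" "w \<notin> \<P>"
            using y p unit_iff [of w] by (auto simp: w_def v_divide)
          obtain w' where w': "w' \<in> digit_reps (Suc r)" "(w - w') / t1 ^ Suc r \<in> \<O>"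
            using digit_reps_ex1 [OF w(1)] by blast
          have "t1 ^ Suc r \<in> \<P>"
            using t1 by (simp add: t1_ideal_iff v_mult v_power lex_pos_def)
          from t1_ideal_mult [OF this w'(2)] have "w - w' \<in> \<P>" using t1 by simp
          then have "w' \<notin> \<P>" using w t1_ideal_add [of "w - w'" w'] by auto
          then have "w' \<in> unit_digit_reps (Suc r)" using w' by (simp add: unit_digit_reps_def)
          moreover have "K = ?f w'"
            using eq [of w w'] w' y p by (simp add: w_def)
          ultimately show "K \<in> ?f ` unit_digit_reps (Suc r)" by blast
        next
          fix K assume "K \<in> ?f ` unit_digit_reps (Suc r)"
          then obtain w where w: "K = ?f w" "w \<in> \<O>" "w \<notin> \<P>"
            using digit_reps_subset unfolding unit_digit_reps_def by blast
          then have "w \<noteq> 0" "v w = 0" using unit_iff by blast+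
          then have y: "p * w \<noteq> 0" "v (p * w) = (i - e - k, - 2 * n)"
            using p by (simp_all add: v_mult)
          moreover have "p * w \<in> Y"
            using y mn by (cases \<nu>) (auto simp: Y_def int_ring_iff t1_ideal_iff lex_pos_def lex_nonneg_def)
          ultimately show "K \<in> (\<lambda>y. rcos (z y)) ` {y \<in> Y. Eta (\<kappa>, e, m + n) ** adj (z y) \<in> Cell (\<mu>, i, m)}"
            unfolding 3 w(1) using True lt by (auto simp: cond_def Anti)
        qed
        from full_conv_count [OF 1 2 this]
        have "full_conv (ev (unit_coeff (\<mu>, i, m))) (ev (unit_coeff (\<nu>, k, n))) (Eta (\<kappa>, e, m + n)) =
            of_nat (card (?f ` unit_digit_reps (Suc r)))"
          by (simp add: unit_digit_reps_def)
        also have "inj_on ?f (unit_digit_reps (Suc r))"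
        proof (rule inj_onI)
          fix w w' assume ww: "w \<in> unit_digit_reps (Suc r)" "w' \<in> unit_digit_reps (Suc r)" "?f w = ?f w'"
          then have "(w - w') / t1 ^ Suc r \<in> \<O>" "(w - w) / t1 ^ Suc r \<in> \<O>" "w \<in> \<O>"
            using eq digit_reps_subset by (auto simp: unit_digit_reps_def)
          then show "w = w'"
            using digit_reps_ex1 [of w "Suc r"] ww unfolding unit_digit_reps_def by blast
        qed
        then have "card (?f ` unit_digit_reps (Suc r)) = (q - 1) * q ^ r"
          by (simp add: card_image card_unit_digit_reps)
        finally show ?thesis
          using True Anti lt by (simp add: r_def of_nat_diff Suc_leI)
      qed
    qed
  qed
qed

end

unbundle fps_syntax

section \<open>The monomials\<close>

text \<open>Summing over a large finite set that does not depend on the subdegrees allows one index set to be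
  used for several products.\<close>

lemma fls_times_nth_box:
  fixes f g :: "'a::comm_ring_1 fls"
  assumes f: "\<And>i. i < a \<Longrightarrow> f $$ i = 0" and g: "\<And>i. i < b \<Longrightarrow> g $$ i = 0"
    and A: "finite A" "{a..e - b} \<subseteq> A"
  shows "(f * g) $$ e = (\<Sum>i\<in>A. f $$ i * g $$ (e - i))"
proof -
  have out: "f $$ i * g $$ (e - i) = 0" if "i < a \<or> e - b < i" for i
    using that f [of i] g [of "e - i"] by auto
  have "(\<Sum>i=fls_subdegree f..e - fls_subdegree g. f $$ i * g $$ (e - i)) =
      (\<Sum>i\<in>A. f $$ i * g $$ (e - i))"
  proof (rule sum.mono_neutral_cong)
    fix i assume "i \<in> A - {fls_subdegree f..e - fls_subdegree g}"
    then have "i < fls_subdegree f \<or> e - i < fls_subdegree g" by auto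
    then show "f $$ i * g $$ (e - i) = 0" by auto
  next
    fix i assume "i \<in> {fls_subdegree f..e - fls_subdegree g} - A"
    then have "i \<notin> {a..e - b}" using A(2) by blast
    then have "i < a \<or> e - b < i" by auto
    then show "f $$ i * g $$ (e - i) = 0" by (rule out)
  qed (use A in auto)
  then show ?thesis by (simp add: fls_times_nth(2))
qed

context sl2_two_dim_local_field
begin

lemma
  shows conv_multiple_unit: "conv (ev (\<lambda>\<gamma>. c * unit_coeff \<alpha> \<gamma>)) (ev (\<lambda>\<gamma>. d * unit_coeff \<beta> \<gamma>)) x =
      c * d * conv_chi \<alpha> \<beta> x"
    and conv_finite_multiple_unit:
      "conv_finite (\<lambda>\<gamma>. c * unit_coeff \<alpha> \<gamma>) (\<lambda>\<gamma>. d * unit_coeff \<beta> \<gamma>)"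
proof -
  let ?t = "\<lambda>p x. c * unit_coeff \<alpha> (fst p) * (d * unit_coeff \<beta> (snd p)) * conv_chi (fst p) (snd p) x"
  have t: "?t p x = (if p = (\<alpha>, \<beta>) then c * d * conv_chi \<alpha> \<beta> x else 0)" for p x
    by (cases p) (auto simp: unit_coeff_def)
  have "conv (ev (\<lambda>\<gamma>. c * unit_coeff \<alpha> \<gamma>)) (ev (\<lambda>\<gamma>. d * unit_coeff \<beta> \<gamma>)) x = (\<Sum>\<^sub>\<infinity>p\<in>UNIV. ?t p x)"
    by (simp only: conv_ev)
  also have "\<dots> = (\<Sum>\<^sub>\<infinity>p\<in>{(\<alpha>, \<beta>)}. c * d * conv_chi \<alpha> \<beta> x)"
    unfolding t by (rule infsum_cong_neutral) auto
  finally show "conv (ev (\<lambda>\<gamma>. c * unit_coeff \<alpha> \<gamma>)) (ev (\<lambda>\<gamma>. d * unit_coeff \<beta> \<gamma>)) x =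
      c * d * conv_chi \<alpha> \<beta> x"
    by simp
  show "conv_finite (\<lambda>\<gamma>. c * unit_coeff \<alpha> \<gamma>) (\<lambda>\<gamma>. d * unit_coeff \<beta> \<gamma>)"
    unfolding conv_finite_def t
    by (rule allI, rule finite_subset [of _ "{(\<alpha>, \<beta>)}"]) (auto split: if_splits)
qed

definition qpow :: "int \<Rightarrow> complex" where
  "qpow i = of_nat q powi i"

lemma qpow_nonzero [simp]: "qpow i \<noteq> 0"
  by (simp add: qpow_def)

lemma qpow_add: "qpow (i + j) = qpow i * qpow j"
  by (simp add: qpow_def power_int_add)

lemma qpow_0 [simp]: "qpow 0 = 1" and qpow_1: "qpow 1 = of_nat q"
  and qpow_m1: "qpow (- 1) = inverse (of_nat q)"
  by (simp_all add: qpow_def power_int_minus)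

subsection \<open>Positive levels\<close>

text \<open>The coefficients of \<open>X\<^sup>i Y\<^sup>m\<close> for positive \<open>m\<close>.\<close>

definition YF :: "int \<Rightarrow> nat \<Rightarrow> coeffs" where
  "YF i m = (\<lambda>\<gamma>. qpow (1 - i - int m) * unit_coeff (Diag, i, int m) \<gamma>)"

lemma YF_level: "level_supported (int m) (YF i m)"
  by (auto simp: level_supported_def YF_def unit_coeff_def)

lemma LX_YF: "m > 0 \<Longrightarrow> LX (YF i m) = YF (i + 1) m"
  unfolding YF_def using qpow_add [of "- 1" "1 - i - int m"]
  by (subst LX_unit_coeff) (simp_all add: lex_nonneg_def qpow_m1 algebra_simps)

lemma swap_coeffs_YF: "swap_coeffs (YF i m) = YF i m"
  by (simp add: YF_def swap_coeffs_def)

lemma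
  assumes "m > 0"
  shows conv_XF_YF: "conv (ev (XF i)) (ev (YF k m)) = ev (YF (i + k) m)"
    and conv_YF_XF: "conv (ev (YF k m)) (ev (XF i)) = ev (YF (i + k) m)"
proof -
  have "LXpow i (YF k m) = YF (i + k) m"
    by (rule LXpow_cong_shift) (rule LX_YF [OF assms])
  then show "conv (ev (XF i)) (ev (YF k m)) = ev (YF (i + k) m)"
    "conv (ev (YF k m)) (ev (XF i)) = ev (YF (i + k) m)"
    by (simp_all add: conv_XF_left [OF YF_level] conv_XF_right [OF YF_level] RXpow_def swap_coeffs_YF
        restrict_level_supported [OF YF_level])
qed

lemma
  assumes "m > 0" "n > 0"
  shows conv_YF_YF: "conv (ev (YF i m)) (ev (YF k n)) = ev (YF (i + k) (m + n))"
    and conv_finite_YF_YF: "conv_finite (YF i m) (YF k n)"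
proof -
  show "conv (ev (YF i m)) (ev (YF k n)) = ev (YF (i + k) (m + n))"
  proof (rule conv_ev_eqI)
    fix \<gamma> :: "kind \<times> int \<times> int"
    obtain \<kappa> e l where \<gamma>: "\<gamma> = (\<kappa>, e, l)" by (metis surj_pair)
    have "qpow (1 - i - int m) * qpow (1 - k - int n) * inverse (of_nat q) =
        qpow ((1 - i - int m) + (1 - k - int n) + - 1)"
      by (simp only: qpow_add qpow_m1)
    also have "(1 - i - int m) + (1 - k - int n) + - 1 = 1 - (i + k) - int (m + n)"
      by simp
    finally have c: "qpow (1 - i - int m) * qpow (1 - k - int n) * inverse (of_nat q) =
        qpow (1 - (i + k) - int (m + n))" .
    have "conv (ev (YF i m)) (ev (YF k n)) (Eta \<gamma>) = qpow (1 - i - int m) * qpow (1 - k - int n) *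
        conv_chi (Diag, i, int m) (Diag, k, int n) (Eta \<gamma>)"
      unfolding YF_def by (rule conv_multiple_unit)
    also have "\<dots> = qpow (1 - i - int m) * qpow (1 - k - int n) * inverse (of_nat q) *
        unit_coeff (Diag, i + k, int (m + n)) \<gamma>"
      using assms full_conv_positive [of "int m" "int n" i k \<kappa> e]
      by (auto simp: \<gamma> conv_chi_Cell [OF Eta_in_Cell] unit_coeff_def)
    finally show "conv (ev (YF i m)) (ev (YF k n)) (Eta \<gamma>) = YF (i + k) (m + n) \<gamma>"
      unfolding c YF_def .
  qed
  show "conv_finite (YF i m) (YF k n)"
    unfolding YF_def by (rule conv_finite_multiple_unit)
qed

subsection \<open>Negative levels\<close>

text \<open>The functions of a fixed negative level whose coefficients vanish for small \<open>i\<close> are the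
  pairs \<open>(A, B)\<close> of Laurent series, \<open>A\<close> for the kind \<open>Diag\<close> and \<open>B\<close> for the kind \<open>Anti\<close>.\<close>

definition NF :: "int \<Rightarrow> complex fls \<Rightarrow> complex fls \<Rightarrow> coeffs" where
  "NF j A B = (\<lambda>(\<kappa>, i, l). if l = j then (case \<kappa> of Diag \<Rightarrow> A $$ i | Anti \<Rightarrow> B $$ i) else 0)"

lemma NF_level: "level_supported j (NF j A B)"
  by (auto simp: level_supported_def NF_def split: if_splits)

text \<open>The generating function of the structure constants in \<open>full_conv_negative\<close>.\<close>

definition cseries :: "complex fls" where
  "cseries = fps_to_fls (Abs_fps (\<lambda>k. if k = 0 then 0 else (of_nat q - 1) * of_nat q ^ (k - 1)))"

lemma cseries_nth: "cseries $$ i = (if i > 0 then (of_nat q - 1) * of_nat q ^ (nat i - 1) else 0)"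
  by (auto simp: cseries_def)

text \<open>The structure constants preserve the kind of the second factor and depend on the first indices
  only through \<open>e - i - k\<close>. Hence left convolution by \<open>(A, B)\<close> multiplies both components by the same
  series.\<close>

lemma
  assumes mn: "m < 0" "n < 0"
  shows conv_NF: "conv (ev (NF m A B)) (ev (NF n C D)) =
      ev (NF (m + n) (fls_const (inverse (of_nat q)) * (A + cseries * B) * C)
                     (fls_const (inverse (of_nat q)) * (A + cseries * B) * D))" (is "_ = ev ?R")
    and conv_finite_NF: "conv_finite (NF m A B) (NF n C D)"
proof -
  define lo where "lo = Min {fls_subdegree A, fls_subdegree B, fls_subdegree C, fls_subdegree D}"
  have lo: "A $$ i = 0" "B $$ i = 0" "C $$ i = 0" "D $$ i = 0" if "i < lo" for i
    using that by (auto simp: lo_def)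
  let ?F = "NF m A B" and ?G = "NF n C D"
  let ?t = "\<lambda>\<gamma> p. ?F (fst p) * ?G (snd p) * conv_chi (fst p) (snd p) (Eta \<gamma>)"
  define \<iota> where "\<iota> \<kappa> = (\<lambda>(\<mu>::kind, i::int, k::int). ((\<mu>, i, m), (\<kappa>::kind, k, n)))" for \<kappa>
  define Bx where "Bx e = {lo..e - lo}" for e
  define H where "H \<kappa> = (case \<kappa> of Diag \<Rightarrow> C | Anti \<Rightarrow> D)" for \<kappa>
  have H: "H \<kappa> $$ i = 0" if "i < lo" for \<kappa> i
    using lo that by (cases \<kappa>) (simp_all add: H_def)
  have G: "?G (\<kappa>, k, n) = H \<kappa> $$ k" for \<kappa> k
    by (cases \<kappa>) (simp_all add: NF_def H_def)
  have out: "?t (\<kappa>, e, l) p = 0" if "p \<notin> \<iota> \<kappa> ` (UNIV \<times> Bx e \<times> Bx e)" for \<kappa> e l p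
  proof (rule ccontr)
    assume t: "?t (\<kappa>, e, l) p \<noteq> 0"
    obtain \<mu> i m' \<nu> k n' where p: "p = ((\<mu>, i, m'), (\<nu>, k, n'))" by (metis surj_pair)
    have "?F (\<mu>, i, m') \<noteq> 0" "?G (\<nu>, k, n') \<noteq> 0" using t by (auto simp: p)
    then have mn': "m' = m" "n' = n"
      using NF_level [of m A B] NF_level [of n C D] by (auto simp: level_supported_def)
    have "i \<ge> lo"
      using \<open>?F (\<mu>, i, m') \<noteq> 0\<close> lo [of i]
      by (cases \<mu>) (auto simp: NF_def not_less [symmetric] split: if_splits)
    moreover have "k \<ge> lo"
      using \<open>?G (\<nu>, k, n') \<noteq> 0\<close> H [of k \<nu>] G [of \<nu> k] mn' by force
    moreover have "conv_chi (\<mu>, i, m) (\<nu>, k, n) (Eta (\<kappa>, e, l)) \<noteq> 0"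
      using t by (simp add: p mn')
    then have "\<kappa> = \<nu> \<and> i + k \<le> e"
      using full_conv_negative [OF mn, of \<mu> i \<nu> k \<kappa> e]
      by (cases \<mu>) (auto simp: conv_chi_Cell [OF Eta_in_Cell] split: if_splits)
    ultimately have "p \<in> \<iota> \<kappa> ` (UNIV \<times> Bx e \<times> Bx e)"
      by (auto simp: p mn' \<iota>_def Bx_def image_iff intro!: bexI [of _ "(\<mu>, i, k)"])
    then show False using that by blast
  qed
  have fin: "finite (\<iota> \<kappa> ` (UNIV \<times> Bx e \<times> Bx e))" for \<kappa> e
  proof -
    have "(UNIV :: kind set) = {Diag, Anti}" using kind.exhaust by auto
    then have "finite (UNIV :: kind set)" by (metis finite.emptyI finite.insertI)
    then show ?thesis by (intro finite_imageI finite_cartesian_product) (simp_all add: Bx_def)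
  qed
  show "conv_finite ?F ?G"
  proof (rule conv_finiteI)
    fix \<gamma> :: "kind \<times> int \<times> int"
    obtain \<kappa> e l where \<gamma>: "\<gamma> = (\<kappa>, e, l)" by (metis surj_pair)
    show "finite {p. ?t \<gamma> p \<noteq> 0}"
      by (rule finite_subset [OF _ fin [of \<kappa> e]]) (use out [of _ \<kappa> e l] \<gamma> in blast)
  qed
  show "conv (ev ?F) (ev ?G) = ev ?R"
  proof (rule conv_ev_eqI)
    fix \<gamma> :: "kind \<times> int \<times> int"
    obtain \<kappa> e l where \<gamma>: "\<gamma> = (\<kappa>, e, l)" by (metis surj_pair)
    have UNIV_kind: "(UNIV :: kind set) = {Diag, Anti}" using kind.exhaust by auto
    have inj: "inj_on (\<iota> \<kappa>) (UNIV \<times> Bx e \<times> Bx e)"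
      by (auto simp: inj_on_def \<iota>_def)
    have "conv (ev ?F) (ev ?G) (Eta \<gamma>) = (\<Sum>\<^sub>\<infinity>p\<in>UNIV. ?t \<gamma> p)"
      by (simp only: conv_ev)
    also have "\<dots> = (\<Sum>\<^sub>\<infinity>p\<in>\<iota> \<kappa> ` (UNIV \<times> Bx e \<times> Bx e). ?t \<gamma> p)"
      by (rule infsum_cong_neutral) (use out \<gamma> in auto)
    also have "\<dots> = (\<Sum>p\<in>\<iota> \<kappa> ` (UNIV \<times> Bx e \<times> Bx e). ?t \<gamma> p)"
      by (rule infsum_finite [OF fin])
    also have "\<dots> = (\<Sum>p\<in>UNIV \<times> Bx e \<times> Bx e. ?t \<gamma> (\<iota> \<kappa> p))"
      by (simp add: sum.reindex [OF inj])
    also have "\<dots> = (\<Sum>\<mu>\<in>UNIV. \<Sum>i\<in>Bx e. \<Sum>k\<in>Bx e. ?t \<gamma> ((\<mu>, i, m), (\<kappa>, k, n)))"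
      by (simp add: sum.cartesian_product \<iota>_def case_prod_unfold)
    also have "\<dots> = ?R \<gamma>"
    proof (cases "l = m + n")
      case False
      then have "conv_chi (\<mu>, i, m) (\<nu>, k, n) (Eta \<gamma>) = 0" for \<mu> i \<nu> k
        by (simp add: \<gamma> conv_chi_Cell [OF Eta_in_Cell])
      then show ?thesis using False by (simp add: \<gamma> NF_def)
    next
      case l: True
      have mn0: "0 \<le> m * n" using mn by (simp add: mult_nonpos_nonpos)
      have chiD: "conv_chi (Diag, i, m) (\<kappa>, k, n) (Eta \<gamma>) = inverse (of_nat q) * of_bool (k = e - i)"
        and chiA: "conv_chi (Anti, i, m) (\<kappa>, k, n) (Eta \<gamma>) = inverse (of_nat q) * cseries $$ (e - i - k)" for i k
        using mn0 full_conv_negative [OF mn, of _ i \<kappa> k \<kappa> e]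
        by (auto simp: \<gamma> l conv_chi_Cell [OF Eta_in_Cell] cseries_nth)
      have ik: "e - i \<in> Bx e" if "i \<in> Bx e" for i
        using that by (auto simp: Bx_def)
      have D: "(\<Sum>i\<in>Bx e. \<Sum>k\<in>Bx e. ?t \<gamma> ((Diag, i, m), (\<kappa>, k, n))) =
          inverse (of_nat q) * (A * H \<kappa>) $$ e"
      proof -
        have "(\<Sum>k\<in>Bx e. ?t \<gamma> ((Diag, i, m), (\<kappa>, k, n))) =
            inverse (of_nat q) * (A $$ i * H \<kappa> $$ (e - i))" if "i \<in> Bx e" for i
        proof -
          have "(\<Sum>k\<in>Bx e. ?t \<gamma> ((Diag, i, m), (\<kappa>, k, n))) =
              (\<Sum>k\<in>Bx e. if k = e - i then inverse (of_nat q) * (A $$ i * H \<kappa> $$ k) else 0)"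
            by (intro sum.cong refl) (simp add: chiD G, simp add: NF_def)
          also have "\<dots> = inverse (of_nat q) * (A $$ i * H \<kappa> $$ (e - i))"
            using ik [OF that] by (subst sum.delta) (simp_all add: Bx_def)
          finally show ?thesis .
        qed
        moreover have "(A * H \<kappa>) $$ e = (\<Sum>i\<in>Bx e. A $$ i * H \<kappa> $$ (e - i))"
          by (rule fls_times_nth_box [of lo _ lo]) (use lo H in \<open>auto simp: Bx_def\<close>)
        ultimately show ?thesis by (simp add: sum_distrib_left)
      qed
      have A: "(\<Sum>i\<in>Bx e. \<Sum>k\<in>Bx e. ?t \<gamma> ((Anti, i, m), (\<kappa>, k, n))) =
          inverse (of_nat q) * (B * (H \<kappa> * cseries)) $$ e"
      proof -
        have "(\<Sum>k\<in>Bx e. ?t \<gamma> ((Anti, i, m), (\<kappa>, k, n))) =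
            inverse (of_nat q) * (B $$ i * (H \<kappa> * cseries) $$ (e - i))" if "i \<in> Bx e" for i
        proof -
          have "(H \<kappa> * cseries) $$ (e - i) = (\<Sum>k\<in>Bx e. H \<kappa> $$ k * cseries $$ (e - i - k))"
            by (rule fls_times_nth_box [of lo _ 0]) (use that H in \<open>auto simp: Bx_def cseries_nth\<close>)
          then show ?thesis
            by (simp add: chiA G sum_distrib_left) (simp add: NF_def mult_ac)
        qed
        moreover have "(B * (H \<kappa> * cseries)) $$ e = (\<Sum>i\<in>Bx e. B $$ i * (H \<kappa> * cseries) $$ (e - i))"
        proof (rule fls_times_nth_box [of lo _ lo])
          show "(H \<kappa> * cseries) $$ i = 0" if "i < lo" for i
            by (subst fls_times_nth_box [of lo _ 0 _ "{}"]) (use that H in \<open>auto simp: cseries_nth\<close>)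
        qed (use lo in \<open>auto simp: Bx_def\<close>)
        ultimately show ?thesis by (simp add: sum_distrib_left)
      qed
      have R: "?R \<gamma> = inverse (of_nat q) * (A * H \<kappa>) $$ e + inverse (of_nat q) * (B * (H \<kappa> * cseries)) $$ e"
      proof -
        have "?R \<gamma> = (fls_const (inverse (of_nat q)) * (A + cseries * B) * H \<kappa>) $$ e"
          by (cases \<kappa>) (simp_all add: \<gamma> l NF_def H_def)
        also have "fls_const (inverse (of_nat q)) * (A + cseries * B) * H \<kappa> =
            fls_const (inverse (of_nat q)) * (A * H \<kappa>) + fls_const (inverse (of_nat q)) * (B * (H \<kappa> * cseries))"
          by (simp add: algebra_simps)
        finally show ?thesis by simp
      qed
      show ?thesis
        unfolding UNIV_kind R using A D by simp
    qed
    finally show "conv (ev ?F) (ev ?G) (Eta \<gamma>) = ?R \<gamma>" .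
  qed
qed

text \<open>\<open>\<Theta>\<^bsub>0,-1\<^esub>\<close> is the pair \<open>(1, d)\<close>. Its square is \<open>q\<^sup>-\<^sup>1 \<phi> (1, d)\<close>, and so on; the constant term
  of \<open>\<phi>\<close> is 1.\<close>

definition dseries :: "complex fls" where
  "dseries = fps_to_fls (Abs_fps (\<lambda>k. - (of_nat q - 1) * of_nat q ^ k))"

lemma dseries_nth: "dseries $$ i = (if i \<ge> 0 then - (of_nat q - 1) * of_nat q ^ nat i else 0)"
  by (auto simp: dseries_def)

lemma dseries_rec: "dseries = fls_const (of_nat q) * (fls_X * dseries) - fls_const (of_nat q - 1)"
proof (rule fls_eqI)
  fix n
  have X: "(fls_X * dseries) $$ n = dseries $$ (n - 1)"
    using fls_X_intpow_times_conv_shift(1) [of 1 dseries] fls_X_power_int [of 1, where 'a = complex] by simp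
  consider "n < 0" | "n = 0" | "n > 0" by linarith
  then show "dseries $$ n = (fls_const (of_nat q) * (fls_X * dseries) - fls_const (of_nat q - 1)) $$ n"
  proof cases
    case 3
    then have "nat n = Suc (nat (n - 1))" by simp
    with 3 show ?thesis by (simp add: X dseries_nth)
  qed (use X in \<open>simp_all add: dseries_nth\<close>)
qed

definition \<phi>series :: "complex fls" where
  "\<phi>series = 1 + cseries * dseries"

lemma \<phi>series_nonzero: "\<phi>series \<noteq> 0"
proof -
  have "(cseries * dseries) $$ 0 = (\<Sum>i\<in>{}. cseries $$ i * dseries $$ (0 - i))"
    by (rule fls_times_nth_box [of 1 _ 0]) (auto simp: cseries_nth dseries_nth)
  then have "\<phi>series $$ 0 = 1"
    by (simp add: \<phi>series_def)
  then show ?thesis by auto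
qed

definition wseries :: "int \<Rightarrow> nat \<Rightarrow> complex fls" where
  "wseries i m = fls_const (qpow (i + 1 - int m)) * fls_X powi i * \<phi>series ^ (m - 1)"

text \<open>The coefficients of \<open>X\<^sup>i Z\<^sup>m\<close> for positive \<open>m\<close>.\<close>

definition WF :: "int \<Rightarrow> nat \<Rightarrow> coeffs" where
  "WF i m = NF (- int m) (wseries i m) (wseries i m * dseries)"

lemma WF_level: "level_supported (- int m) (WF i m)"
  by (simp add: WF_def NF_level)

lemma
  assumes "m > 0" "n > 0"
  shows conv_WF_WF: "conv (ev (WF i m)) (ev (WF k n)) = ev (WF (i + k) (m + n))"
    and conv_finite_WF_WF: "conv_finite (WF i m) (WF k n)"
proof -
  have c: "inverse (of_nat q) * qpow (i + 1 - int m) * qpow (k + 1 - int n) =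
      qpow (i + k + 1 - int (m + n))"
  proof -
    have "inverse (of_nat q) * qpow (i + 1 - int m) * qpow (k + 1 - int n) =
        qpow (- 1 + (i + 1 - int m) + (k + 1 - int n))"
      by (simp only: qpow_add qpow_m1)
    also have "- 1 + (i + 1 - int m) + (k + 1 - int n) = i + k + 1 - int (m + n)"
      by simp
    finally show ?thesis .
  qed
  obtain m' n' where m': "m = Suc m'" "n = Suc n'"
    using assms by (metis Suc_pred)
  have "fls_const (inverse (of_nat q)) * (wseries i m + cseries * (wseries i m * dseries)) * wseries k n =
      fls_const (inverse (of_nat q)) * wseries i m * \<phi>series * wseries k n"
    by (simp add: \<phi>series_def algebra_simps)
  also have "\<dots> = (fls_const (inverse (of_nat q)) * fls_const (qpow (i + 1 - int m)) *
      fls_const (qpow (k + 1 - int n))) * (fls_X powi i * fls_X powi k) *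
      (\<phi>series ^ (m - 1) * \<phi>series * \<phi>series ^ (n - 1))"
    unfolding wseries_def by (simp only: ac_simps)
  also have "fls_const (inverse (of_nat q)) * fls_const (qpow (i + 1 - int m)) *
      fls_const (qpow (k + 1 - int n)) = fls_const (qpow (i + k + 1 - int (m + n)))"
    by (simp only: fls_const_mult_const c)
  also have "(fls_X :: complex fls) powi i * fls_X powi k = fls_X powi (i + k)"
    by (simp only: power_int_add [OF disjI1 [OF fls_X_nonzero]])
  also have "\<phi>series ^ (m - 1) * \<phi>series * \<phi>series ^ (n - 1) = \<phi>series ^ (m + n - 1)"
    by (simp add: m' power_add mult_ac)
  finally have w: "fls_const (inverse (of_nat q)) * (wseries i m + cseries * (wseries i m * dseries)) * wseries k n =
      wseries (i + k) (m + n)"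
    by (simp only: wseries_def)
  show "conv (ev (WF i m)) (ev (WF k n)) = ev (WF (i + k) (m + n))"
  proof -
    define P where "P = fls_const (inverse (of_nat q)) * (wseries i m + cseries * (wseries i m * dseries))"
    have P: "P * wseries k n = wseries (i + k) (m + n)" using w by (simp only: P_def)
    then have Pd: "P * (wseries k n * dseries) = wseries (i + k) (m + n) * dseries"
      by (simp only: mult.assoc [symmetric])
    have lv: "- int m + - int n = - int (m + n)" by simp
    show ?thesis
      using conv_NF [of "- int m" "- int n" "wseries i m" "wseries i m * dseries" "wseries k n"
          "wseries k n * dseries", folded P_def, unfolded P Pd lv] assms
      by (simp only: WF_def neg_less_0_iff_less of_nat_0_less_iff)
  qed
  show "conv_finite (WF i m) (WF k n)"
    unfolding WF_def using assms by (intro conv_finite_NF) simp_all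
qed

lemma LXpow_negative_level: "j < 0 \<Longrightarrow> LXpow i F (\<kappa>, e, j) = qpow i * F (\<kappa>, e - i, j)"
proof (induction i arbitrary: e rule: int_induct [where k = 0])
  case (step1 i)
  then show ?case
    unfolding LXpow_plus1 by (simp add: LX_negative_level qpow_add qpow_1 algebra_simps)
next
  case (step2 i)
  have "LXpow i F = LX (LXpow (i - 1) F)"
    using LXpow_plus1 [of "i - 1" F] by simp
  then have "LXpow i F (\<kappa>, e + 1, j) = of_nat q * LXpow (i - 1) F (\<kappa>, e, j)"
    using LX_negative_level [OF step2.prems] by simp
  then have "of_nat q * LXpow (i - 1) F (\<kappa>, e, j) = qpow i * F (\<kappa>, e + 1 - i, j)"
    using step2 by simp
  moreover have "qpow i = of_nat q * qpow (i - 1)"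
    using qpow_add [of 1 "i - 1"] by (simp add: qpow_1)
  ultimately show ?case by (simp add: algebra_simps)
qed simp

lemma fls_X_powi_times_nth: "(fls_X powi i * f) $$ n = (f :: complex fls) $$ (n - i)"
  by (simp add: fls_X_intpow_times_conv_shift)

lemma wseries_shift: "wseries (i + k) m = fls_const (qpow i) * (fls_X powi i * wseries k m)"
proof -
  have "qpow (i + k + 1 - int m) = qpow i * qpow (k + 1 - int m)"
    by (simp flip: qpow_add add: algebra_simps)
  then show ?thesis
    by (simp only: wseries_def power_int_add [OF disjI1 [OF fls_X_nonzero]]
        fls_const_mult_const [symmetric] ac_simps)
qed

lemma wseries_shift_nth:
  "wseries (i + k) m $$ e = qpow i * wseries k m $$ (e - i)"
  "(wseries (i + k) m * dseries) $$ e = qpow i * (wseries k m * dseries) $$ (e - i)"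
  unfolding wseries_shift mult.assoc
  by (simp_all add: fls_X_powi_times_nth del: fls_X_power_int)

lemma conv_XF_WF:
  assumes "m > 0"
  shows "conv (ev (XF i)) (ev (WF k m)) = ev (WF (i + k) m)"
proof -
  have "restrict_level (- int m) (LXpow i (WF k m)) = WF (i + k) m"
  proof
    fix \<gamma> :: "kind \<times> int \<times> int"
    obtain \<kappa> e l where \<gamma>: "\<gamma> = (\<kappa>, e, l)" by (metis surj_pair)
    show "restrict_level (- int m) (LXpow i (WF k m)) \<gamma> = WF (i + k) m \<gamma>"
      using assms
      by (cases \<kappa>) (auto simp: \<gamma> restrict_level_def LXpow_negative_level WF_def NF_def wseries_shift_nth)
  qed
  then show ?thesis
    by (simp add: conv_XF_left [OF WF_level])
qed

text \<open>The series \<open>d\<close> is chosen such that the right convolution with \<open>\<Theta>\<^bsub>1,0\<^esub>\<close> agrees with the left one.\<close>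

lemma RX_WF:
  assumes "m > 0"
  shows "RXpow 1 (WF k m) = WF (k + 1) m"
proof
  fix \<gamma> :: "kind \<times> int \<times> int"
  obtain \<kappa> e l where \<gamma>: "\<gamma> = (\<kappa>, e, l)" by (metis surj_pair)
  have j: "- int m < 0" using assms by simp
  define w where "w = wseries k m"
  have wd: "(w * dseries) $$ e = of_nat q * (w * dseries) $$ (e - 1) - (of_nat q - 1) * w $$ e" for e
  proof -
    have "w * dseries = fls_const (of_nat q) * (fls_X powi 1 * (w * dseries)) - fls_const (of_nat q - 1) * w"
      by (subst dseries_rec) (simp add: algebra_simps)
    then have "(w * dseries) $$ e = (fls_const (of_nat q) * (fls_X powi 1 * (w * dseries)) - fls_const (of_nat q - 1) * w) $$ e"
      by simp
    also have "\<dots> = of_nat q * (w * dseries) $$ (e - 1) - (of_nat q - 1) * w $$ e"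
      by (simp only: fls_minus_nth fls_mult_const_nth fls_X_powi_times_nth)
    finally show ?thesis .
  qed
  note sh = wseries_shift_nth [of 1 k m, unfolded qpow_1, folded w_def]
  show "RXpow 1 (WF k m) \<gamma> = WF (k + 1) m \<gamma>"
  proof (cases "l = - int m")
    case l: True
    show ?thesis
    proof (cases \<kappa>)
      case Diag
      then show ?thesis
        using sh(1) [of e] unfolding \<gamma> l by (simp add: RX_negative_level [OF j] WF_def NF_def w_def add.commute)
    next
      case Anti
      have "inverse (of_nat q) * (w * dseries) $$ (e + 1) +
          (of_nat q - 1) * (w $$ e + inverse (of_nat q) * w $$ (e + 1)) = of_nat q * (w * dseries) $$ (e - 1)"
        using wd [of "e + 1"] wd [of e] by (simp add: field_simps)
      then show ?thesis
        using sh(2) [of e] Anti unfolding \<gamma> l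
        by (simp add: RX_negative_level [OF j] WF_def NF_def w_def add.commute)
    qed
  next
    case False
    then show ?thesis
      using RX_level_supported [OF WF_level [of m k]] WF_level [of m "k + 1"] assms
      unfolding \<gamma> level_supported_def by (metis neg_equal_0_iff_equal of_nat_0_less_iff less_irrefl)
  qed
qed

lemma conv_WF_XF:
  assumes "m > 0"
  shows "conv (ev (WF k m)) (ev (XF i)) = ev (WF (i + k) m)"
proof -
  have "RXpow i (WF k m) = WF (i + k) m"
    by (rule RXpow_cong_shift) (rule RX_WF [OF assms])
  then show ?thesis
    by (simp add: conv_XF_right [OF WF_level] restrict_level_supported [OF WF_level])
qed

subsection \<open>The multiplication table\<close>

text \<open>\<open>EF (a, b, c)\<close> is the family of coefficients of \<open>\<Theta>\<^bsub>1,0\<^esub>\<^sup>a \<Theta>\<^bsub>0,1\<^esub>\<^sup>b \<Theta>\<^bsub>0,-1\<^esub>\<^sup>c\<close>.\<close>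

definition EF :: "int \<times> nat \<times> nat \<Rightarrow> coeffs" where
  "EF = (\<lambda>(a, b, c).
     if b = 0 \<and> c = 0 then XF a else if c = 0 then YF a b else if b = 0 then WF a c else (\<lambda>\<gamma>. 0))"

lemma level_supported_0: "level_supported j (\<lambda>\<gamma>. 0)"
  by (simp add: level_supported_def)

lemma EF_level: "level_supported (int b - int c) (EF (a, b, c))"
  using XF_level_0 YF_level WF_level level_supported_0 by (simp add: EF_def)

lemma conv_zero:
  "conv (ev (\<lambda>\<gamma>. 0)) (ev G) = (\<lambda>x. 0)" "conv (ev F) (ev (\<lambda>\<gamma>. 0)) = (\<lambda>x. 0)"
  "conv_finite (\<lambda>\<gamma>. 0) G" "conv_finite F (\<lambda>\<gamma>. 0)"
  by (simp_all only: conv_ev conv_finite_def fun_eq_iff, simp_all)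

lemma EF_mult: "conv (ev (EF m)) (ev (EF n)) = ev (EF (m + n)) \<and> conv_finite (EF m) (EF n)"
proof -
  obtain a b c a' b' c' where mn: "m = (a, b, c)" "n = (a', b', c')" by (metis surj_pair)
  have XX: "conv (ev (XF a)) (ev (XF a')) = ev (XF (a + a'))"
    using conv_XF_left [of 0 "XF a'" a] XF_level_0 [of a'] XF_level_0 [of "a + a'"]
    by (simp add: LXpow_XF restrict_level_supported)
  consider "b > 0 \<and> c > 0 \<or> b' > 0 \<and> c' > 0" | "b = 0" "c = 0" "b' = 0 \<or> c' = 0"
    | "b' = 0" "c' = 0" "b = 0 \<or> c = 0" | "b > 0" "c = 0" "b' > 0" "c' = 0"
    | "b = 0" "c > 0" "b' = 0" "c' > 0"
    | "b > 0" "c = 0" "b' = 0" "c' > 0" | "b = 0" "c > 0" "b' > 0" "c' = 0"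
    by (cases "b = 0"; cases "c = 0"; cases "b' = 0"; cases "c' = 0") simp_all
  then show ?thesis
  proof cases
    case 1
    then have "EF m = (\<lambda>\<gamma>. 0) \<or> EF n = (\<lambda>\<gamma>. 0)" "EF (m + n) = (\<lambda>\<gamma>. 0)"
      by (auto simp: mn EF_def)
    then show ?thesis using conv_zero by auto
  next
    case 2
    then show ?thesis
      using conv_finite_XF_left [OF EF_level [of b' c' a'], of a] XX
      by (auto simp: mn EF_def conv_XF_YF conv_XF_WF)
  next
    case 3
    then show ?thesis
      using conv_finite_XF_right [OF EF_level [of b c a], of a'] XX
      by (auto simp: mn EF_def conv_YF_XF conv_WF_XF add.commute)
  next
    case 4
    then show ?thesis by (simp add: mn EF_def conv_YF_YF conv_finite_YF_YF)
  next
    case 5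
    then show ?thesis by (simp add: mn EF_def conv_WF_WF conv_finite_WF_WF)
  next
    case 6
    then show ?thesis
      using conv_opposite_levels [OF YF_level [of b a] WF_level [of c' a']]
      by (simp add: mn EF_def mult_pos_neg)
  next
    case 7
    then show ?thesis
      using conv_opposite_levels [OF WF_level [of c a] YF_level [of b' a']]
      by (simp add: mn EF_def mult_neg_pos)
  qed
qed

end

section \<open>Linear independence of the monomials\<close>

lemma sum_singles:
  fixes p :: "'a \<Rightarrow>\<^sub>0 'b::comm_monoid_add"
  shows "(\<Sum>m\<in>Poly_Mapping.keys p. Poly_Mapping.single m (Poly_Mapping.lookup p m)) = p"
  by (rule poly_mapping_eqI) (simp add: lookup_sum lookup_single when_def in_keys_iff)

context sl2_two_dim_local_field
begin

definition \<Phi> :: "laurent_XYZ \<Rightarrow> coeffs" where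
  "\<Phi> p = (\<lambda>\<gamma>. \<Sum>m\<in>Poly_Mapping.keys p. Poly_Mapping.lookup p m * EF m \<gamma>)"

lemma \<Phi>_superset:
  assumes "finite A" "Poly_Mapping.keys p \<subseteq> A"
  shows "\<Phi> p \<gamma> = (\<Sum>m\<in>A. Poly_Mapping.lookup p m * EF m \<gamma>)"
  unfolding \<Phi>_def using assms by (intro sum.mono_neutral_left) (auto simp: in_keys_iff)

lemma \<Phi>_add: "\<Phi> (p + p') \<gamma> = \<Phi> p \<gamma> + \<Phi> p' \<gamma>"
proof -
  let ?A = "Poly_Mapping.keys p \<union> Poly_Mapping.keys p'"
  have "Poly_Mapping.keys (p + p') \<subseteq> ?A" by (rule Poly_Mapping.keys_add)
  then show ?thesis
    by (simp add: \<Phi>_superset [of ?A] lookup_add distrib_right sum.distrib)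
qed

lemma \<Phi>_uminus: "\<Phi> (- p) \<gamma> = - \<Phi> p \<gamma>"
  by (simp add: \<Phi>_def sum_negf)

lemma \<Phi>_0 [simp]: "\<Phi> 0 = (\<lambda>\<gamma>. 0)"
  by (simp add: \<Phi>_def)

lemma \<Phi>_sum: "\<Phi> (\<Sum>i\<in>A. f i) \<gamma> = (\<Sum>i\<in>A. \<Phi> (f i) \<gamma>)"
  by (induction A rule: infinite_finite_induct) (simp_all add: \<Phi>_add)

lemma \<Phi>_single: "\<Phi> (Poly_Mapping.single m c) \<gamma> = c * EF m \<gamma>"
  by (subst \<Phi>_superset [of "{m}"]) auto

lemma \<Phi>_eq_iff: "\<Phi> p = \<Phi> p' \<longleftrightarrow> \<Phi> (p - p') = (\<lambda>\<gamma>. 0)"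
proof -
  have "\<Phi> (p - p') \<gamma> = \<Phi> p \<gamma> - \<Phi> p' \<gamma>" for \<gamma>
    using \<Phi>_add [of p "- p'" \<gamma>] by (simp add: \<Phi>_uminus)
  then show ?thesis by (simp add: fun_eq_iff)
qed

lemma \<Phi>_smult: "\<Phi> (Poly_Mapping.single 0 c * p) = (\<lambda>\<gamma>. c * \<Phi> p \<gamma>)"
proof
  fix \<gamma>
  have "Poly_Mapping.single 0 c * p = Poly_Mapping.single 0 c *
      (\<Sum>m\<in>Poly_Mapping.keys p. Poly_Mapping.single m (Poly_Mapping.lookup p m))"
    by (simp only: sum_singles)
  also have "\<dots> = (\<Sum>m\<in>Poly_Mapping.keys p. Poly_Mapping.single m (c * Poly_Mapping.lookup p m))"
    by (simp add: sum_distrib_left mult_single)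
  finally have "\<Phi> (Poly_Mapping.single 0 c * p) \<gamma> =
      (\<Sum>m\<in>Poly_Mapping.keys p. c * Poly_Mapping.lookup p m * EF m \<gamma>)"
    by (simp add: \<Phi>_sum \<Phi>_single)
  then show "\<Phi> (Poly_Mapping.single 0 c * p) \<gamma> = c * \<Phi> p \<gamma>"
    by (simp add: \<Phi>_def sum_distrib_left mult.assoc)
qed

lemma ev_\<Phi>_add: "ev (\<Phi> (p + p')) = (\<lambda>x. ev (\<Phi> p) x + ev (\<Phi> p') x)"
proof -
  have "\<Phi> (p + p') = (\<lambda>\<gamma>. \<Phi> p \<gamma> + \<Phi> p' \<gamma>)" by (rule ext) (rule \<Phi>_add)
  then show ?thesis by (intro ext) (simp only: ev_add)
qed

lemma ev_\<Phi>_smult: "ev (\<Phi> (Poly_Mapping.single 0 c * p)) = (\<lambda>x. c * ev (\<Phi> p) x)"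
  by (rule ext) (simp only: \<Phi>_smult ev_scale)

lemma ev_\<Phi>: "ev (\<Phi> p) = (\<lambda>x. \<Sum>m\<in>Poly_Mapping.keys p. Poly_Mapping.lookup p m * ev (EF m) x)"
  by (rule ext) (simp only: \<Phi>_def ev_sum ev_scale)

lemma conv_bilinear:
  assumes fin: "finite A" "finite B" "\<And>m n. m \<in> A \<Longrightarrow> n \<in> B \<Longrightarrow> conv_finite (F m) (G n)"
  shows "conv (ev (\<lambda>\<gamma>. \<Sum>m\<in>A. c m * F m \<gamma>)) (ev (\<lambda>\<gamma>. \<Sum>n\<in>B. d n * G n \<gamma>)) x =
    (\<Sum>m\<in>A. \<Sum>n\<in>B. c m * d n * conv (ev (F m)) (ev (G n)) x)"
proof -
  let ?t = "\<lambda>m n p. F m (fst p) * G n (snd p) * conv_chi (fst p) (snd p) x"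
  define P where "P = (\<Union>m\<in>A. \<Union>n\<in>B. {p. ?t m n p \<noteq> 0})"
  have P: "finite P" using fin by (auto simp: P_def conv_finite_def)
  have t: "?t m n p = 0" if "m \<in> A" "n \<in> B" "p \<notin> P" for m n p
    using that by (auto simp: P_def)
  have conv_P: "conv (ev (F m)) (ev (G n)) x = (\<Sum>p\<in>P. ?t m n p)" if "m \<in> A" "n \<in> B" for m n
    unfolding conv_ev infsum_finite [OF P, symmetric]
    by (rule infsum_cong_neutral) (use t [OF that] in auto)
  have eq: "(\<Sum>m\<in>A. c m * F m (fst p)) * (\<Sum>n\<in>B. d n * G n (snd p)) * conv_chi (fst p) (snd p) x =
      (\<Sum>m\<in>A. \<Sum>n\<in>B. c m * d n * ?t m n p)" for p
    by (subst sum_product, unfold sum_distrib_right, intro sum.cong refl) (simp only: mult_ac)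
  have "conv (ev (\<lambda>\<gamma>. \<Sum>m\<in>A. c m * F m \<gamma>)) (ev (\<lambda>\<gamma>. \<Sum>n\<in>B. d n * G n \<gamma>)) x =
      (\<Sum>p\<in>P. \<Sum>m\<in>A. \<Sum>n\<in>B. c m * d n * ?t m n p)"
    unfolding conv_ev eq infsum_finite [OF P, symmetric]
    by (rule infsum_cong_neutral) (use t in \<open>auto intro!: sum.neutral\<close>)
  also have "\<dots> = (\<Sum>m\<in>A. \<Sum>n\<in>B. \<Sum>p\<in>P. c m * d n * ?t m n p)"
    by (subst sum.swap) (intro sum.cong refl sum.swap)
  also have "\<dots> = (\<Sum>m\<in>A. \<Sum>n\<in>B. c m * d n * conv (ev (F m)) (ev (G n)) x)"
    by (intro sum.cong refl) (simp add: conv_P sum_distrib_left)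
  finally show ?thesis .
qed

lemma \<Phi>_mult: "conv (ev (\<Phi> p)) (ev (\<Phi> p')) = ev (\<Phi> (p * p'))"
proof
  fix x
  let ?K = "Poly_Mapping.keys p" and ?K' = "Poly_Mapping.keys p'"
  let ?c = "Poly_Mapping.lookup p" and ?c' = "Poly_Mapping.lookup p'"
  have "p * p' = (\<Sum>m\<in>?K. Poly_Mapping.single m (?c m)) * (\<Sum>n\<in>?K'. Poly_Mapping.single n (?c' n))"
    by (simp only: sum_singles)
  also have "\<dots> = (\<Sum>m\<in>?K. \<Sum>n\<in>?K'. Poly_Mapping.single (m + n) (?c m * ?c' n))"
    by (simp add: sum_product mult_single)
  finally have pp: "\<Phi> (p * p') \<gamma> = (\<Sum>m\<in>?K. \<Sum>n\<in>?K'. ?c m * ?c' n * EF (m + n) \<gamma>)" for \<gamma>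
    by (simp add: \<Phi>_sum \<Phi>_single)
  have "conv (ev (\<Phi> p)) (ev (\<Phi> p')) x =
      (\<Sum>m\<in>?K. \<Sum>n\<in>?K'. ?c m * ?c' n * conv (ev (EF m)) (ev (EF n)) x)"
    unfolding \<Phi>_def using EF_mult by (intro conv_bilinear) auto
  also have "\<dots> = ev (\<Phi> (p * p')) x"
    unfolding pp using EF_mult by (simp add: ev_sum ev_scale)
  finally show "conv (ev (\<Phi> p)) (ev (\<Phi> p')) x = ev (\<Phi> (p * p')) x" .
qed

lemma LX_sum: "finite A \<Longrightarrow> LX (\<lambda>\<gamma>. \<Sum>i\<in>A. c i * F i \<gamma>) = (\<lambda>\<gamma>. \<Sum>i\<in>A. c i * LX (F i) \<gamma>)"
proof (induction A rule: finite_induct)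
  case empty
  show ?case using LX_lincomb [of 0 "\<lambda>\<gamma>. 0" 0 "\<lambda>\<gamma>. 0"] by simp
next
  case (insert i A)
  then show ?case
    using LX_lincomb [of "c i" "F i" 1 "\<lambda>\<gamma>. \<Sum>i\<in>A. c i * F i \<gamma>"] by simp
qed

text \<open>After multiplication with a large power of \<open>\<Theta>\<^bsub>1,0\<^esub>\<close> only multiples of distinct
  characteristic functions remain.\<close>

lemma XF_independent:
  assumes A: "finite A" and zero: "\<And>\<gamma>. (\<Sum>a\<in>A. c a * XF a \<gamma>) = 0" and a: "a \<in> A"
  shows "c a = 0"
proof -
  have shift: "(\<Sum>a\<in>A. c a * XF (a + int N) \<gamma>) = 0" for N \<gamma>
  proof (induction N arbitrary: \<gamma>)
    case (Suc N)
    have "(\<lambda>\<gamma>. \<Sum>a\<in>A. c a * LX (XF (a + int N)) \<gamma>) = LX (\<lambda>\<gamma>. \<Sum>a\<in>A. c a * XF (a + int N) \<gamma>)"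
      by (rule LX_sum [OF A, symmetric])
    also have "\<dots> = LX (\<lambda>\<gamma>. 0)" using Suc.IH by simp
    also have "\<dots> = (\<lambda>\<gamma>. 0)" using LX_lincomb [of 0 "\<lambda>\<gamma>. 0" 0 "\<lambda>\<gamma>. 0"] by simp
    finally have "(\<Sum>a\<in>A. c a * LX (XF (a + int N)) \<gamma>) = 0" by (rule fun_cong)
    then show ?case by (simp add: LX_XF algebra_simps)
  qed (use zero in simp)
  define N where "N = Suc (\<Sum>a\<in>A. nat \<bar>a\<bar>)"
  have pos: "a + int N = int (nat (a + int N - 1)) + 1" if "a \<in> A" for a
  proof -
    have "nat \<bar>a\<bar> \<le> (\<Sum>a\<in>A. nat \<bar>a\<bar>)"
      using A that by (intro member_le_sum) auto
    then have "nat \<bar>a\<bar> < N" by (simp only: N_def less_Suc_eq_le)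
    then show ?thesis by arith
  qed
  define \<gamma> where "\<gamma> = (Diag, a + int N, 0 :: int)"
  have val: "XF (b + int N) \<gamma> = (if b = a then inverse (of_nat q) ^ nat (a + int N - 1) else 0)" if "b \<in> A" for b
    using XF_positive [of "nat (b + int N - 1)"] unfolding pos [OF that, symmetric]
    by (simp add: \<gamma>_def unit_coeff_def)
  have "(\<Sum>b\<in>A. c b * XF (b + int N) \<gamma>) =
      (\<Sum>b\<in>A. if b = a then c a * inverse (of_nat q) ^ nat (a + int N - 1) else 0)"
    using val by (intro sum.cong) auto
  then show ?thesis
    using shift [of N \<gamma>] A a by simp
qed

lemma fls_X_powi_nth: "(fls_X powi b :: complex fls) $$ a = (if a = b then 1 else 0)"
  using fls_X_powi_times_nth [of b 1 a] by simp

text \<open>Division by the common factor \<open>\<phi>\<^bsup>m-1\<^esup>\<close> leaves multiples of distinct powers of the variable.\<close>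

lemma wseries_independent:
  assumes A: "finite A" and zero: "\<And>i. (\<Sum>a\<in>A. c a * wseries a m $$ i) = 0" and a: "a \<in> A"
  shows "c a = 0"
proof -
  let ?s = "\<Sum>b\<in>A. fls_const (c b * qpow (b + 1 - int m)) * fls_X powi b"
  have "?s * \<phi>series ^ (m - 1) = (\<Sum>b\<in>A. fls_const (c b) * wseries b m)"
    unfolding sum_distrib_right
    by (intro sum.cong refl) (simp only: wseries_def fls_const_mult_const [symmetric] mult.assoc)
  also have "\<dots> = 0"
    by (rule fls_eqI) (use zero in \<open>simp add: fls_nth_sum\<close>)
  finally have "?s = 0"
    using \<phi>series_nonzero by simp
  then have "?s $$ a = 0" by simp
  moreover have "(fls_const (c b * qpow (b + 1 - int m)) * fls_X powi b) $$ a =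
      (if b = a then c a * qpow (a + 1 - int m) else 0)" for b
    by (auto simp: fls_X_powi_nth simp del: fls_X_power_int)
  ultimately show ?thesis
    using A a by (simp add: fls_nth_sum del: fls_X_power_int)
qed

lemma \<Phi>_eq_0_iff: "\<Phi> p = (\<lambda>\<gamma>. 0) \<longleftrightarrow> (\<forall>a b c. (a, b, c) \<in> Poly_Mapping.keys p \<longrightarrow> b > 0 \<and> c > 0)"
proof
  assume *: "\<forall>a b c. (a, b, c) \<in> Poly_Mapping.keys p \<longrightarrow> b > 0 \<and> c > 0"
  have "EF m = (\<lambda>\<gamma>. 0)" if "m \<in> Poly_Mapping.keys p" for m
    using * that by (cases m) (auto simp: EF_def)
  then show "\<Phi> p = (\<lambda>\<gamma>. 0)" by (simp add: \<Phi>_def)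
next
  assume zero: "\<Phi> p = (\<lambda>\<gamma>. 0)"
  let ?K = "Poly_Mapping.keys p" and ?c = "Poly_Mapping.lookup p"
  \<comment> \<open>The terms of a fixed level are the multiples of \<open>Y\<^sup>b\<close>, or of \<open>Z\<^sup>c\<close>.\<close>
  have part: "(\<Sum>a\<in>{a. (a, b, c) \<in> ?K}. ?c (a, b, c) * EF (a, b, c) (\<kappa>, i, int b - int c)) = 0"
    if bc: "b = 0 \<or> c = 0" for b c \<kappa> i
  proof -
    let ?\<gamma> = "(\<kappa>, i, int b - int c)"
    have inj: "inj_on (\<lambda>a. (a, b, c)) {a. (a, b, c) \<in> ?K}" by (simp add: inj_on_def)
    have "0 = (\<Sum>m\<in>?K. ?c m * EF m ?\<gamma>)"
      using fun_cong [OF zero, of ?\<gamma>] by (simp add: \<Phi>_def)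
    also have "\<dots> = (\<Sum>m\<in>(\<lambda>a. (a, b, c)) ` {a. (a, b, c) \<in> ?K}. ?c m * EF m ?\<gamma>)"
    proof (rule sum.mono_neutral_right)
      show "\<forall>m\<in>?K - (\<lambda>a. (a, b, c)) ` {a. (a, b, c) \<in> ?K}. ?c m * EF m ?\<gamma> = 0"
      proof
        fix m assume m: "m \<in> ?K - (\<lambda>a. (a, b, c)) ` {a. (a, b, c) \<in> ?K}"
        obtain a' b' c' where m': "m = (a', b', c')" by (metis surj_pair)
        have "b' \<noteq> b \<or> c' \<noteq> c" using m by (auto simp: m')
        moreover have "b' > 0 \<and> c' > 0 \<or> int b' - int c' = int b - int c" if "EF m ?\<gamma> \<noteq> 0"
          using EF_level [of b' c' a'] that by (auto simp: level_supported_def m')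
        moreover have "EF m = (\<lambda>\<gamma>. 0)" if "b' > 0 \<and> c' > 0"
          using that by (simp add: m' EF_def)
        ultimately show "?c m * EF m ?\<gamma> = 0"
          using bc by (cases "b' > 0 \<and> c' > 0") auto
      qed
    qed auto
    also have "\<dots> = (\<Sum>a\<in>{a. (a, b, c) \<in> ?K}. ?c (a, b, c) * EF (a, b, c) ?\<gamma>)"
      by (simp add: sum.reindex [OF inj])
    finally show ?thesis by simp
  qed
  have fin: "finite {a. (a, b, c) \<in> ?K}" for b c
  proof -
    have "finite ((\<lambda>a. (a, b, c)) -` ?K)"
      by (rule finite_vimageI) (simp_all add: inj_def)
    then show ?thesis by (simp add: vimage_def)
  qed
  have "?c (a, b, c) = 0" if bc: "b = 0 \<or> c = 0" and a: "(a, b, c) \<in> ?K" for a b c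
  proof -
    consider "b = 0" "c = 0" | "b > 0" "c = 0" | "b = 0" "c > 0" using bc by auto
    then show ?thesis
    proof cases
      case 1
      have "(\<Sum>a\<in>{a. (a, b, c) \<in> ?K}. ?c (a, b, c) * XF a \<gamma>) = 0" for \<gamma>
      proof -
        obtain \<kappa> i l where \<gamma>: "\<gamma> = (\<kappa>, i, l)" by (metis surj_pair)
        show ?thesis
        proof (cases "l = 0")
          case True
          then show ?thesis using part [OF bc, of \<kappa> i] 1 by (simp add: EF_def \<gamma>)
        next
          case False
          then have "XF a \<gamma> = 0" for a
            using XF_level_0 [of a] by (auto simp: level_supported_def \<gamma>)
          then show ?thesis by simp
        qed
      qed
      from XF_independent [OF fin this] show ?thesis using a by simp
    next
      case 2
      have "?c (a', b, c) * EF (a', b, c) (Diag, a, int b - int c) =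
          (if a' = a then ?c (a, b, c) * qpow (1 - a - int b) else 0)" for a'
        using 2 by (simp add: EF_def YF_def unit_coeff_def)
      then show ?thesis
        using part [OF bc, of Diag a] fin [of b c] a by simp
    next
      case 3
      have "(\<Sum>a\<in>{a. (a, b, c) \<in> ?K}. ?c (a, b, c) * wseries a c $$ i) = 0" for i
        using part [OF bc, of Diag i] 3 by (simp add: EF_def WF_def NF_def)
      from wseries_independent [OF fin this] show ?thesis using a by simp
    qed
  qed
  then show "\<forall>a b c. (a, b, c) \<in> ?K \<longrightarrow> b > 0 \<and> c > 0"
    by (metis in_keys_iff neq0_conv)
qed

section \<open>The monomials in the Hecke algebra\<close>

text \<open>The generators of \<open>hecke_space\<close> in terms of coefficients.\<close>

lemma infsum_chi:
  "(\<lambda>x. \<Sum>\<^sub>\<infinity>r\<in>R. c r * chi \<kappa> r j x) =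
   ev (\<lambda>(\<kappa>', r, j'). if \<kappa>' = \<kappa> \<and> j' = j \<and> r \<in> R then c r else 0)"
proof
  fix x
  show "(\<Sum>\<^sub>\<infinity>r\<in>R. c r * chi \<kappa> r j x) =
      ev (\<lambda>(\<kappa>', r, j'). if \<kappa>' = \<kappa> \<and> j' = j \<and> r \<in> R then c r else 0) x"
  proof (cases "det x = 1")
    case True
    then obtain \<kappa>' i j' where x: "x \<in> Cell (\<kappa>', i, j')" using Bruhat_exists by (metis surj_pair)
    have chi: "chi \<kappa> r j x = (if \<kappa>' = \<kappa> \<and> j' = j \<and> r = i then 1 else 0)" for r
      using ev_Cell [OF x] by (auto simp: chi_ev unit_coeff_def)
    have "(\<Sum>\<^sub>\<infinity>r\<in>R. c r * chi \<kappa> r j x) =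
        (\<Sum>\<^sub>\<infinity>r\<in>R \<inter> {i}. if \<kappa>' = \<kappa> \<and> j' = j then c i else 0)"
      unfolding chi by (rule infsum_cong_neutral) auto
    also have "\<dots> = (if \<kappa>' = \<kappa> \<and> j' = j \<and> i \<in> R then c i else 0)"
      by (cases "i \<in> R") simp_all
    finally show ?thesis using ev_Cell [OF x] by simp
  next
    case False
    then show ?thesis by (simp add: chi_ev ev_no_det)
  qed
qed

lemma hecke_space_ev_add:
  "ev F \<in> hecke_space \<Longrightarrow> ev G \<in> hecke_space \<Longrightarrow> ev (\<lambda>\<gamma>. F \<gamma> + G \<gamma>) \<in> hecke_space"
  using hecke_space.add [of "ev F" "ev G"] by (simp flip: ev_add)

lemma hecke_space_finite_support:
  assumes "level_supported 0 F" "finite {\<gamma>. F \<gamma> \<noteq> 0}"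
  shows "ev F \<in> hecke_space"
proof -
  let ?I = "(\<lambda>\<gamma>. fst (snd \<gamma>)) ` {\<gamma>. F \<gamma> \<noteq> 0}"
  define lo hi where "lo = Min (insert 0 ?I)" and "hi = Max (insert 0 ?I)"
  have r: "r \<in> {lo..hi}" if "F (\<kappa>, r, l) \<noteq> 0" for \<kappa> r l
  proof -
    have "r \<in> insert 0 ?I" using that by (force intro: image_eqI [of _ _ "(\<kappa>, r, l)"])
    then show ?thesis using assms(2) by (auto simp: lo_def hi_def intro: Min_le Max_ge)
  qed
  define P :: "kind \<Rightarrow> coeffs" where "P \<kappa> = (\<lambda>(\<kappa>', r, j'). if \<kappa>' = \<kappa> \<and> j' = 0 \<and> r \<in> {lo..hi} then F (\<kappa>, r, 0) else 0)"
    for \<kappa>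
  have part: "ev (P \<kappa>) \<in> hecke_space" for \<kappa>
    using hecke_space.zero [of "\<lambda>r. F (\<kappa>, r, 0)" \<kappa> lo hi]
    unfolding P_def infsum_chi [symmetric] by simp
  have "F = (\<lambda>\<gamma>. P Diag \<gamma> + P Anti \<gamma>)"
  proof
    fix \<gamma> :: "kind \<times> int \<times> int"
    obtain \<kappa> i l where \<gamma>: "\<gamma> = (\<kappa>, i, l)" by (metis surj_pair)
    have "F (\<kappa>, i, l) = 0" if "l \<noteq> 0 \<or> i \<notin> {lo..hi}"
      using assms(1) r that unfolding level_supported_def by blast
    then show "F \<gamma> = P Diag \<gamma> + P Anti \<gamma>"
      by (cases \<kappa>) (auto simp: \<gamma> P_def)
  qed
  then show ?thesis using hecke_space_ev_add [OF part [of Diag] part [of Anti]] by simp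
qed

lemma hecke_space_NF:
  assumes "j < 0"
  shows "ev (NF j A B) \<in> hecke_space"
proof -
  have part: "ev (\<lambda>(\<kappa>', r, j'). if \<kappa>' = \<kappa> \<and> j' = j \<and> r \<in> {fls_subdegree C..} then C $$ r else 0) \<in> hecke_space"
    for \<kappa> C
    using hecke_space.neg [OF assms, of "\<lambda>r. C $$ r" \<kappa> "fls_subdegree C"]
    unfolding infsum_chi .
  have "NF j A B = (\<lambda>\<gamma>. (\<lambda>(\<kappa>', r, j'). if \<kappa>' = Diag \<and> j' = j \<and> r \<in> {fls_subdegree A..} then A $$ r else 0) \<gamma> +
      (\<lambda>(\<kappa>', r, j'). if \<kappa>' = Anti \<and> j' = j \<and> r \<in> {fls_subdegree B..} then B $$ r else 0) \<gamma>)"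
    by (rule ext) (auto simp: NF_def not_le split: kind.splits prod.splits)
  then show ?thesis using hecke_space_ev_add [OF part part] by simp
qed

lemma hecke_space_YF:
  assumes "m > 0"
  shows "ev (YF i m) \<in> hecke_space"
proof -
  let ?c = "\<lambda>r. if r = i then qpow (1 - i - int m) else 0"
  have "YF i m = (\<lambda>(\<kappa>', r, j'). if \<kappa>' = Diag \<and> j' = int m \<and> r \<in> {..i} then ?c r else 0)"
    by (rule ext) (auto simp: YF_def unit_coeff_def split: prod.splits)
  then show ?thesis
    using hecke_space.pos [of "int m" ?c Diag i] assms unfolding infsum_chi by simp
qed

lemma hecke_space_zero: "(\<lambda>x. 0) \<in> hecke_space"
  using hecke_space.zero [of "\<lambda>r. 0" Diag 0 0] by simp

lemma hecke_space_EF: "ev (EF m) \<in> hecke_space"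
proof -
  obtain a b c where m: "m = (a, b, c)" by (metis surj_pair)
  show ?thesis
    using XF_level_0 [of a] hecke_space_zero
    by (auto simp: m EF_def WF_def intro: hecke_space_finite_support hecke_space_YF hecke_space_NF)
qed

lemma hecke_space_\<Phi>: "ev (\<Phi> p) \<in> hecke_space"
proof -
  have "(\<lambda>x. \<Sum>m\<in>A. Poly_Mapping.lookup p m * ev (EF m) x) \<in> hecke_space" if "finite A" for A
    using that
  proof (induction A rule: finite_induct)
    case (insert m A)
    then show ?case
      using hecke_space.add [OF hecke_space.scale [OF hecke_space_EF [of m], of "Poly_Mapping.lookup p m"] insert.IH]
      by simp
  qed (simp add: hecke_space_zero)
  from this [OF finite_keys, of p] show ?thesis
    unfolding ev_\<Phi> .
qed

lemma iota_ev: "iota = ev (EF 0)"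
  by (simp add: fun_eq_iff iota_def EF_def zero_prod_def XF_def chi_ev ev_scale)

lemma Theta_1_0_ev: "Theta_1_0 = ev (EF (1, 0, 0))"
  using XF_positive [of 0] by (simp add: Theta_1_0_def EF_def chi_ev)

lemma Theta_m1_0_ev: "Theta_m1_0 = ev (EF (- 1, 0, 0))"
proof -
  have "ev (XF (- 1)) = ev (\<lambda>\<gamma>. (unit_coeff (Diag, - 1, 0) \<gamma>
      + (- (of_nat q - 1)) * unit_coeff (Anti, - 1, 0) \<gamma>) + ((- (of_nat q - 1)) * unit_coeff (Anti, 0, 0) \<gamma>
      + of_nat q * (of_nat q + inverse (of_nat q) - 2) * unit_coeff (Diag, 0, 0) \<gamma>))"
    unfolding XF_minus1 by (simp add: algebra_simps)
  then show ?thesis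
    by (simp only: fun_eq_iff Theta_m1_0_def EF_def chi_ev ev_add ev_scale prod.case) (simp add: algebra_simps)
qed

lemma Theta_0_1_ev: "Theta_0_1 = ev (EF (0, 1, 0))"
  by (simp add: Theta_0_1_def EF_def YF_def chi_ev)

lemma Theta_0_m1_ev: "Theta_0_m1 = ev (EF (0, 0, 1))"
proof
  fix x
  have w: "wseries 0 (Suc 0) = 1"
    by (simp add: wseries_def)
  have sum: "(\<Sum>\<^sub>\<infinity>i\<in>UNIV. of_nat q ^ i * chi Anti (int i) (- 1) x) =
      (\<Sum>\<^sub>\<infinity>r\<in>{0..}. of_nat q ^ nat r * chi Anti r (- 1) x)"
  proof -
    have "bij_betw int UNIV {0..}"
      by (rule bij_betwI [where g = nat]) auto
    from infsum_reindex_bij_betw [OF this, of "\<lambda>r. of_nat q ^ nat r * chi Anti r (- 1) x"]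
    show ?thesis by simp
  qed
  have "EF (0, 0, 1) = (\<lambda>\<gamma>. unit_coeff (Diag, 0, - 1) \<gamma> + (- (of_nat q - 1)) *
      (\<lambda>(\<kappa>', r, j'). if \<kappa>' = Anti \<and> j' = - 1 \<and> r \<in> {0..} then of_nat q ^ nat r else 0) \<gamma>)"
    by (rule ext) (auto simp: EF_def WF_def NF_def w dseries_nth unit_coeff_def split: kind.splits prod.splits)
  then show "Theta_0_m1 x = ev (EF (0, 0, 1)) x"
    by (simp only: Theta_0_m1_def sum ev_add ev_scale chi_ev [of Diag] fun_cong [OF infsum_chi])
       (simp add: algebra_simps)
qed

lemma Theta_algebra_carrier: "carrier Theta_algebra = range (\<lambda>p. ev (\<Phi> p))"
proof -
  let ?S = "{Theta_1_0, Theta_m1_0, Theta_0_1, Theta_0_m1}"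
  let ?R = "range (\<lambda>p. ev (\<Phi> p))"
  have single: "ev (EF m) = ev (\<Phi> (Poly_Mapping.single m 1))" for m
    by (rule arg_cong [of _ _ ev]) (simp add: fun_eq_iff \<Phi>_single)
  have sub: "is_subalgebra ?R hecke_algebra"
    unfolding is_subalgebra_def
  proof (intro conjI ballI allI)
    show "?R \<subseteq> carrier hecke_algebra"
      using hecke_space_\<Phi> by (auto simp: hecke_algebra_def)
    show "\<one>\<^bsub>hecke_algebra\<^esub> \<in> ?R"
      by (simp add: hecke_algebra_def iota_ev single)
    show "\<zero>\<^bsub>hecke_algebra\<^esub> \<in> ?R"
      by (rule image_eqI [of _ _ 0]) (simp_all add: hecke_algebra_def)
    fix f assume f: "f \<in> ?R"
    then obtain p where p: "f = ev (\<Phi> p)" by blast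
    show "c \<odot>\<^bsub>hecke_algebra\<^esub> f \<in> ?R" for c
      by (rule image_eqI [of _ _ "Poly_Mapping.single 0 c * p"])
         (simp_all add: hecke_algebra_def p ev_\<Phi>_smult)
    fix g assume "g \<in> ?R"
    then obtain p' where p': "g = ev (\<Phi> p')" by blast
    show "f \<oplus>\<^bsub>hecke_algebra\<^esub> g \<in> ?R"
      by (rule image_eqI [of _ _ "p + p'"]) (simp_all add: hecke_algebra_def p p' ev_\<Phi>_add)
    show "f \<otimes>\<^bsub>hecke_algebra\<^esub> g \<in> ?R"
      by (rule image_eqI [of _ _ "p * p'"]) (simp_all add: hecke_algebra_def p p' \<Phi>_mult)
  qed
  have gen: "?S \<subseteq> ?R"
    by (auto simp: Theta_1_0_ev Theta_m1_0_ev Theta_0_1_ev Theta_0_m1_ev single)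
  have min: "?R \<subseteq> B" if B: "is_subalgebra B hecke_algebra" "?S \<subseteq> B" for B
  proof -
    have conv_B: "conv f g \<in> B" if "f \<in> B" "g \<in> B" for f g
      using B(1) that by (simp add: is_subalgebra_def hecke_algebra_def)
    have add: "ev (EF (m + n)) \<in> B" if "ev (EF m) \<in> B" "ev (EF n) \<in> B" for m n
      using conv_B [OF that] EF_mult [of m n] by simp
    have gens: "ev (EF (1, 0, 0)) \<in> B" "ev (EF (- 1, 0, 0)) \<in> B" "ev (EF (0, 1, 0)) \<in> B"
      "ev (EF (0, 0, 1)) \<in> B" "ev (EF (0, 0, 0)) \<in> B"
      using B iota_ev
      by (auto simp: Theta_1_0_ev Theta_m1_0_ev Theta_0_1_ev Theta_0_m1_ev is_subalgebra_def hecke_algebra_def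
          zero_prod_def)
    have X: "ev (EF (a, 0, 0)) \<in> B" for a
    proof (induction a rule: int_induct [where k = 0])
      case (step1 i)
      then show ?case using add [OF step1(2) gens(1)] by simp
    next
      case (step2 i)
      then show ?case using add [OF step2(2) gens(2)] by simp
    qed (use gens in simp)
    have Y: "ev (EF (0, b, 0)) \<in> B" for b
    proof (induction b)
      case (Suc b)
      then show ?case using add [OF Suc gens(3)] by simp
    qed (use gens in simp)
    have Z: "ev (EF (0, 0, c)) \<in> B" for c
    proof (induction c)
      case (Suc c)
      then show ?case using add [OF Suc gens(4)] by simp
    qed (use gens in simp)
    have EF: "ev (EF m) \<in> B" for m
    proof -
      obtain a b c where "m = (a, 0, 0) + (0, b, 0) + (0, 0, c)"
        by (metis add.left_neutral add.right_neutral add_Pair surj_pair)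
      then show ?thesis using add X Y Z by metis
    qed
    have "(\<lambda>x. \<Sum>m\<in>A. c m * ev (EF m) x) \<in> B" if "finite A" for A and c :: "_ \<Rightarrow> complex"
      using that
    proof (induction A rule: finite_induct)
      case empty
      then show ?case using B(1) by (simp add: is_subalgebra_def hecke_algebra_def)
    next
      case (insert m A)
      have "(\<lambda>x. c m * ev (EF m) x) \<in> B"
        using B(1) EF [of m] by (simp add: is_subalgebra_def hecke_algebra_def)
      then show ?case
        using B(1) insert by (simp add: is_subalgebra_def hecke_algebra_def)
    qed
    from this [OF finite_keys] have "ev (\<Phi> p) \<in> B" for p
      unfolding ev_\<Phi> .
    then show ?thesis by blast
  qed
  have "\<Inter>{B. is_subalgebra B hecke_algebra \<and> ?S \<subseteq> B} = ?R"
  proof (rule equalityI)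
    show "\<Inter>{B. is_subalgebra B hecke_algebra \<and> ?S \<subseteq> B} \<subseteq> ?R"
      by (rule Inter_lower) (use sub gen in simp)
    show "?R \<subseteq> \<Inter>{B. is_subalgebra B hecke_algebra \<and> ?S \<subseteq> B}"
      by (rule Inter_greatest) (use min in simp)
  qed
  then show ?thesis
    by (simp add: Theta_algebra_def generated_subalgebra_def)
qed

end

section \<open>The quotient algebra\<close>

lemma cring_ring_of_class: "cring (ring_of_class :: 'a::comm_ring_1 ring)"
proof (rule cringI)
  show "abelian_group (ring_of_class :: 'a ring)"
  proof (rule abelian_groupI)
    fix x :: 'a
    show "\<exists>y\<in>carrier ring_of_class. y \<oplus>\<^bsub>ring_of_class\<^esub> x = \<zero>\<^bsub>ring_of_class\<^esub>"
      by (rule bexI [of _ "- x"]) (simp_all add: ring_of_class_def)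
  qed (simp_all add: ring_of_class_def add_ac)
  show "comm_monoid (ring_of_class :: 'a ring)"
    by (rule comm_monoidI) (simp_all add: ring_of_class_def mult_ac)
qed (simp add: ring_of_class_def distrib_right)

lemma principal_ideal_YZ:
  "p \<in> PIdl\<^bsub>ring_of_class\<^esub> (Y_var * Z_var) \<longleftrightarrow>
   (\<forall>a b c. (a, b, c) \<in> Poly_Mapping.keys p \<longrightarrow> b > 0 \<and> c > 0)"
proof -
  have YZ: "Y_var * Z_var = Poly_Mapping.single (0, 1, 1) 1"
    by (simp add: Y_var_def Z_var_def mult_single)
  have PIdl: "p \<in> PIdl\<^bsub>ring_of_class\<^esub> (Y_var * Z_var) \<longleftrightarrow> (\<exists>r. p = r * Poly_Mapping.single (0, 1, 1) 1)"
    by (auto simp: cgenideal_def ring_of_class_def YZ)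
  show ?thesis
    unfolding PIdl
  proof
    assume "\<exists>r. p = r * Poly_Mapping.single (0, 1, 1) 1"
    then obtain r where r: "p = r * Poly_Mapping.single (0, 1, 1) 1" by blast
    show "\<forall>a b c. (a, b, c) \<in> Poly_Mapping.keys p \<longrightarrow> b > 0 \<and> c > 0"
      using keys_mult [of r "Poly_Mapping.single (0, 1, 1) 1"] unfolding r by fastforce
  next
    assume *: "\<forall>a b c. (a, b, c) \<in> Poly_Mapping.keys p \<longrightarrow> b > 0 \<and> c > 0"
    define s :: "int \<times> nat \<times> nat \<Rightarrow> _" where "s = (\<lambda>(a, b, c). (a, b - 1, c - 1))"
    have s: "s m + (0, 1, 1) = m" if "m \<in> Poly_Mapping.keys p" for m
      using * that by (cases m) (auto simp: s_def)
    have "(\<Sum>m\<in>Poly_Mapping.keys p. Poly_Mapping.single (s m) (Poly_Mapping.lookup p m)) *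
        Poly_Mapping.single (0, 1, 1) 1 =
        (\<Sum>m\<in>Poly_Mapping.keys p. Poly_Mapping.single (s m + (0, 1, 1)) (Poly_Mapping.lookup p m))"
      by (simp add: sum_distrib_right mult_single)
    also have "\<dots> = (\<Sum>m\<in>Poly_Mapping.keys p. Poly_Mapping.single m (Poly_Mapping.lookup p m))"
      by (intro sum.cong refl) (simp only: s)
    finally show "\<exists>r. p = r * Poly_Mapping.single (0, 1, 1) 1"
      unfolding sum_singles by metis
  qed
qed

theorem proposition3p2:
  fixes v :: "'f::field \<Rightarrow> int \<times> int" and t1 t2 :: 'f and q :: nat
  assumes "sl2_two_dim_local_field v t1 t2 q"
  shows "algebra_isomorphic (sl2_data.Theta_algebra v t1 t2 q) quotient_algebra_YZ"
proof -
  interpret sl2_two_dim_local_field v t1 t2 q by (rule assms)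
  let ?R = "ring_of_class :: laurent_XYZ ring"
  define I where "I = PIdl\<^bsub>?R\<^esub> (Y_var * Z_var)"
  interpret R: cring ?R by (rule cring_ring_of_class)
  interpret I: ideal I ?R
    unfolding I_def by (rule R.cgenideal_ideal) (simp add: ring_of_class_def)
  have R [simp]: "carrier ?R = UNIV" "a \<oplus>\<^bsub>?R\<^esub> b = a + b" "a \<otimes>\<^bsub>?R\<^esub> b = a * b" "\<one>\<^bsub>?R\<^esub> = 1" for a b
    by (simp_all add: ring_of_class_def)
  have coset: "I +>\<^bsub>?R\<^esub> p = {p'. \<Phi> p' = \<Phi> p}" for p
  proof -
    have "p' \<in> I +>\<^bsub>?R\<^esub> p \<longleftrightarrow> p' - p \<in> I" for p'
      by (auto simp: a_r_coset_def' intro: bexI [of _ "p' - p"])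
    then show ?thesis
      unfolding \<Phi>_eq_iff \<Phi>_eq_0_iff by (auto simp: I_def principal_ideal_YZ)
  qed
  \<comment> \<open>The inverse of the isomorphism induced by \<open>\<Phi>\<close>: the fibres of \<open>\<Phi>\<close> are the cosets of \<open>I\<close>.\<close>
  define h where "h f = {p. ev (\<Phi> p) = f}" for f
  have h: "h (ev (\<Phi> p)) = I +>\<^bsub>?R\<^esub> p" for p
    by (simp add: h_def coset ev_eq_iff)
  have Q: "carrier quotient_algebra_YZ = range (\<lambda>p. I +>\<^bsub>?R\<^esub> p)"
    "(I +>\<^bsub>?R\<^esub> p) \<otimes>\<^bsub>quotient_algebra_YZ\<^esub> (I +>\<^bsub>?R\<^esub> p') = I +>\<^bsub>?R\<^esub> (p * p')"
    "(I +>\<^bsub>?R\<^esub> p) \<oplus>\<^bsub>quotient_algebra_YZ\<^esub> (I +>\<^bsub>?R\<^esub> p') = I +>\<^bsub>?R\<^esub> (p + p')"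
    "\<one>\<^bsub>quotient_algebra_YZ\<^esub> = I +>\<^bsub>?R\<^esub> 1"
    "c \<odot>\<^bsub>quotient_algebra_YZ\<^esub> (I +>\<^bsub>?R\<^esub> p) = I +>\<^bsub>?R\<^esub> (Poly_Mapping.single 0 c * p)" for p p' c
    using I.rcoset_mult_add [of p p'] I.a_rcos_sum [of p p'] I.rcoset_mult_add [of "Poly_Mapping.single 0 c" p]
    by (auto simp: quotient_algebra_YZ_def Let_def ring.extend_def FactRing_def A_RCOSETS_def' simp flip: I_def)
  have A: "f \<otimes>\<^bsub>Theta_algebra\<^esub> g = conv f g" "f \<oplus>\<^bsub>Theta_algebra\<^esub> g = (\<lambda>x. f x + g x)"
    "\<one>\<^bsub>Theta_algebra\<^esub> = iota" "c \<odot>\<^bsub>Theta_algebra\<^esub> f = (\<lambda>x. c * f x)" for f g c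
    by (simp_all add: Theta_algebra_def generated_subalgebra_def hecke_algebra_def)
  have one: "iota = ev (\<Phi> 1)"
  proof -
    have "\<Phi> 1 = EF 0"
      using \<Phi>_single [of 0 1] by (simp add: fun_eq_iff)
    then show ?thesis by (simp add: iota_ev)
  qed
  have "h \<in> ring_hom Theta_algebra quotient_algebra_YZ"
    by (rule ring_hom_memI) (auto simp: Theta_algebra_carrier A Q h \<Phi>_mult one simp flip: ev_\<Phi>_add)
  moreover have "bij_betw h (carrier Theta_algebra) (carrier quotient_algebra_YZ)"
    unfolding bij_betw_def
  proof
    show "inj_on h (carrier Theta_algebra)"
      unfolding Theta_algebra_carrier inj_on_def h_def by blast
    show "h ` carrier Theta_algebra = carrier quotient_algebra_YZ"
      unfolding Theta_algebra_carrier Q by (simp add: image_image h)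
  qed
  moreover have "h (c \<odot>\<^bsub>Theta_algebra\<^esub> f) = c \<odot>\<^bsub>quotient_algebra_YZ\<^esub> h f"
    if "f \<in> carrier Theta_algebra" for c f
    using that by (auto simp: Theta_algebra_carrier A Q h simp flip: ev_\<Phi>_smult)
  ultimately show ?thesis
    unfolding algebra_isomorphic_def ring_iso_def by blast
qed

end
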